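(* Let $R$ be a commutative Noetherian ring, $I$ a proper ideal of $R$, and $n\geq 1$ an integer. Then the following conditions are equivalent: (1) $R$ is $I$-Cohen Macaulay. (2) The polynomial ring $R[x_1,\dots,x_n]$ is $I[x_1,\dots,x_n]$-Cohen Macaulay and $\operatorname{grade}(I[x_1,\dots,x_n],R[x_1,\dots,x_n])=\operatorname{grade}(I,R)$. (3) The formal power series ring $R[[x_1,\dots,x_n]]$ is $I[[x_1,\dots,x_n]]$-Cohen Macaulay and $\operatorname{grade}(I[[x_1,\dots,x_n]],R[[x_1,\dots,x_n]])=\operatorname{grade}(I,R)$.
   Context: For a proper ideal $J$ of a commutative Noetherian ring $A$, a finitely generated $A$-module $L$ is called $J$-Cohen Macaulay (over $A$) if $\operatorname{grade}(J,L)+\dim_A(L/JL)=\dim_A(L)$, where $\operatorname{grade}(J,L)$ is the length of a maximal $L$-regular sequence contained in $J$ and $\dim$ denotes Krull dimension. A ring $A$ is called $J$-Cohen Macaulay if it is so as a module over itself. $I[x_1,\dots,x_n]$ and $I[[x_1,\dots,x_n]]$ denote the ideals of polynomials, respectively formal power series, with all coefficients in $I$. *)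

theory Defs
  imports
    "HOL-Algebra.Module"
    "HOL-Algebra.QuotRing"
    "HOL-Algebra.Ring_Divisibility"
    "HOL-Library.Multiset"
    "HOL-Library.Extended_Real"
begin

section \<open>Modules\<close>

definition self_module :: "('a, 'm) ring_scheme \<Rightarrow> ('a, 'a) module"
  where "self_module A =
    \<lparr>carrier = carrier A, mult = mult A, one = one A, zero = zero A, add = add A,
     smult = mult A\<rparr>"

definition module_span ::
    "('a, 'm) ring_scheme \<Rightarrow> ('a, 'b, 'c) module_scheme \<Rightarrow> 'b set \<Rightarrow> 'b set"
  where "module_span A L S = \<Inter>{N. submodule N A L \<and> S \<subseteq> N}"

definition fin_gen_module :: "('a, 'm) ring_scheme \<Rightarrow> ('a, 'b, 'c) module_scheme \<Rightarrow> bool"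
  where "fin_gen_module A L \<longleftrightarrow>
    (\<exists>S. finite S \<and> S \<subseteq> carrier L \<and> module_span A L S = carrier L)"

definition ideal_smult ::
    "('a, 'm) ring_scheme \<Rightarrow> 'a set \<Rightarrow> ('a, 'b, 'c) module_scheme \<Rightarrow> 'b set"
  where "ideal_smult A J L = module_span A L {a \<odot>\<^bsub>L\<^esub> x | a x. a \<in> J \<and> x \<in> carrier L}"

text \<open>The record type of modules extends that of rings; the two multiplicative fields carry no
  information for a module and are left unspecified here.\<close>

definition quot_module :: "('a, 'b, 'c) module_scheme \<Rightarrow> 'b set \<Rightarrow> ('a, 'b set) module"
  where "quot_module L N =
    \<lparr>carrier = a_rcosets\<^bsub>L\<^esub> N, mult = (\<lambda>_ _. undefined), one = undefined,
     zero = N, add = set_add L,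
     smult = (\<lambda>a X. \<Union>x\<in>X. N +>\<^bsub>L\<^esub> (a \<odot>\<^bsub>L\<^esub> x))\<rparr>"

definition annihilator :: "('a, 'm) ring_scheme \<Rightarrow> ('a, 'b, 'c) module_scheme \<Rightarrow> 'a set"
  where "annihilator A L = {a \<in> carrier A. \<forall>x\<in>carrier L. a \<odot>\<^bsub>L\<^esub> x = \<zero>\<^bsub>L\<^esub>}"


section \<open>Krull dimension\<close>

text \<open>Extended reals are used so that the dimension is infinite for chains of unbounded length and
  minus infinity for the zero ring and the zero module.\<close>

definition krull_dim :: "('a, 'm) ring_scheme \<Rightarrow> ereal"
  where "krull_dim A = Sup {ereal (real k) | k.
    \<exists>P :: nat \<Rightarrow> 'a set. (\<forall>i\<le>k. primeideal (P i) A) \<and> (\<forall>i<k. P i \<subset> P (Suc i))}"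

definition module_dim :: "('a, 'm) ring_scheme \<Rightarrow> ('a, 'b, 'c) module_scheme \<Rightarrow> ereal"
  where "module_dim A L = krull_dim (A Quot annihilator A L)"


section \<open>Regular sequences and grade\<close>

definition regular_seq ::
    "('a, 'm) ring_scheme \<Rightarrow> ('a, 'b, 'c) module_scheme \<Rightarrow> 'a list \<Rightarrow> bool"
  where "regular_seq A L xs \<longleftrightarrow>
    set xs \<subseteq> carrier A \<and>
    (\<forall>i<length xs.
       let Q = quot_module L (ideal_smult A (Idl\<^bsub>A\<^esub> (set (take i xs))) L)
       in \<forall>z\<in>carrier Q. (xs ! i) \<odot>\<^bsub>Q\<^esub> z = \<zero>\<^bsub>Q\<^esub> \<longrightarrow> z = \<zero>\<^bsub>Q\<^esub>) \<and>
    ideal_smult A (Idl\<^bsub>A\<^esub> (set xs)) L \<noteq> carrier L"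

definition maximal_regular_seq_in ::
    "('a, 'm) ring_scheme \<Rightarrow> ('a, 'b, 'c) module_scheme \<Rightarrow> 'a set \<Rightarrow> 'a list \<Rightarrow> bool"
  where "maximal_regular_seq_in A L J xs \<longleftrightarrow>
    regular_seq A L xs \<and> set xs \<subseteq> J \<and> (\<forall>y\<in>J. \<not> regular_seq A L (xs @ [y]))"

text \<open>Over a Noetherian ring, for finitely generated \<open>L\<close> with \<open>JL \<noteq> L\<close>, maximal \<open>L\<close>-regular
  sequences in \<open>J\<close> exist and all have the same length, so the description is proper.\<close>

definition grade :: "('a, 'm) ring_scheme \<Rightarrow> 'a set \<Rightarrow> ('a, 'b, 'c) module_scheme \<Rightarrow> nat"
  where "grade A J L = (THE k. \<exists>xs. maximal_regular_seq_in A L J xs \<and> length xs = k)"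


section \<open>Cohen--Macaulayness with respect to an ideal\<close>

text \<open>The first four conditions are the standing assumptions under which the notion is defined.\<close>

definition ideal_cohen_macaulay_module ::
    "('a, 'm) ring_scheme \<Rightarrow> 'a set \<Rightarrow> ('a, 'b, 'c) module_scheme \<Rightarrow> bool"
  where "ideal_cohen_macaulay_module A J L \<longleftrightarrow>
    cring A \<and> noetherian_ring A \<and>
    (ideal J A \<and> J \<noteq> carrier A) \<and>
    (module A L \<and> fin_gen_module A L) \<and>
    ereal (real (grade A J L)) + module_dim A (quot_module L (ideal_smult A J L))
      = module_dim A L"

definition ideal_cohen_macaulay_ring :: "('a, 'm) ring_scheme \<Rightarrow> 'a set \<Rightarrow> bool"
  where "ideal_cohen_macaulay_ring A J \<longleftrightarrow> ideal_cohen_macaulay_module A J (self_module A)"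


section \<open>Polynomials and formal power series in finitely many variables\<close>

text \<open>As in \<open>HOL-Algebra.Indexed_Polynomials\<close>, a monomial is a multiset of variables and a series is
  the function sending a monomial to its coefficient. The variables are \<open>0, \<dots>, n - 1\<close>;
  coefficients at monomials in other variables are required to vanish.\<close>

definition mseries_carrier :: "('a, 'm) ring_scheme \<Rightarrow> nat \<Rightarrow> (nat multiset \<Rightarrow> 'a) set"
  where "mseries_carrier R n =
    {f. (\<forall>m. f m \<in> carrier R) \<and> (\<forall>m. \<not> set_mset m \<subseteq> {..<n} \<longrightarrow> f m = \<zero>\<^bsub>R\<^esub>)}"

definition mpoly_carrier :: "('a, 'm) ring_scheme \<Rightarrow> nat \<Rightarrow> (nat multiset \<Rightarrow> 'a) set"
  where "mpoly_carrier R n = {f \<in> mseries_carrier R n. finite {m. f m \<noteq> \<zero>\<^bsub>R\<^esub>}}"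

definition mseries_ring :: "('a, 'm) ring_scheme \<Rightarrow> nat \<Rightarrow> (nat multiset \<Rightarrow> 'a) ring"
  where "mseries_ring R n =
    \<lparr>carrier = mseries_carrier R n,
     mult = (\<lambda>f g m. \<Oplus>\<^bsub>R\<^esub>k\<in>{k. k \<subseteq># m}. f k \<otimes>\<^bsub>R\<^esub> g (m - k)),
     one = (\<lambda>m. if m = {#} then \<one>\<^bsub>R\<^esub> else \<zero>\<^bsub>R\<^esub>),
     zero = (\<lambda>m. \<zero>\<^bsub>R\<^esub>),
     add = (\<lambda>f g m. f m \<oplus>\<^bsub>R\<^esub> g m)\<rparr>"

definition mpoly_ring :: "('a, 'm) ring_scheme \<Rightarrow> nat \<Rightarrow> (nat multiset \<Rightarrow> 'a) ring"
  where "mpoly_ring R n = (mseries_ring R n)\<lparr>carrier := mpoly_carrier R n\<rparr>"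

definition mseries_ideal ::
    "('a, 'm) ring_scheme \<Rightarrow> nat \<Rightarrow> 'a set \<Rightarrow> (nat multiset \<Rightarrow> 'a) set"
  where "mseries_ideal R n I = {f \<in> mseries_carrier R n. \<forall>m. f m \<in> I}"

definition mpoly_ideal ::
    "('a, 'm) ring_scheme \<Rightarrow> nat \<Rightarrow> 'a set \<Rightarrow> (nat multiset \<Rightarrow> 'a) set"
  where "mpoly_ideal R n I = {f \<in> mpoly_carrier R n. \<forall>m. f m \<in> I}"

end

theory Submission
  imports Defs "HOL-Algebra.Subrings" "HOL-Library.Multiset_Order"
begin

text \<open>Let \<open>S\<close> be the polynomial or the power series ring in \<open>n\<close> variables over \<open>R\<close>. A maximal regular
  sequence \<open>xs\<close> in \<open>I\<close> comes with some \<open>z\<close> outside \<open>(xs)\<close> such that \<open>Iz\<close> lies in \<open>(xs)\<close>. Comparing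
  coefficients, \<open>xs\<close> is still regular over \<open>S\<close>, and \<open>z\<close> still witnesses its maximality in \<open>IS\<close>; as all
  maximal regular sequences have the same length (Rees), the grades agree. So the
  claim reduces to \<open>dim S = dim R + n\<close> and \<open>dim S/IS = dim R/I + n\<close>. Both are instances of a
  statement about chains of primes above a given ideal, which avoids working in quotients. The lower
  bound is explicit; for the upper bound variables are added one at a time. If a prime
  \<open>p\<close> of \<open>R\<close> has height at most \<open>d\<close>, it is minimal over \<open>d\<close> elements, and a prime of \<open>R[x]\<close>
  over \<open>p\<close> (for \<open>R[[x]]\<close>, one that contains \<open>x\<close>) is minimal over these and one more, so Krull's
  height theorem applies.\<close>

text \<open>Localization is avoided as well: a statement about R_P becomes one with multipliers
  \<open>s\<close> outside \<open>P\<close>. The finite length of (R/K)_P for \<open>P\<close>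
  minimal over \<open>K\<close>, on which Krull's principal ideal theorem rests, then reads:
  descending chains of ideals above \<open>K\<close> are locally stationary. It is proved by
  Noetherian induction along 0 -> R/(K : x) -> R/K -> R/(K + Rx) -> 0. In the same spirit Ext^n(R/J,
  R) is represented by the elements of R/(xs) killed by \<open>J\<close>, for a regular sequence
  \<open>xs\<close> of length n in \<open>J\<close>; Rees' theorem says that the existence of
  nonzero ones depends on n only, and follows by exchanging one element at a time. In the power
  series ring the top prime of a chain need not contain x. Since x lies in the Jacobson radical, the
  top can be replaced by a larger prime that does, without shortening the chain. For polynomials no
  such enlargement is available in general; the extra generator is found inside the given prime by
  division with remainder in the fibre. Dimensions may be infinite; the final comparison cancels
  only the finite number n.\<close>

lemma (in cring) idealI':
  assumes "K \<subseteq> carrier R" "\<zero> \<in> K"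
    and "\<And>a b. a \<in> K \<Longrightarrow> b \<in> K \<Longrightarrow> a \<oplus> b \<in> K"
    and "\<And>a r. a \<in> K \<Longrightarrow> r \<in> carrier R \<Longrightarrow> r \<otimes> a \<in> K"
  shows "ideal K R"
proof (rule idealI)
  show "ring R" by (rule ring_axioms)
  show "subgroup K (add_monoid R)"
  proof (rule add.subgroupI)
    fix a assume a: "a \<in> K"
    have "\<ominus> \<one> \<otimes> a \<in> K" using assms(4) a by simp
    then show "\<ominus> a \<in> K" using a assms(1) by (simp add: l_minus subset_eq)
  qed (use assms in auto)
  fix a x assume a: "a \<in> K" and x: "x \<in> carrier R"
  show "x \<otimes> a \<in> K" using assms(4) a x by blast
  then show "a \<otimes> x \<in> K" using a x assms(1) by (metis m_comm subsetD)
qed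

lemma (in cring) primeidealI':
  assumes "ideal P R" "\<one> \<notin> P"
    and "\<And>a b. a \<in> carrier R \<Longrightarrow> b \<in> carrier R \<Longrightarrow> a \<otimes> b \<in> P \<Longrightarrow> a \<in> P \<or> b \<in> P"
  shows "primeideal P R"
  using assms by (intro primeidealI) (auto simp: cring_axioms)

lemma (in ideal) minus_mem: "a \<in> I \<Longrightarrow> b \<in> I \<Longrightarrow> a \<ominus> b \<in> I"
  by (simp add: a_minus_def)

lemma (in ideal) add_cancel_mem:
  assumes "a \<in> carrier R" "b \<in> I" "a \<oplus> b \<in> I"
  shows "a \<in> I"
proof -
  have "(a \<oplus> b) \<ominus> b \<in> I" using assms minus_mem by blast
  moreover have "(a \<oplus> b) \<ominus> b = a" using assms Icarr[of b] by (simp add: a_minus_def a_assoc r_neg)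
  ultimately show ?thesis by simp
qed

lemma (in ideal) finsum_mem: "(\<And>i. i \<in> A \<Longrightarrow> f i \<in> I) \<Longrightarrow> finsum R f A \<in> I"
proof (induction A rule: infinite_finite_induct)
  case (insert i A)
  then have "f \<in> A \<rightarrow> carrier R" "f i \<in> carrier R" using Icarr by auto
  then show ?case using insert by simp
qed simp_all

lemma (in primeideal) one_notin: "\<one> \<notin> I"
  using I_notcarr one_imp_carrier by blast

lemma (in primeideal) mult_mem_iff:
  "a \<in> carrier R \<Longrightarrow> b \<in> carrier R \<Longrightarrow> a \<otimes> b \<in> I \<longleftrightarrow> a \<in> I \<or> b \<in> I"
  using I_prime I_l_closed I_r_closed by blast

lemma (in primeideal) pow_mem:
  "a \<in> carrier R \<Longrightarrow> a [^] (k::nat) \<in> I \<Longrightarrow> a \<in> I"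
proof (induction k)
  case 0
  then show ?case using one_notin by simp
qed (auto simp: mult_mem_iff)

subsection \<open>Adjoining an element to an ideal, and ideal quotients\<close>

definition adjoin :: "('a, 'm) ring_scheme \<Rightarrow> 'a set \<Rightarrow> 'a \<Rightarrow> 'a set"
  where "adjoin R K x = {k \<oplus>\<^bsub>R\<^esub> r \<otimes>\<^bsub>R\<^esub> x | k r. k \<in> K \<and> r \<in> carrier R}"

text \<open>The annihilator of the image of \<open>x\<close> in R/K. If xy lies in \<open>K\<close>
  but x and y do not, both outer terms of 0 -> R/(K : x) -> R/K -> R/(K + Rx) -> 0 belong to larger
  ideals, which drives the Noetherian inductions.\<close>

definition colon :: "('a, 'm) ring_scheme \<Rightarrow> 'a set \<Rightarrow> 'a \<Rightarrow> 'a set"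
  where "colon R K x = {r \<in> carrier R. r \<otimes>\<^bsub>R\<^esub> x \<in> K}"

context cring
begin

lemma adjoin_ideal:
  assumes K: "ideal K R" and x: "x \<in> carrier R"
  shows "ideal (adjoin R K x) R"
proof -
  interpret K: ideal K R by fact
  show ?thesis
  proof (rule idealI')
    show "adjoin R K x \<subseteq> carrier R" using x K.Icarr by (auto simp: adjoin_def)
    have "\<zero> = \<zero> \<oplus> \<zero> \<otimes> x" using x by simp
    then show "\<zero> \<in> adjoin R K x" unfolding adjoin_def using K.zero_closed by blast
  next
    fix a b assume "a \<in> adjoin R K x" "b \<in> adjoin R K x"
    then obtain k r l s where *: "a = k \<oplus> r \<otimes> x" "b = l \<oplus> s \<otimes> x" "k \<in> K" "l \<in> K"
      "r \<in> carrier R" "s \<in> carrier R" unfolding adjoin_def by blast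
    have "k \<in> carrier R" "l \<in> carrier R" using * K.Icarr by auto
    then have "a \<oplus> b = (k \<oplus> l) \<oplus> (r \<oplus> s) \<otimes> x" using * x by algebra
    then show "a \<oplus> b \<in> adjoin R K x" unfolding adjoin_def using * K.a_closed by blast
  next
    fix a t assume "a \<in> adjoin R K x" and t: "t \<in> carrier R"
    then obtain k r where *: "a = k \<oplus> r \<otimes> x" "k \<in> K" "r \<in> carrier R"
      unfolding adjoin_def by blast
    have "k \<in> carrier R" using * K.Icarr by auto
    then have "t \<otimes> a = t \<otimes> k \<oplus> (t \<otimes> r) \<otimes> x" using * x t by algebra
    then show "t \<otimes> a \<in> adjoin R K x" unfolding adjoin_def using * t K.I_l_closed m_closed by blast
  qed
qed

lemma adjoin_supset: "ideal K R \<Longrightarrow> x \<in> carrier R \<Longrightarrow> K \<subseteq> adjoin R K x"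
proof
  fix k assume "ideal K R" "x \<in> carrier R" "k \<in> K"
  then have "k = k \<oplus> \<zero> \<otimes> x" by (simp add: ideal.Icarr)
  then show "k \<in> adjoin R K x" unfolding adjoin_def using \<open>k \<in> K\<close> by blast
qed

lemma adjoin_self: "ideal K R \<Longrightarrow> x \<in> carrier R \<Longrightarrow> x \<in> adjoin R K x"
proof -
  assume *: "ideal K R" "x \<in> carrier R"
  then have "x = \<zero> \<oplus> \<one> \<otimes> x" by simp
  then show ?thesis unfolding adjoin_def
    using additive_subgroup.zero_closed[OF ideal.axioms(1)[OF *(1)]] by blast
qed

lemma adjoin_least:
  assumes "ideal L R" "K \<subseteq> L" "x \<in> L"
  shows "adjoin R K x \<subseteq> L"
proof -
  interpret L: ideal L R by fact
  show ?thesis using assms L.I_l_closed L.a_closed by (auto simp: adjoin_def)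
qed

lemma adjoin_commute:
  assumes "ideal K R" "x \<in> carrier R" "y \<in> carrier R"
  shows "adjoin R (adjoin R K x) y = adjoin R (adjoin R K y) x"
proof -
  have "adjoin R (adjoin R K x) y \<subseteq> adjoin R (adjoin R K y) x"
    if x: "x \<in> carrier R" and y: "y \<in> carrier R" for x y
  proof -
    have K: "ideal (adjoin R K y) R" using assms(1) y by (rule adjoin_ideal)
    have sub: "adjoin R K y \<subseteq> adjoin R (adjoin R K y) x" using K x by (rule adjoin_supset)
    show ?thesis
    proof (intro adjoin_least)
      show "ideal (adjoin R (adjoin R K y) x) R" using K x by (rule adjoin_ideal)
      then show "ideal (adjoin R (adjoin R K y) x) R" .
      show "K \<subseteq> adjoin R (adjoin R K y) x" using sub adjoin_supset[OF assms(1) y] by blast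
      show "x \<in> adjoin R (adjoin R K y) x" using K x by (rule adjoin_self)
      show "y \<in> adjoin R (adjoin R K y) x" using sub adjoin_self[OF assms(1) y] by blast
    qed
  qed
  then show ?thesis using assms(2,3) by blast
qed

lemma adjoin_psupset: "ideal K R \<Longrightarrow> x \<in> carrier R \<Longrightarrow> x \<notin> K \<Longrightarrow> K \<subset> adjoin R K x"
  using adjoin_supset adjoin_self by blast

lemma colon_ideal:
  assumes K: "ideal K R" and x: "x \<in> carrier R"
  shows "ideal (colon R K x) R"
proof -
  interpret K: ideal K R by fact
  show ?thesis
    by (rule idealI') (use x in \<open>auto simp: colon_def l_distr m_assoc K.I_l_closed\<close>)
qed

lemma colon_supset: "ideal K R \<Longrightarrow> x \<in> carrier R \<Longrightarrow> K \<subseteq> colon R K x"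
  by (auto simp: colon_def ideal.I_r_closed ideal.Icarr)

lemma mem_colon_iff: "r \<in> colon R K x \<longleftrightarrow> r \<in> carrier R \<and> r \<otimes> x \<in> K"
  by (simp add: colon_def)

end

subsection \<open>Noetherian rings\<close>

locale noetherian_cring = cring + noetherian_ring
begin

lemma ex_maximal:
  assumes "\<S> \<noteq> {}" "\<And>K. K \<in> \<S> \<Longrightarrow> ideal K R"
  shows "\<exists>M\<in>\<S>. \<forall>N\<in>\<S>. M \<subseteq> N \<longrightarrow> N = M"
proof (rule subset_Zorn_nonempty[OF assms(1)])
    fix C assume C: "C \<noteq> {}" "subset.chain \<S> C"
    then have "subset.chain {I. ideal I R} C"
      using assms(2) by (auto simp: subset_chain_def)
    \<comment> \<open>\<open>ideal_chain_is_trivial\<close> is the ascending chain condition: a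
      nonempty chain of ideals contains its union.\<close>
    then have "\<Union>C \<in> C" using ideal_chain_is_trivial C(1) by blast
    then show "\<Union>C \<in> \<S>" using C(2) by (auto simp: subset_chain_def)
qed

text \<open>Noetherian induction: an ideal maximal among the counterexamples would satisfy the
  step.\<close>

lemma ideal_induct [consumes 1, case_names step]:
  assumes "ideal K R"
    and "\<And>K. ideal K R \<Longrightarrow> (\<And>K'. ideal K' R \<Longrightarrow> K \<subset> K' \<Longrightarrow> Q K') \<Longrightarrow> Q K"
  shows "Q K"
proof (rule ccontr)
  assume "\<not> Q K"
  then have "{K. ideal K R \<and> \<not> Q K} \<noteq> {}" using assms(1) by blast
  then have "\<exists>M\<in>{K. ideal K R \<and> \<not> Q K}. \<forall>N\<in>{K. ideal K R \<and> \<not> Q K}. M \<subseteq> N \<longrightarrow> N = M"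
    by (rule ex_maximal) simp
  then obtain M where M: "ideal M R" "\<not> Q M" "\<And>N. ideal N R \<Longrightarrow> \<not> Q N \<Longrightarrow> M \<subseteq> N \<Longrightarrow> N = M"
    by blast
  then show False using assms(2)[of M] by blast
qed

text \<open>A finite \<open>F\<close> with \<open>Idl F\<close> maximal gains nothing from a further
  element of \<open>X\<close>. The generators lie in \<open>X\<close> itself, which matters when
  \<open>X\<close> is not an ideal, as in \<open>finite_associated_primes\<close>.\<close>

lemma finite_subset_generates:
  assumes "X \<subseteq> carrier R"
  obtains F where "finite F" "F \<subseteq> X" "X \<subseteq> Idl F"
proof -
  let ?S = "{Idl F | F. finite F \<and> F \<subseteq> X}"
  have "?S \<noteq> {}" by auto
  then have "\<exists>M\<in>?S. \<forall>N\<in>?S. M \<subseteq> N \<longrightarrow> N = M"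
    by (rule ex_maximal) (use assms in \<open>auto intro!: genideal_ideal\<close>)
  then obtain M where M: "M \<in> ?S" "\<forall>N\<in>?S. M \<subseteq> N \<longrightarrow> N = M" ..
  then obtain F where F: "M = Idl F" "finite F" "F \<subseteq> X" by blast
  have "x \<in> Idl F" if "x \<in> X" for x
  proof -
    have sub: "insert x F \<subseteq> carrier R" using that F assms by auto
    have "Idl F \<subseteq> Idl (insert x F)" by (rule subset_Idl_subset[OF sub]) auto
    moreover have "Idl (insert x F) \<in> ?S" using that F by blast
    ultimately have "Idl (insert x F) = Idl F" using M(2)[rule_format, of "Idl (insert x F)"] F(1) by simp
    then show ?thesis using genideal_self[OF sub] by auto
  qed
  then show thesis using that F by blast
qed

lemma ascending_stabilises:
  assumes "\<And>i. ideal (K i) R" "\<And>i. K i \<subseteq> K (Suc i)"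
  obtains N where "\<And>i. N \<le> i \<Longrightarrow> K i = K N"
proof -
  have "\<exists>M\<in>range K. \<forall>N\<in>range K. M \<subseteq> N \<longrightarrow> N = M"
    by (rule ex_maximal) (use assms(1) in auto)
  then obtain M where M: "M \<in> range K" "\<forall>N\<in>range K. M \<subseteq> N \<longrightarrow> N = M" ..
  then obtain N where "M = K N" by blast
  then show thesis using that[of N] M(2) lift_Suc_mono_le[of K, OF assms(2)] by simp
qed

lemma ex_prime_supset:
  assumes "ideal K R" "K \<noteq> carrier R"
  obtains P where "primeideal P R" "K \<subseteq> P"
proof -
  let ?S = "{L. ideal L R \<and> K \<subseteq> L \<and> L \<noteq> carrier R}"
  have "?S \<noteq> {}" using assms by blast
  then have "\<exists>M\<in>?S. \<forall>N\<in>?S. M \<subseteq> N \<longrightarrow> N = M" by (rule ex_maximal) simp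
  then obtain M where M: "M \<in> ?S" "\<forall>N\<in>?S. M \<subseteq> N \<longrightarrow> N = M" ..
  have "maximalideal M R"
  proof (rule maximalidealI)
    fix J assume J: "ideal J R" "M \<subseteq> J" "J \<subseteq> carrier R"
    show "J = M \<or> J = carrier R"
    proof (cases "J = carrier R")
      case False
      then have "J \<in> ?S" using J M(1) by auto
      then show ?thesis using M(2)[rule_format, of J] J(2) by simp
    qed auto
  qed (use M in auto)
  then show thesis using that M(1) maximalideal_prime by blast
qed

text \<open>If xy lies in \<open>K\<close>, every prime above \<open>K\<close> contains K + Rx or K
  + Ry, so the two finite sets supplied by Noetherian induction can be united. The result contains
  all minimal primes, possibly with further ones.\<close>

lemma finite_minimal_primes:
  assumes "ideal K R"
  shows "\<exists>F. finite F \<and> (\<forall>p\<in>F. primeideal p R \<and> K \<subseteq> p) \<and>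
    (\<forall>q. primeideal q R \<longrightarrow> K \<subseteq> q \<longrightarrow> (\<exists>p\<in>F. p \<subseteq> q))"
  using assms
proof (induction K rule: ideal_induct)
  case (step K)
  interpret K: ideal K R by fact
  consider "\<one> \<in> K" | "primeideal K R"
    | x y where "x \<in> carrier R" "y \<in> carrier R" "x \<otimes> y \<in> K" "x \<notin> K" "y \<notin> K"
    using primeidealI'[OF step(1)] by blast
  then show ?case
  proof cases
    case 1
    then have "\<not> (primeideal q R \<and> K \<subseteq> q)" for q using primeideal.one_notin by blast
    then show ?thesis by (intro exI[of _ "{}"]) auto
  next
    case 2
    then show ?thesis by (intro exI[of _ "{K}"]) auto
  next
    case (3 x y)
    obtain F where F: "finite F" "\<forall>p\<in>F. primeideal p R \<and> adjoin R K x \<subseteq> p"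
      "\<forall>q. primeideal q R \<longrightarrow> adjoin R K x \<subseteq> q \<longrightarrow> (\<exists>p\<in>F. p \<subseteq> q)"
      using step(2)[of "adjoin R K x"] step(1) 3 adjoin_ideal adjoin_psupset by metis
    obtain G where G: "finite G" "\<forall>p\<in>G. primeideal p R \<and> adjoin R K y \<subseteq> p"
      "\<forall>q. primeideal q R \<longrightarrow> adjoin R K y \<subseteq> q \<longrightarrow> (\<exists>p\<in>G. p \<subseteq> q)"
      using step(2)[of "adjoin R K y"] step(1) 3 adjoin_ideal adjoin_psupset by metis
    have "\<exists>p\<in>F \<union> G. p \<subseteq> q" if q: "primeideal q R" "K \<subseteq> q" for q
    proof -
      have "x \<in> q \<or> y \<in> q" using primeideal.I_prime[OF q(1) 3(1,2)] 3(3) q(2) by blast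
      then have "adjoin R K x \<subseteq> q \<or> adjoin R K y \<subseteq> q"
        using adjoin_least[OF primeideal.axioms(1)[OF q(1)] q(2)] by auto
      then show ?thesis using F(3) G(3) q(1) by (meson UnI1 UnI2)
    qed
    moreover have "K \<subseteq> adjoin R K x" "K \<subseteq> adjoin R K y" using 3 adjoin_supset step(1) by auto
    moreover have "\<forall>p\<in>F \<union> G. primeideal p R \<and> K \<subseteq> p"
      using F(2) G(2) calculation(2,3) by (meson UnE subset_trans)
    ultimately show ?thesis using F(1) G(1) by (intro exI[of _ "F \<union> G"]) simp
  qed
qed

end

lemma (in cring) noetherianI:
  assumes "\<And>N. ideal N R \<Longrightarrow> \<exists>F. finite F \<and> F \<subseteq> N \<and> N \<subseteq> Idl F"
  shows "noetherian_cring R"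
proof -
  have "\<exists>A \<subseteq> carrier R. finite A \<and> N = Idl A" if N: "ideal N R" for N
  proof -
    obtain F where F: "finite F" "F \<subseteq> N" "N \<subseteq> Idl F" using assms[OF N] by blast
    have "Idl F \<subseteq> N" using genideal_minimal[OF N F(2)] .
    then show ?thesis using F ideal.Icarr[OF N] by (intro exI[of _ F]) auto
  qed
  then show ?thesis unfolding noetherian_cring_def
    by (auto intro!: noetherian_ringI cring_axioms)
qed

subsection \<open>Prime avoidance\<close>

lemma (in cring) prime_avoidance:
  assumes "finite F" "\<And>p. p \<in> F \<Longrightarrow> primeideal p R" "ideal J R" "J \<subseteq> \<Union>F"
  shows "\<exists>p\<in>F. J \<subseteq> p"
  using assms
proof (induction F rule: finite_psubset_induct)
  case (psubset F)
  interpret J: ideal J R by fact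
  show ?case
  proof (cases "\<exists>p\<in>F. J \<subseteq> \<Union>(F - {p})")
    case True
    then obtain p where "p \<in> F" "J \<subseteq> \<Union>(F - {p})" by blast
    then show ?thesis using psubset.IH[of "F - {p}"] psubset.prems by blast
  next
    case False
    have "\<exists>x. x \<in> J \<and> x \<in> p \<and> (\<forall>q\<in>F - {p}. x \<notin> q)" if p: "p \<in> F" for p
    proof -
      have "\<not> J \<subseteq> \<Union>(F - {p})" using False p by simp
      then obtain x where x: "x \<in> J" "x \<notin> \<Union>(F - {p})" unfolding subset_iff by metis
      then show ?thesis using psubset.prems(3) by (intro exI[of _ x]) auto
    qed
    then have "\<forall>p\<in>F. \<exists>x. x \<in> J \<and> x \<in> p \<and> (\<forall>q\<in>F - {p}. x \<notin> q)" ..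
    then obtain f where f': "\<forall>p\<in>F. f p \<in> J \<and> f p \<in> p \<and> (\<forall>q\<in>F - {p}. f p \<notin> q)"
      by (elim bchoice[THEN exE])
    then have f: "\<And>p. p \<in> F \<Longrightarrow> f p \<in> J" "\<And>p. p \<in> F \<Longrightarrow> f p \<in> p"
      "\<And>p q. p \<in> F \<Longrightarrow> q \<in> F \<Longrightarrow> q \<noteq> p \<Longrightarrow> f p \<notin> q" by auto
    have fc: "f p \<in> carrier R" if "p \<in> F" for p using f(1)[OF that] J.Icarr by simp
    have "F \<noteq> {}" using psubset.prems(3) subsetD[OF _ J.zero_closed] by blast
    then obtain p where p: "p \<in> F" by blast
    interpret p: primeideal p R using p psubset by blast
    define G where "G = F - {p}"
    have G: "finite G" "G \<subseteq> F" using psubset.hyps by (auto simp: G_def)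
    have prod: "finprod R f H \<in> carrier R \<and> (\<forall>q\<in>H. finprod R f H \<in> q) \<and> finprod R f H \<notin> p"
      if "finite H" "H \<subseteq> G" for H
      using that
    proof (induction H rule: finite_induct)
      case empty
      then show ?case using p.one_notin by simp
    next
      case (insert q H)
      have qF: "q \<in> F" "q \<noteq> p" using insert.prems G_def by auto
      have "f \<in> H \<rightarrow> carrier R" using insert.prems fc G by auto
      then have eq: "finprod R f (insert q H) = f q \<otimes> finprod R f H"
        using insert qF fc by simp
      have IH: "finprod R f H \<in> carrier R" "\<And>q. q \<in> H \<Longrightarrow> finprod R f H \<in> q" "finprod R f H \<notin> p"
        using insert by auto
      have "f q \<otimes> finprod R f H \<in> q'" if "q' \<in> insert q H" for q'
      proof -
        have "primeideal q' R" using that insert.prems G psubset.prems(1) by blast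
        then interpret q': primeideal q' R .
        show ?thesis using that IH f(2)[OF qF(1)] fc[OF qF(1)] q'.mult_mem_iff by auto
      qed
      moreover have "f q \<otimes> finprod R f H \<notin> p"
        using IH f(3)[OF qF(1) p] qF(2) fc[OF qF(1)] p.mult_mem_iff by auto
      ultimately show ?case using eq IH fc[OF qF(1)] by auto
    qed
    show ?thesis
    proof (cases "G = {}")
      case True
      then have "F = {p}" using p by (auto simp: G_def)
      then show ?thesis using psubset.prems(3) by simp
    next
      case False
      then obtain q where q: "q \<in> G" by blast
      let ?w = "finprod R f G"
      have w: "?w \<in> carrier R" "\<And>q. q \<in> G \<Longrightarrow> ?w \<in> q" "?w \<notin> p" using prod[OF G(1)] by auto
      \<comment> \<open>The index set is nonempty, and one factor from \<open>J\<close>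
        suffices.\<close>
      have wJ: "?w \<in> J"
      proof -
        have "?w = f q \<otimes> finprod R f (G - {q})"
          using finprod_insert[of "G - {q}" q f] G q fc by (auto simp: insert_absorb subset_eq)
        moreover have "finprod R f (G - {q}) \<in> carrier R" using prod[of "G - {q}"] G by auto
        ultimately show ?thesis using f(1)[of q] q G J.I_r_closed by auto
      qed
      have "f p \<oplus> ?w \<in> J" using f(1)[OF p] wJ J.a_closed by blast
      then obtain r where r: "r \<in> F" "f p \<oplus> ?w \<in> r" using psubset.prems(3) by blast
      interpret r: primeideal r R using r psubset by blast
      have False
      proof (cases "r = p")
        case True
        have "?w \<oplus> f p \<in> p" using r(2) True w fc[OF p] by (simp add: a_comm)
        then show False using p.add_cancel_mem[OF w(1) f(2)[OF p]] w(3) by blast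
      next
        case False
        then have "?w \<in> r" using w(2) r(1) by (auto simp: G_def)
        then have "f p \<in> r" using r.add_cancel_mem[OF fc[OF p]] r(2) by blast
        then show False using f(3)[OF p r(1)] False by blast
      qed
      then show ?thesis ..
    qed
  qed
qed

subsection \<open>Krull's height theorem\<close>

text \<open>A strict chain of m + 1 primes with top \<open>p\<close>. Only the bottom prime is
  tested against \<open>J\<close>, and \<open>J\<close> may be any set; the empty set admits all
  primes.\<close>

fun prime_chain :: "('a, 'm) ring_scheme \<Rightarrow> 'a set \<Rightarrow> nat \<Rightarrow> 'a set \<Rightarrow> bool" where
  "prime_chain R J 0 p \<longleftrightarrow> primeideal p R \<and> J \<subseteq> p"
| "prime_chain R J (Suc m) p \<longleftrightarrow> primeideal p R \<and> (\<exists>q. prime_chain R J m q \<and> q \<subset> p)"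

text \<open>\<open>J\<close> may be any set, so \<open>J \<union> X\<close> can be used in place of
  the ideal that it generates.\<close>

definition minimal_over :: "('a, 'm) ring_scheme \<Rightarrow> 'a set \<Rightarrow> 'a set \<Rightarrow> bool"
  where "minimal_over R J p \<longleftrightarrow> primeideal p R \<and> J \<subseteq> p \<and>
    (\<forall>q. primeideal q R \<longrightarrow> J \<subseteq> q \<longrightarrow> q \<subseteq> p \<longrightarrow> q = p)"

lemma prime_chainD: "prime_chain R J m p \<Longrightarrow> primeideal p R \<and> J \<subseteq> p"
  by (induction m arbitrary: p) auto

lemma prime_chain_SucI:
  "prime_chain R J m q \<Longrightarrow> q \<subset> p \<Longrightarrow> primeideal p R \<Longrightarrow> prime_chain R J (Suc m) p"
  by auto

lemma prime_chain_upward: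
  "prime_chain R J m p \<Longrightarrow> primeideal q R \<Longrightarrow> p \<subseteq> q \<Longrightarrow> prime_chain R J m q"
  by (cases m; simp; meson subset_trans psubset_subset_trans)

lemma adjoin_mono: "K \<subseteq> L \<Longrightarrow> adjoin R K x \<subseteq> adjoin R L x"
  unfolding adjoin_def by blast

section \<open>Local arguments and the height theorems\<close>

context noetherian_cring
begin

text \<open>Locally at \<open>P\<close> the ring R/K is Artinian when \<open>P\<close> is minimal
  over \<open>K\<close>, and zero when \<open>K\<close> is not contained in \<open>P\<close>. If
  \<open>K\<close> is neither prime nor the whole ring, some xy lies in \<open>K\<close> with x and
  y outside, and a chain is locally stationary as soon as its images in R/(K + Rx) and its colon
  ideals by x are.\<close>

lemma local_descending_chain:
  assumes "ideal K R" and P: "primeideal P R"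
    and "\<And>L. primeideal L R \<Longrightarrow> K \<subseteq> L \<Longrightarrow> L \<subseteq> P \<Longrightarrow> L = P"
    and "\<And>n. ideal (C n) R" "\<And>n. K \<subseteq> C n" "\<And>n. C (Suc n) \<subseteq> C n"
  shows "\<exists>N. \<forall>n\<ge>N. \<forall>c\<in>C n. \<exists>s\<in>carrier R - P. s \<otimes> c \<in> C (Suc n)"
  using assms(1,3-)
proof (induction K arbitrary: C rule: ideal_induct)
  case (step K)
  interpret P: primeideal P R by fact
  interpret K: ideal K R by fact
  have C: "\<And>n. ideal (C n) R" "\<And>n. K \<subseteq> C n" "\<And>n. C (Suc n) \<subseteq> C n" by fact+
  have Cc: "c \<in> carrier R" if "c \<in> C n" for c n using ideal.Icarr[OF C(1) that] .
  have outside: "\<exists>s\<in>carrier R - P. s \<otimes> c \<in> C (Suc n)" if "\<not> C (Suc n) \<subseteq> P" "c \<in> C n" for c n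
  proof -
    obtain s where s: "s \<in> C (Suc n)" "s \<notin> P" using \<open>\<not> C (Suc n) \<subseteq> P\<close> by auto
    have "s \<otimes> c \<in> C (Suc n)" using ideal.I_r_closed[OF C(1) s(1)] Cc that by simp
    then show ?thesis using s Cc by auto
  qed
  consider "\<not> K \<subseteq> P" | "K \<subseteq> P" "primeideal K R"
    | x y where "K \<subseteq> P" "x \<in> carrier R" "y \<in> carrier R" "x \<otimes> y \<in> K" "x \<notin> K" "y \<notin> K"
    using primeidealI'[OF step(1)] P.one_notin by auto
  then show ?case
  proof cases
    case 1
    then have "\<not> C (Suc n) \<subseteq> P" for n using C(2)[of "Suc n"] by auto
    then show ?thesis using outside by auto
  next
    case 2
    \<comment> \<open>Here R/K localized at \<open>P\<close> is a field: a member of the chain is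
      \<open>P\<close> or contains a local unit.\<close>
    then have KP: "K = P" using step.prems(1) by auto
    show ?thesis
    proof (cases "\<exists>N. C N \<subseteq> P")
      case False
      then show ?thesis using outside by auto
    next
      case True
      then obtain N where N: "C N \<subseteq> P" by auto
      have eq: "C n = P" if "n \<ge> N" for n
        using lift_Suc_antimono_le[of C, OF C(3) that] N C(2)[of n] KP by auto
      have "\<one> \<otimes> c \<in> C (Suc n)" if "n \<ge> N" "c \<in> C n" for n c
        using eq[of n] eq[of "Suc n"] that Cc[of c n] by simp
      then show ?thesis using P.one_notin by (intro exI[of _ N]) blast
    qed
  next
    case (3 x y)
    have "\<exists>N. \<forall>n\<ge>N. \<forall>c\<in>adjoin R (C n) x. \<exists>s\<in>carrier R - P. s \<otimes> c \<in> adjoin R (C (Suc n)) x"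
    proof (rule step.IH[of "adjoin R K x"])
      fix L assume "primeideal L R" "adjoin R K x \<subseteq> L" "L \<subseteq> P"
      then show "L = P" using step.prems(1) adjoin_supset[OF step(1) 3(2)] by auto
    qed (use 3 C step(1) in \<open>simp_all add: adjoin_ideal adjoin_psupset adjoin_mono\<close>)
    then obtain N1 where N1: "\<And>n c. n \<ge> N1 \<Longrightarrow> c \<in> adjoin R (C n) x \<Longrightarrow>
        \<exists>s\<in>carrier R - P. s \<otimes> c \<in> adjoin R (C (Suc n)) x" by auto
    \<comment> \<open>The colon ideals contain y because xy lies in \<open>K\<close>, so the
      induction hypothesis for K + Ry applies to them.\<close>
    have "\<exists>N. \<forall>n\<ge>N. \<forall>c\<in>colon R (C n) x. \<exists>s\<in>carrier R - P. s \<otimes> c \<in> colon R (C (Suc n)) x"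
    proof (rule step.IH[of "adjoin R K y"])
      fix L assume "primeideal L R" "adjoin R K y \<subseteq> L" "L \<subseteq> P"
      then show "L = P" using step.prems(1) adjoin_supset[OF step(1) 3(3)] by auto
    next
      fix n
      have "y \<in> colon R (C n) x" using 3 C(2)[of n] by (auto simp: colon_def m_comm)
      then show "adjoin R K y \<subseteq> colon R (C n) x"
        using 3 C(1) subset_trans[OF C(2) colon_supset[OF C(1) 3(2)]]
        by (intro adjoin_least) (simp_all add: colon_ideal)
      show "colon R (C (Suc n)) x \<subseteq> colon R (C n) x" using C(3) by (auto simp: colon_def)
    qed (use 3 C step(1) in \<open>simp_all add: adjoin_ideal adjoin_psupset colon_ideal\<close>)
    then obtain N2 where N2: "\<And>n c. n \<ge> N2 \<Longrightarrow> c \<in> colon R (C n) x \<Longrightarrow>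
        \<exists>s\<in>carrier R - P. s \<otimes> c \<in> colon R (C (Suc n)) x" by auto
    have "\<exists>s\<in>carrier R - P. s \<otimes> c \<in> C (Suc n)" if n: "n \<ge> max N1 N2" and c: "c \<in> C n" for n c
    proof -
      have cc: "c \<in> carrier R" using Cc c .
      interpret Cn: ideal "C n" R by (rule C)
      interpret Cs: ideal "C (Suc n)" R by (rule C)
      have "c \<in> adjoin R (C n) x" using adjoin_supset[OF C(1) 3(2)] c by auto
      then obtain s where s: "s \<in> carrier R" "s \<notin> P" "s \<otimes> c \<in> adjoin R (C (Suc n)) x"
        using N1[of n c] n by auto
      \<comment> \<open>Stationarity in the quotient moves sc into \<open>C (Suc n)\<close> up to a
        multiple rx; stationarity of the colon ideals then absorbs rx.\<close>
      then obtain d r where d: "d \<in> C (Suc n)" "r \<in> carrier R" "s \<otimes> c = d \<oplus> r \<otimes> x"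
        by (auto simp: adjoin_def)
      have dc: "d \<in> carrier R" using d(1) by (rule Cc)
      have "r \<otimes> x \<oplus> d \<in> C n" using d(2,3) s(1) c dc 3(2) Cn.I_l_closed[OF c s(1)] by (simp add: a_comm)
      then have "r \<otimes> x \<in> C n"
        by (rule Cn.add_cancel_mem[rotated 2]) (use d(2) 3(2) subsetD[OF C(3) d(1)] in auto)
      then obtain t where t: "t \<in> carrier R" "t \<notin> P" "t \<otimes> r \<otimes> x \<in> C (Suc n)"
        using N2[of n r] n d(2) by (auto simp: colon_def)
      have "(t \<otimes> s) \<otimes> c = t \<otimes> (s \<otimes> c)" using t s cc by (simp add: m_assoc)
      also have "\<dots> = t \<otimes> d \<oplus> t \<otimes> r \<otimes> x" unfolding d(3) using t d dc 3(2) by algebra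
      also have "\<dots> \<in> C (Suc n)" using t d Cs.I_l_closed Cs.a_closed by simp
      finally have "(t \<otimes> s) \<otimes> c \<in> C (Suc n)" .
      moreover have "t \<otimes> s \<in> carrier R - P" using s t P.mult_mem_iff by auto
      ultimately show ?thesis by (intro bexI)
    qed
    then show ?thesis by (intro exI[of _ "max N1 N2"]) auto
  qed
qed

text \<open>Nakayama's lemma for the localization at \<open>P\<close>. An ideal maximal among those not
  containing \<open>D\<close> locally would contain \<open>aD\<close> locally.\<close>

lemma local_nakayama:
  assumes "primeideal P R" "a \<in> P" "ideal D' R" "D \<subseteq> carrier R"
    and step: "\<And>d. d \<in> D \<Longrightarrow>
      \<exists>s\<in>carrier R - P. \<exists>d'\<in>D'. \<exists>g\<in>D. s \<otimes> d = d' \<oplus> g \<otimes> a"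
    and d: "d \<in> D"
  shows "\<exists>s\<in>carrier R - P. s \<otimes> d \<in> D'"
proof (rule ccontr)
  assume nd: "\<not> ?thesis"
  interpret P: primeideal P R by fact
  have a: "a \<in> carrier R" using assms(2) by (rule P.Icarr)
  define \<S> where "\<S> = {E. ideal E R \<and> D' \<subseteq> E \<and> (\<exists>d\<in>D. \<forall>s\<in>carrier R - P. s \<otimes> d \<notin> E)}"
  have "D' \<in> \<S>" using nd d assms(3) by (auto simp: \<S>_def)
  then have "\<exists>M\<in>\<S>. \<forall>N\<in>\<S>. M \<subseteq> N \<longrightarrow> N = M"
    by (intro ex_maximal) (auto simp: \<S>_def)
  then obtain E where E: "E \<in> \<S>" "\<And>N. N \<in> \<S> \<Longrightarrow> E \<subseteq> N \<Longrightarrow> N = E" by auto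
  interpret E: ideal E R using E(1) by (simp add: \<S>_def)
  have D'E: "D' \<subseteq> E" using E(1) by (simp add: \<S>_def)
  obtain e where e: "e \<in> D" "\<And>s. s \<in> carrier R \<Longrightarrow> s \<notin> P \<Longrightarrow> s \<otimes> e \<notin> E"
    using E(1) by (auto simp: \<S>_def)
  obtain s d' g where s: "s \<in> carrier R" "s \<notin> P" "d' \<in> D'" "g \<in> D" "s \<otimes> e = d' \<oplus> g \<otimes> a"
    using step[OF e(1)] by auto
  have c: "g \<in> carrier R" "e \<in> carrier R" using s e assms(4) by auto
  have d'c: "d' \<in> E" "d' \<in> carrier R" using s D'E by auto
  have "\<exists>t\<in>carrier R - P. t \<otimes> (g \<otimes> a) \<in> E"
  proof (cases "g \<otimes> a \<in> E")
    case True
    then show ?thesis using P.one_notin a c by (intro bexI[of _ \<one>]) auto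
  next
    case False
    let ?E = "adjoin R E (g \<otimes> a)"
    have "E \<subset> ?E" "ideal ?E R"
      using adjoin_psupset[OF E.ideal_axioms _ False] adjoin_ideal[OF E.ideal_axioms] a c by auto
    then have "?E \<notin> \<S>" using E(2) by auto
    then have "\<exists>s\<in>carrier R - P. s \<otimes> g \<in> ?E"
      using \<open>E \<subset> ?E\<close> \<open>ideal ?E R\<close> D'E s(4) by (auto simp: \<S>_def)
    then obtain s' f u where s': "s' \<in> carrier R" "s' \<notin> P" "s' \<otimes> g = f \<oplus> u \<otimes> (g \<otimes> a)"
      "f \<in> E" "u \<in> carrier R" by (auto simp: adjoin_def)
    have fc: "f \<in> carrier R" using s'(4) by (rule E.Icarr)
    \<comment> \<open>The local unit 1 - ua of Nakayama's lemma, cleared of denominators; it is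
      outside \<open>P\<close> because \<open>a\<close> is inside and \<open>s'\<close> is
      not.\<close>
    let ?t = "s' \<ominus> u \<otimes> a"
    have "?t \<otimes> g = s' \<otimes> g \<ominus> u \<otimes> (g \<otimes> a)" using s' a c by algebra
    also have "\<dots> = f" unfolding s'(3) using fc s' a c by algebra
    finally have "?t \<otimes> g \<in> E" using s'(4) by simp
    then have "?t \<otimes> g \<otimes> a \<in> E" using a by (rule E.I_r_closed)
    then have "?t \<otimes> (g \<otimes> a) \<in> E" using a c s' by (simp add: m_assoc)
    moreover have "?t \<notin> P"
    proof
      assume "?t \<in> P"
      then have "?t \<oplus> u \<otimes> a \<in> P" using assms(2) s'(5) P.I_l_closed P.a_closed by auto
      moreover have "?t \<oplus> u \<otimes> a = s'" using s' a by algebra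
      ultimately show False using s'(2) by simp
    qed
    ultimately show ?thesis using s' a by (intro bexI[of _ ?t]) auto
  qed
  then obtain t where t: "t \<in> carrier R" "t \<notin> P" "t \<otimes> (g \<otimes> a) \<in> E" by auto
  have "(t \<otimes> s) \<otimes> e = t \<otimes> (s \<otimes> e)" using t s c by (simp add: m_assoc)
  also have "\<dots> = t \<otimes> d' \<oplus> t \<otimes> (g \<otimes> a)" unfolding s(5) using t d'c a c by algebra
  also have "\<dots> \<in> E" using t d'c E.I_l_closed E.a_closed by simp
  finally show False using e(2)[of "t \<otimes> s"] s t P.mult_mem_iff by auto
qed

text \<open>Krull's principal ideal theorem in the domain R/Q'. The contractions \<open>D n\<close>
  of (y^n) from the localization at \<open>Q\<close> become stationary modulo \<open>a\<close>,
  locally at \<open>P\<close>. As \<open>a\<close> is outside \<open>Q\<close>, this gives D n = D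
  (n + 1) + a D n, and Nakayama's lemma removes the last term. Then y^n is locally a multiple of
  y^(n + 1), so that y would be a unit at \<open>Q\<close> although it lies in
  \<open>Q\<close>.\<close>

lemma principal_ideal_theorem:
  assumes primes: "primeideal Q' R" "primeideal Q R"
    and chain: "Q' \<subset> Q" "Q \<subset> P" and min: "minimal_over R (insert a Q') P"
  shows False
proof -
  interpret Q': primeideal Q' R by fact
  interpret Q: primeideal Q R by fact
  interpret P: primeideal P R using min by (simp add: minimal_over_def)
  have aP: "a \<in> P" using min by (simp add: minimal_over_def)
  then have a: "a \<in> carrier R" by (rule P.Icarr)
  have aQ: "a \<notin> Q" using min chain primes by (auto simp: minimal_over_def)
  obtain y where y: "y \<in> Q" "y \<notin> Q'" using chain by auto
  have yc: "y \<in> carrier R" using y(1) by (rule Q.Icarr)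
  \<comment> \<open>In R/Q' the ideal \<open>Y n\<close> is (y^n), and \<open>D n\<close> is its
    contraction from the localization at \<open>Q\<close>; these play the part of the symbolic
    powers of \<open>Q\<close>.\<close>
  define Y where "Y n = adjoin R Q' (y [^] (n::nat))" for n
  define D where "D n = {r \<in> carrier R. \<exists>s\<in>carrier R - Q. s \<otimes> r \<in> Y n}" for n
  have Yi: "ideal (Y n) R" for n unfolding Y_def using yc by (simp add: adjoin_ideal Q'.ideal_axioms)
  have YS: "Y (Suc n) \<subseteq> Y n" for n unfolding Y_def
  proof (rule adjoin_least)
    show "Q' \<subseteq> adjoin R Q' (y [^] n)" using adjoin_supset Q'.ideal_axioms yc by simp
    have "y [^] n \<in> adjoin R Q' (y [^] n)" using adjoin_self Q'.ideal_axioms yc by simp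
    then show "y [^] Suc n \<in> adjoin R Q' (y [^] n)"
      using ideal.I_r_closed[OF Yi[of n], unfolded Y_def] yc by simp
  qed (use Yi[of n] in \<open>simp add: Y_def\<close>)
  have Di: "ideal (D n) R" for n
  proof -
    interpret Yn: ideal "Y n" R by (rule Yi)
    show ?thesis
    proof (rule idealI')
      show "\<zero> \<in> D n" using Q.one_notin by (auto simp: D_def intro!: bexI[of _ \<one>])
    next
      fix u v assume "u \<in> D n" "v \<in> D n"
      then obtain s t where st: "u \<in> carrier R" "v \<in> carrier R" "s \<in> carrier R" "s \<notin> Q"
        "t \<in> carrier R" "t \<notin> Q" "s \<otimes> u \<in> Y n" "t \<otimes> v \<in> Y n" by (auto simp: D_def)
      have "(s \<otimes> t) \<otimes> (u \<oplus> v) = t \<otimes> (s \<otimes> u) \<oplus> s \<otimes> (t \<otimes> v)" using st by algebra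
      also have "\<dots> \<in> Y n" using st Yn.I_l_closed Yn.a_closed by simp
      finally show "u \<oplus> v \<in> D n" using st Q.mult_mem_iff
        by (auto simp: D_def intro!: bexI[of _ "s \<otimes> t"])
    next
      fix u r assume "u \<in> D n" and r: "r \<in> carrier R"
      then obtain s where st: "u \<in> carrier R" "s \<in> carrier R" "s \<notin> Q" "s \<otimes> u \<in> Y n"
        by (auto simp: D_def)
      have "s \<otimes> (r \<otimes> u) = r \<otimes> (s \<otimes> u)" using st r by algebra
      then show "r \<otimes> u \<in> D n" using st r Yn.I_l_closed
        by (auto simp: D_def intro!: bexI[of _ s])
    qed (auto simp: D_def)
  qed
  have YD: "Y n \<subseteq> D n" for n
    using Q.one_notin ideal.Icarr[OF Yi] by (auto simp: D_def intro!: bexI[of _ \<one>])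
  have DS: "D (Suc n) \<subseteq> D n" for n using YS by (auto simp: D_def)
  have Q'Y: "Q' \<subseteq> Y n" for n unfolding Y_def using adjoin_supset Q'.ideal_axioms yc by simp
  have "\<exists>N. \<forall>n\<ge>N. \<forall>c\<in>adjoin R (D n) a. \<exists>s\<in>carrier R - P. s \<otimes> c \<in> adjoin R (D (Suc n)) a"
  proof (rule local_descending_chain)
    show "ideal (adjoin R Q' a) R" using a Q'.ideal_axioms by (simp add: adjoin_ideal)
    show "L = P" if "primeideal L R" "adjoin R Q' a \<subseteq> L" "L \<subseteq> P" for L
    proof -
      have "insert a Q' \<subseteq> L"
        using that adjoin_supset[OF Q'.ideal_axioms a] adjoin_self[OF Q'.ideal_axioms a] by auto
      then show ?thesis using that min by (simp add: minimal_over_def)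
    qed
    show "adjoin R Q' a \<subseteq> adjoin R (D n) a" for n using Q'Y YD adjoin_mono by (metis subset_trans)
  qed (use a Di DS in \<open>simp_all add: adjoin_ideal adjoin_mono P.primeideal_axioms\<close>)
  then obtain n where n: "\<And>c. c \<in> adjoin R (D n) a \<Longrightarrow>
      \<exists>s\<in>carrier R - P. s \<otimes> c \<in> adjoin R (D (Suc n)) a" by auto
  interpret Dn: ideal "D n" R by (rule Di)
  have "y [^] n \<in> Y n" by (simp add: Y_def adjoin_self Q'.ideal_axioms yc)
  then have yD: "y [^] n \<in> D n" by (rule subsetD[OF YD])
  have step: "\<exists>s\<in>carrier R - P. \<exists>d'\<in>D (Suc n). \<exists>g\<in>D n. s \<otimes> d = d' \<oplus> g \<otimes> a" if d: "d \<in> D n" for d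
  proof -
    have "d \<in> adjoin R (D n) a" using d by (rule subsetD[OF adjoin_supset[OF Di a]])
    from n[OF this] obtain s d' r where s: "s \<in> carrier R" "s \<notin> P" "d' \<in> D (Suc n)"
      "r \<in> carrier R" "s \<otimes> d = d' \<oplus> r \<otimes> a" by (auto simp: adjoin_def)
    have "d' \<in> D n" using s(3) by (rule subsetD[OF DS])
    moreover have "r \<otimes> a \<oplus> d' \<in> D n" using s a Dn.I_l_closed[OF d s(1)] Dn.Icarr[OF \<open>d' \<in> D n\<close>]
      by (simp add: a_comm)
    ultimately have "r \<otimes> a \<in> D n" using s a by (metis Dn.add_cancel_mem m_closed)
    then obtain t where t: "t \<in> carrier R" "t \<notin> Q" "t \<otimes> (r \<otimes> a) \<in> Y n"
      unfolding D_def by blast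
    \<comment> \<open>Since \<open>a\<close> is outside \<open>Q\<close>, it can be absorbed into
      the multiplier, which puts r itself into \<open>D n\<close>.\<close>
    have "(t \<otimes> a) \<otimes> r \<in> Y n" using t(3) unfolding m_assoc[OF t(1) a s(4)] m_comm[OF a s(4)] .
    moreover have "t \<otimes> a \<in> carrier R - Q"
      using t(1,2) a aQ Q.mult_mem_iff[OF t(1) a] m_closed[OF t(1) a] by blast
    ultimately have "r \<in> D n" unfolding D_def using s(4) by blast
    then show ?thesis using s by auto
  qed
  have "D n \<subseteq> carrier R" unfolding D_def by blast
  from local_nakayama[OF P.primeideal_axioms aP Di this step yD]
  have "\<exists>s\<in>carrier R - P. s \<otimes> y [^] n \<in> D (Suc n)" .
  then obtain s where s: "s \<in> carrier R" "s \<notin> P" "s \<otimes> y [^] n \<in> D (Suc n)" by auto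
  then obtain t where t: "t \<in> carrier R" "t \<notin> Q" "t \<otimes> (s \<otimes> y [^] n) \<in> Y (Suc n)"
    unfolding D_def by blast
  then obtain q u where q: "q \<in> Q'" "u \<in> carrier R"
    "t \<otimes> (s \<otimes> y [^] n) = q \<oplus> u \<otimes> y [^] Suc n" unfolding Y_def adjoin_def by blast
  have qc: "q \<in> carrier R" using q(1) by (rule Q'.Icarr)
  let ?w = "y [^] n"
  have w: "?w \<in> carrier R" using yc by simp
  note c = t(1) s(1) q(2) qc w yc
  \<comment> \<open>Cancelling y^n modulo \<open>Q'\<close> leaves ts - uy in \<open>Q'\<close>;
    with y in \<open>Q\<close> this puts ts into \<open>Q\<close>.\<close>
  have "(t \<otimes> s \<ominus> u \<otimes> y) \<otimes> ?w = t \<otimes> (s \<otimes> ?w) \<ominus> u \<otimes> (?w \<otimes> y)" using c by algebra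
  also have "\<dots> = q" unfolding q(3) nat_pow_Suc using c by algebra
  finally have "(t \<otimes> s \<ominus> u \<otimes> y) \<otimes> ?w \<in> Q'" using q(1) by simp
  then have "t \<otimes> s \<ominus> u \<otimes> y \<in> Q' \<or> ?w \<in> Q'" using c Q'.mult_mem_iff by simp
  then have "t \<otimes> s \<ominus> u \<otimes> y \<in> Q" using Q'.pow_mem[OF yc] y(2) chain by auto
  then have "(t \<otimes> s \<ominus> u \<otimes> y) \<oplus> u \<otimes> y \<in> Q" using y(1) c(3) Q.I_l_closed Q.a_closed by simp
  moreover have "(t \<otimes> s \<ominus> u \<otimes> y) \<oplus> u \<otimes> y = t \<otimes> s" using c by algebra
  ultimately have "t \<otimes> s \<in> Q" by simp
  then show False using t(2) s(2) chain(2) Q.mult_mem_iff[OF c(1,2)] by auto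
qed

text \<open>The usual argument for radicals: an ideal above \<open>K\<close> that is maximal among
  those avoiding all products s b^n is prime. The exponent 0 keeps it inside \<open>P\<close>, the
  multiplier 1 keeps \<open>b\<close> out of it.\<close>

lemma local_radical:
  assumes "ideal K R" "primeideal P R" "b \<in> carrier R"
    and "\<And>L. primeideal L R \<Longrightarrow> K \<subseteq> L \<Longrightarrow> L \<subseteq> P \<Longrightarrow> b \<in> L"
  shows "\<exists>s\<in>carrier R - P. \<exists>n::nat. s \<otimes> b [^] n \<in> K"
proof (rule ccontr)
  assume n: "\<not> ?thesis"
  interpret P: primeideal P R by fact
  define \<S> where "\<S> = {E. ideal E R \<and> K \<subseteq> E \<and> (\<forall>s\<in>carrier R - P. \<forall>n::nat. s \<otimes> b [^] n \<notin> E)}"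
  have "K \<in> \<S>" using n assms(1) by (auto simp: \<S>_def)
  then have "\<exists>M\<in>\<S>. \<forall>N\<in>\<S>. M \<subseteq> N \<longrightarrow> N = M"
    by (intro ex_maximal) (auto simp: \<S>_def)
  then obtain E where E: "E \<in> \<S>" "\<And>N. N \<in> \<S> \<Longrightarrow> E \<subseteq> N \<Longrightarrow> N = E" by auto
  have Ei: "ideal E R" and KE: "K \<subseteq> E" using E(1) by (auto simp: \<S>_def)
  have En: "s \<otimes> b [^] n \<notin> E" if "s \<in> carrier R" "s \<notin> P" for s and n :: nat
    using E(1) that by (auto simp: \<S>_def)
  interpret E: ideal E R by (rule Ei)
  have *: "\<exists>s\<in>carrier R - P. \<exists>n::nat. s \<otimes> b [^] n \<in> adjoin R E x"
    if x: "x \<in> carrier R" "x \<notin> E" for x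
  proof -
    have "adjoin R E x \<notin> \<S>" using E(2) adjoin_psupset[OF Ei x] by auto
    then show ?thesis using adjoin_psupset[OF Ei x] KE adjoin_ideal[OF Ei x(1)]
      by (auto simp: \<S>_def)
  qed
  have "primeideal E R"
  proof (rule primeidealI'[OF Ei])
    show "\<one> \<notin> E" using En[of \<one> 0] P.one_notin by simp
  next
    fix x y assume xy: "x \<in> carrier R" "y \<in> carrier R" "x \<otimes> y \<in> E"
    show "x \<in> E \<or> y \<in> E"
    proof (rule ccontr)
      assume "\<not> ?thesis"
      then obtain s t e f r u and n m :: nat where
        st: "s \<in> carrier R" "s \<notin> P" "s \<otimes> b [^] n = e \<oplus> r \<otimes> x" "e \<in> E" "r \<in> carrier R"
        "t \<in> carrier R" "t \<notin> P" "t \<otimes> b [^] m = f \<oplus> u \<otimes> y" "f \<in> E" "u \<in> carrier R"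
        using *[OF xy(1)] *[OF xy(2)] by (auto simp: adjoin_def)
      have c: "e \<in> carrier R" "f \<in> carrier R" using st E.Icarr by auto
      have "(s \<otimes> t) \<otimes> b [^] (n + m) = (s \<otimes> b [^] n) \<otimes> (t \<otimes> b [^] m)"
        using st(1,6) nat_pow_closed[OF assms(3), of n] nat_pow_closed[OF assms(3), of m]
          nat_pow_mult[OF assms(3), of n m, symmetric] by (simp add: m_ac del: nat_pow_mult)
      also have "\<dots> = (f \<oplus> u \<otimes> y) \<otimes> e \<oplus> ((r \<otimes> x) \<otimes> f \<oplus> (r \<otimes> u) \<otimes> (x \<otimes> y))"
        unfolding st using st c xy by algebra
      also have "\<dots> \<in> E" using st c xy by (simp add: E.I_l_closed E.a_closed)
      finally show False using En[of "s \<otimes> t" "n + m"] st P.mult_mem_iff by simp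
    qed
  qed
  moreover have "E \<subseteq> P"
  proof
    fix z assume z: "z \<in> E"
    then show "z \<in> P" using En[of z 0] E.Icarr[OF z] by auto
  qed
  ultimately have "b \<in> E" using assms(4) KE by auto
  then show False using En[of \<one> 1] P.one_notin assms(3) by simp
qed

text \<open>This is the height theorem for R/J. Let \<open>Q1\<close> be a prime with nothing
  strictly between it and \<open>P\<close>, and \<open>a\<close> in \<open>X\<close> outside
  \<open>Q1\<close>. Locally at \<open>P\<close> every b in \<open>X\<close> is nilpotent modulo Q1
  + Ra, which replaces it by an element \<open>\<beta> b\<close> of \<open>Q1\<close>. The at most k
  elements so obtained from the members of \<open>X\<close> other than \<open>a\<close> have
  \<open>Q1\<close> as a minimal prime over \<open>J\<close>.\<close>

theorem krull_height:
  assumes "finite X" "card X \<le> k" "minimal_over R (J \<union> X) P" "prime_chain R J m P"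
  shows "m \<le> k"
  using assms
proof (induction k arbitrary: X P m)
  case 0
  then have "minimal_over R J P" by simp
  then have "\<not> prime_chain R J (Suc i) P" for i
    using prime_chainD[of R J i] unfolding minimal_over_def prime_chain.simps psubset_eq by blast
  then show ?case using 0 by (cases m) auto
next
  case (Suc k)
  show ?case
  proof (cases m)
    case (Suc m')
    interpret P: primeideal P R using Suc.prems by (simp add: minimal_over_def)
    have XP: "X \<subseteq> P" "J \<subseteq> P" using Suc.prems by (auto simp: minimal_over_def)
    obtain Q where Q: "prime_chain R J m' Q" "Q \<subset> P" using Suc Suc.prems(4) by auto
    define \<S> where "\<S> = {L. primeideal L R \<and> Q \<subseteq> L \<and> L \<subset> P}"
    have "Q \<in> \<S>" using Q prime_chainD[OF Q(1)] by (auto simp: \<S>_def)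
    then have "\<exists>M\<in>\<S>. \<forall>N\<in>\<S>. M \<subseteq> N \<longrightarrow> N = M"
      by (intro ex_maximal) (auto simp: \<S>_def primeideal_def)
    then obtain Q1 where Q1': "Q1 \<in> \<S>" "\<forall>N\<in>\<S>. Q1 \<subseteq> N \<longrightarrow> N = Q1" ..
    then have Q1: "primeideal Q1 R" "Q \<subseteq> Q1" "Q1 \<subset> P" by (simp_all add: \<S>_def)
    have Q1max: "L = Q1" if "primeideal L R" "Q1 \<subseteq> L" "L \<subset> P" for L
      using that Q1'(2) Q1(2) by (simp add: \<S>_def)
    interpret Q1: primeideal Q1 R by fact
    have chain: "prime_chain R J m' Q1" using prime_chain_upward[OF Q(1) Q1(1,2)] .
    then have JQ1: "J \<subseteq> Q1" using prime_chainD[of R J m' Q1] by simp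
    have "\<not> X \<subseteq> Q1" using Suc.prems(3) Q1 JQ1 by (auto simp: minimal_over_def)
    then obtain a where a: "a \<in> X" "a \<notin> Q1" by auto
    have ac: "a \<in> carrier R" using a XP P.Icarr by auto
    have "\<exists>s\<in>carrier R - P. \<exists>n::nat. s \<otimes> b [^] n \<in> adjoin R Q1 a" if b: "b \<in> X" for b
    proof (rule local_radical)
      show "ideal (adjoin R Q1 a) R" using ac Q1.ideal_axioms by (rule adjoin_ideal[rotated])
      show "b \<in> carrier R" using b XP P.Icarr by auto
      fix L assume L: "primeideal L R" "adjoin R Q1 a \<subseteq> L" "L \<subseteq> P"
      have "a \<in> L" "Q1 \<subseteq> L"
        using L adjoin_supset[OF Q1.ideal_axioms ac] adjoin_self[OF Q1.ideal_axioms ac] by auto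
      then have "L = P" using Q1max[OF L(1)] L(3) a(2) unfolding psubset_eq by blast
      then show "b \<in> L" using b XP by auto
    qed (rule P.primeideal_axioms)
    then have "\<exists>s\<in>carrier R - P. \<exists>n::nat. \<exists>\<beta>\<in>Q1. \<exists>r\<in>carrier R. s \<otimes> b [^] n = \<beta> \<oplus> r \<otimes> a"
      if "b \<in> X" for b using that by (fastforce simp: adjoin_def)
    then have "\<exists>\<beta>. \<beta> \<in> Q1 \<and> (\<exists>s\<in>carrier R - P. \<exists>n::nat. \<exists>r\<in>carrier R. s \<otimes> b [^] n = \<beta> \<oplus> r \<otimes> a)"
      if "b \<in> X" for b using that by meson
    then obtain \<beta> where \<beta>: "\<And>b. b \<in> X \<Longrightarrow> \<beta> b \<in> Q1"
      "\<And>b. b \<in> X \<Longrightarrow> \<exists>s\<in>carrier R - P. \<exists>n::nat. \<exists>r\<in>carrier R. s \<otimes> b [^] n = \<beta> b \<oplus> r \<otimes> a"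
      by metis
    let ?X = "\<beta> ` (X - {a})"
    have "minimal_over R (J \<union> ?X) Q1"
      unfolding minimal_over_def
    proof (intro conjI allI impI)
      show "J \<union> ?X \<subseteq> Q1" using \<beta>(1) JQ1 by auto
    next
      fix Q0 assume Q0: "primeideal Q0 R" "J \<union> ?X \<subseteq> Q0" "Q0 \<subseteq> Q1"
      \<comment> \<open>A prime \<open>Q0\<close> strictly inside \<open>Q1\<close> would make
        \<open>P\<close> minimal over \<open>Q0\<close> and \<open>a\<close> with \<open>Q1\<close>
        in between, against the principal ideal theorem.\<close>
      have "minimal_over R (insert a Q0) P"
        unfolding minimal_over_def
      proof (intro conjI allI impI)
        show "insert a Q0 \<subseteq> P" using a XP Q0 Q1 by auto
      next
        fix L assume L: "primeideal L R" "insert a Q0 \<subseteq> L" "L \<subseteq> P"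
        interpret L: primeideal L R by fact
        have "b \<in> L" if b: "b \<in> X" for b
        proof (cases "b = a")
          case False
          obtain s r and n :: nat where s: "s \<in> carrier R" "s \<notin> P" "r \<in> carrier R"
            "s \<otimes> b [^] n = \<beta> b \<oplus> r \<otimes> a" using \<beta>(2)[OF b] by auto
          have bc: "b \<in> carrier R" using b XP P.Icarr by auto
          have "\<beta> b \<in> L" using b False Q0(2) L(2) by auto
          then have "s \<otimes> b [^] n \<in> L" unfolding s(4) using s L(2)
            by (intro L.a_closed L.I_l_closed) auto
          then have "b [^] n \<in> L" using L.mult_mem_iff[OF s(1)] bc s(2) L(3) by auto
          then show ?thesis using L.pow_mem[OF bc] by simp
        qed (use L in auto)
        then have "J \<union> X \<subseteq> L" using Q0 L by auto
        then show "L = P" using Suc.prems(3) L by (simp add: minimal_over_def)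
      qed (rule P.primeideal_axioms)
      then show "Q0 = Q1" using principal_ideal_theorem[OF Q0(1) Q1(1) _ Q1(3)] Q0(3) by blast
    qed (rule Q1.primeideal_axioms)
    moreover have "card ?X \<le> k"
      using card_image_le[of "X - {a}" \<beta>] a Suc.prems(1,2) by (simp add: card_Diff_singleton)
    ultimately have "m' \<le> k" using Suc.IH[of ?X Q1 m'] Suc.prems(1) chain by simp
    then show ?thesis using Suc by simp
  qed simp
qed

text \<open>The chain is lengthened at its bottom. Its length is positive, so the bottom prime lies
  strictly inside \<open>p\<close> and the hypothesis applies to it.\<close>

lemma prime_chain_prepend:
  assumes "\<And>p0. primeideal p0 R \<Longrightarrow> J' \<subseteq> p0 \<Longrightarrow> p0 \<subset> p \<Longrightarrow> \<exists>q. primeideal q R \<and> J \<subseteq> q \<and> q \<subset> p0"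
    and "prime_chain R J' (Suc m) p"
  shows "prime_chain R J (Suc (Suc m)) p"
  using assms
proof (induction m arbitrary: p)
  case 0
  from 0(2) obtain p0 where p0: "primeideal p0 R" "J' \<subseteq> p0" "p0 \<subset> p" "primeideal p R"
    unfolding prime_chain.simps by blast
  then obtain q where "primeideal q R" "J \<subseteq> q" "q \<subset> p0"
    using 0(1)[OF p0(1-3)] by blast
  then have "prime_chain R J (Suc 0) p0" using p0(1) by auto
  then show ?case using p0(3,4) unfolding prime_chain.simps by blast
next
  case (Suc m)
  then obtain p' where p': "prime_chain R J' (Suc m) p'" "p' \<subset> p" "primeideal p R"
    by (metis prime_chain.simps(2))
  have "prime_chain R J (Suc (Suc m)) p'"
  proof (rule Suc.IH[OF _ p'(1)])
    show "\<exists>q. primeideal q R \<and> J \<subseteq> q \<and> q \<subset> p0" if "primeideal p0 R" "J' \<subseteq> p0" "p0 \<subset> p'" for p0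
      using Suc.prems(1)[OF that(1,2)] that(3) p'(2) by (meson psubset_trans)
  qed
  then show ?case using p'(2,3) by (metis prime_chain.simps(2))
qed

text \<open>By prime avoidance there is \<open>a\<close> in \<open>p\<close> outside all minimal
  primes of \<open>J\<close> strictly inside \<open>p\<close>. A chain of positive length over J +
  Ra then never starts at a minimal prime of \<open>J\<close> and can be prolonged downwards, so
  \<open>a\<close> lowers the bound by one.\<close>

theorem krull_height_converse:
  assumes "ideal J R" "primeideal p R" "J \<subseteq> p" "\<And>m. prime_chain R J m p \<Longrightarrow> m \<le> d"
  shows "\<exists>X. finite X \<and> card X \<le> d \<and> minimal_over R (J \<union> X) p"
  using assms
proof (induction d arbitrary: J)
  case 0
  have "minimal_over R J p"
    unfolding minimal_over_def
  proof (intro conjI allI impI)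
    fix q assume q: "primeideal q R" "J \<subseteq> q" "q \<subseteq> p"
    show "q = p"
    proof (rule ccontr)
      assume "q \<noteq> p"
      then have "prime_chain R J 1 p" using q 0(2) by auto
      then show False using 0(4) by fastforce
    qed
  qed (use 0 in auto)
  then show ?case by (intro exI[of _ "{}"]) simp
next
  case (Suc d)
  interpret p: primeideal p R by fact
  obtain F where F: "finite F" "\<And>q. q \<in> F \<Longrightarrow> primeideal q R \<and> J \<subseteq> q"
    "\<And>q. primeideal q R \<Longrightarrow> J \<subseteq> q \<Longrightarrow> \<exists>p\<in>F. p \<subseteq> q"
    using finite_minimal_primes[OF Suc.prems(1)] by auto
  \<comment> \<open>Members of \<open>F\<close> that contain \<open>p\<close> cannot be avoided, but
    a member inside some \<open>p0\<close> strictly below \<open>p\<close> is not of this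
    kind.\<close>
  have "\<not> p \<subseteq> \<Union>{q\<in>F. \<not> p \<subseteq> q}"
    using prime_avoidance[of "{q\<in>F. \<not> p \<subseteq> q}" p] F(1,2) p.ideal_axioms by auto
  then obtain a where a: "a \<in> p" "\<And>q. q \<in> F \<Longrightarrow> \<not> p \<subseteq> q \<Longrightarrow> a \<notin> q" by auto
  have ac: "a \<in> carrier R" using a(1) by (rule p.Icarr)
  let ?J = "adjoin R J a"
  have sub: "J \<subseteq> ?J" "a \<in> ?J" using adjoin_supset adjoin_self ac Suc.prems(1) by auto
  have Jp: "?J \<subseteq> p" using Suc.prems a p.ideal_axioms by (intro adjoin_least) auto
  have "m \<le> d" if m: "prime_chain R ?J m p" for m
  proof (cases m)
    case (Suc m')
    have "prime_chain R J (Suc (Suc m')) p"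
    proof (rule prime_chain_prepend)
      fix p0 assume p0: "primeideal p0 R" "?J \<subseteq> p0" "p0 \<subset> p"
      then obtain q where q: "q \<in> F" "q \<subseteq> p0" using F(3) sub by (meson subset_trans)
      then have "a \<notin> q" using a(2) p0 by auto
      then show "\<exists>q. primeideal q R \<and> J \<subseteq> q \<and> q \<subset> p0" using q F(2) p0 sub by (intro exI[of _ q]) auto
    qed (use m Suc in simp)
    then show ?thesis using Suc.prems(4) Suc by fastforce
  qed simp
  then obtain X where X: "finite X" "card X \<le> d" "minimal_over R (?J \<union> X) p"
    using Suc.IH[OF adjoin_ideal[OF Suc.prems(1) ac] Suc.prems(2) Jp] by auto
  have "minimal_over R (J \<union> insert a X) p"
    unfolding minimal_over_def
  proof (intro conjI allI impI)
    show "J \<union> insert a X \<subseteq> p" using X(3) sub by (auto simp: minimal_over_def)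
    fix q assume q: "primeideal q R" "J \<union> insert a X \<subseteq> q" "q \<subseteq> p"
    then have "?J \<subseteq> q" by (intro adjoin_least) (auto simp: primeideal_def)
    then show "q = p" using X(3) q by (simp add: minimal_over_def)
  qed (rule Suc.prems)
  then show ?case using X by (intro exI[of _ "insert a X"]) (auto simp: card_insert_if)
qed

end

subsection \<open>Zero divisors and regular sequences modulo an ideal\<close>

definition regular_mod :: "('a, 'm) ring_scheme \<Rightarrow> 'a set \<Rightarrow> 'a \<Rightarrow> bool"
  where "regular_mod R K x \<longleftrightarrow> (\<forall>z\<in>carrier R. x \<otimes>\<^bsub>R\<^esub> z \<in> K \<longrightarrow> z \<in> K)"

text \<open>Properness of the final ideal is left out: it is automatic for sequences in a proper
  ideal that contains \<open>K\<close>.\<close>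

fun regular_on :: "('a, 'm) ring_scheme \<Rightarrow> 'a set \<Rightarrow> 'a list \<Rightarrow> bool" where
  "regular_on R K [] \<longleftrightarrow> True"
| "regular_on R K (x # xs) \<longleftrightarrow> regular_mod R K x \<and> regular_on R (adjoin R K x) xs"

lemma regular_modD:
  "regular_mod R K x \<Longrightarrow> x \<otimes>\<^bsub>R\<^esub> z \<in> K \<Longrightarrow> z \<in> carrier R \<Longrightarrow> z \<in> K"
  unfolding regular_mod_def by blast

abbreviation adjoins :: "('a, 'm) ring_scheme \<Rightarrow> 'a set \<Rightarrow> 'a list \<Rightarrow> 'a set"
  where "adjoins R \<equiv> foldl (adjoin R)"

text \<open>All stages of the sequence, the final ideal included. The proof of Rees' theorem looks
  for one element that is regular modulo every stage.\<close>

fun partial_adjoins :: "('a, 'm) ring_scheme \<Rightarrow> 'a set \<Rightarrow> 'a list \<Rightarrow> 'a set list" where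
  "partial_adjoins R K [] = [K]"
| "partial_adjoins R K (x # xs) = K # partial_adjoins R (adjoin R K x) xs"

text \<open>The ideal \<open>J\<close> annihilates a nonzero element of \<open>R/K\<close>, that is, \<open>Hom(R/J, R/K)\<close> is nonzero.\<close>

definition has_socle :: "('a, 'm) ring_scheme \<Rightarrow> 'a set \<Rightarrow> 'a set \<Rightarrow> bool"
  where "has_socle R J K \<longleftrightarrow> (\<exists>z\<in>carrier R - K. \<forall>j\<in>J. j \<otimes>\<^bsub>R\<^esub> z \<in> K)"

lemma not_regular_mod_of_socle:
  "has_socle R J K \<Longrightarrow> x \<in> J \<Longrightarrow> \<not> regular_mod R K x"
  unfolding has_socle_def regular_mod_def by auto

lemma regular_on_append:
  "regular_on R K (xs @ ys) \<longleftrightarrow> regular_on R K xs \<and> regular_on R (adjoins R K xs) ys"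
  by (induction xs arbitrary: K) auto

text \<open>Each stage of \<open>xs\<close> is followed by an element that is regular there; the
  appended \<open>x\<close> serves the final stage. Hence an ideal containing the sequence kills no
  nonzero element at any stage.\<close>

lemma ex_regular_partial_adjoins:
  assumes "regular_on R K (xs @ [x])" "L \<in> set (partial_adjoins R K xs)"
  shows "\<exists>y\<in>set (xs @ [x]). regular_mod R L y"
  using assms by (induction xs arbitrary: K) auto

lemma last_partial_adjoins: "adjoins R K xs \<in> set (partial_adjoins R K xs)"
  by (induction xs arbitrary: K) auto

section \<open>Exchange and permutation of regular elements\<close>

context cring
begin

lemma adjoins_ideal: "ideal K R \<Longrightarrow> set xs \<subseteq> carrier R \<Longrightarrow> ideal (adjoins R K xs) R"
  by (induction xs arbitrary: K) (auto simp: adjoin_ideal)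

lemma partial_adjoins_ideal:
  "ideal K R \<Longrightarrow> set xs \<subseteq> carrier R \<Longrightarrow> L \<in> set (partial_adjoins R K xs) \<Longrightarrow> ideal L R"
proof (induction xs arbitrary: K)
  case (Cons x xs)
  then show ?case using Cons.IH[of "adjoin R K x"] by (auto simp: adjoin_ideal)
qed simp

lemma adjoins_adjoin:
  "ideal K R \<Longrightarrow> set xs \<subseteq> carrier R \<Longrightarrow> u \<in> carrier R \<Longrightarrow>
    adjoins R (adjoin R K u) xs = adjoin R (adjoins R K xs) u"
  by (induction xs arbitrary: K) (auto simp: adjoin_ideal adjoin_commute)

lemma adjoins_least:
  "ideal L R \<Longrightarrow> K \<subseteq> L \<Longrightarrow> set xs \<subseteq> L \<Longrightarrow> adjoins R K xs \<subseteq> L"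
  by (induction xs arbitrary: K) (simp_all add: adjoin_least)

lemma adjoins_supset:
  "ideal K R \<Longrightarrow> set xs \<subseteq> carrier R \<Longrightarrow> K \<subseteq> adjoins R K xs \<and> set xs \<subseteq> adjoins R K xs"
proof (induction xs rule: rev_induct)
  case (snoc x xs)
  then have "ideal (adjoins R K xs) R" "x \<in> carrier R" by (auto intro: adjoins_ideal)
  then have "adjoins R K xs \<subseteq> adjoin R (adjoins R K xs) x" "x \<in> adjoin R (adjoins R K xs) x"
    by (rule adjoin_supset, rule adjoin_self)
  then show ?case using snoc by auto
qed simp

lemma Idl_eq_adjoins:
  assumes "set xs \<subseteq> carrier R"
  shows "Idl (set xs) = adjoins R {\<zero>} xs"
proof
  show "Idl (set xs) \<subseteq> adjoins R {\<zero>} xs"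
    using adjoins_supset[OF zeroideal assms] adjoins_ideal[OF zeroideal assms]
    by (intro genideal_minimal) auto
  have "ideal (Idl (set xs)) R" using assms by (rule genideal_ideal)
  then show "adjoins R {\<zero>} xs \<subseteq> Idl (set xs)"
    using genideal_self[OF assms] by (intro adjoins_least)
      (auto simp: additive_subgroup.zero_closed ideal.axioms(1))
qed

text \<open>The elements killed by \<open>J\<close> in either quotient represent Ext^1(R/J, R/K).
  Explicitly, the class of z modulo x corresponds to the class modulo y of the element w with yz =
  wx modulo \<open>K\<close>.\<close>

lemma has_socle_exchange:
  assumes K: "ideal K R" and J: "J \<subseteq> carrier R" and xy: "x \<in> J" "y \<in> J"
    and reg: "regular_mod R K x" "regular_mod R K y" and soc: "has_socle R J (adjoin R K x)"
  shows "has_socle R J (adjoin R K y)"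
proof -
  interpret K: ideal K R by fact
  have c: "x \<in> carrier R" "y \<in> carrier R" using J xy by auto
  obtain z where z: "z \<in> carrier R" "z \<notin> adjoin R K x"
    "\<And>j. j \<in> J \<Longrightarrow> j \<otimes> z \<in> adjoin R K x" using soc unfolding has_socle_def by blast
  obtain k w where k: "k \<in> K" "w \<in> carrier R" "y \<otimes> z = k \<oplus> w \<otimes> x"
    using z(3)[OF xy(2)] unfolding adjoin_def by blast
  have kc: "k \<in> carrier R" using k(1) by (rule K.Icarr)
  \<comment> \<open>If w were vy modulo \<open>K\<close>, cancelling y would give z = vx modulo
    \<open>K\<close>.\<close>
  have "w \<notin> adjoin R K y"
  proof
    assume "w \<in> adjoin R K y"
    then obtain l v where l: "l \<in> K" "v \<in> carrier R" "w = l \<oplus> v \<otimes> y"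
      unfolding adjoin_def by blast
    have lc: "l \<in> carrier R" using l(1) by (rule K.Icarr)
    have "y \<otimes> (z \<ominus> v \<otimes> x) = y \<otimes> z \<ominus> y \<otimes> (v \<otimes> x)" using z(1) l(2) c by algebra
    also have "\<dots> = k \<oplus> l \<otimes> x" unfolding k(3) l(3) using kc lc l(2) c by algebra
    also have "\<dots> \<in> K" using k(1) l(1) c(1) by (intro K.a_closed K.I_r_closed)
    finally have "z \<ominus> v \<otimes> x \<in> K"
      by (rule regular_modD[OF reg(2)]) (simp add: z(1) l(2) c)
    moreover have "z = (z \<ominus> v \<otimes> x) \<oplus> v \<otimes> x" using z(1) l(2) c by algebra
    ultimately show False using z(2) l(2) unfolding adjoin_def by blast
  qed
  moreover have "j \<otimes> w \<in> adjoin R K y" if j: "j \<in> J" for j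
  proof -
    have jc: "j \<in> carrier R" using J j by auto
    obtain l v where l: "l \<in> K" "v \<in> carrier R" "j \<otimes> z = l \<oplus> v \<otimes> x"
      using z(3)[OF j] unfolding adjoin_def by blast
    have lc: "l \<in> carrier R" using l(1) by (rule K.Icarr)
    \<comment> \<open>With yz = wx and jz = vx modulo \<open>K\<close> one gets x(jw) = y(jz) =
      x(vy), and x cancels.\<close>
    have "x \<otimes> (j \<otimes> w \<ominus> v \<otimes> y) = (j \<otimes> (k \<oplus> w \<otimes> x) \<ominus> j \<otimes> k) \<ominus> v \<otimes> x \<otimes> y"
      using jc kc k(2) l(2) c by algebra
    also have "\<dots> = y \<otimes> (j \<otimes> z) \<ominus> j \<otimes> k \<ominus> v \<otimes> x \<otimes> y"
      unfolding k(3)[symmetric] using jc kc l(2) c z(1) by algebra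
    also have "\<dots> = y \<otimes> l \<ominus> j \<otimes> k" unfolding l(3) using jc kc lc l(2) c z(1) by algebra
    also have "\<dots> \<in> K" using k(1) l(1) c(2) jc by (intro K.minus_mem K.I_l_closed)
    finally have "j \<otimes> w \<ominus> v \<otimes> y \<in> K"
      by (rule regular_modD[OF reg(1)]) (simp add: jc k(2) l(2) c)
    moreover have "j \<otimes> w = (j \<otimes> w \<ominus> v \<otimes> y) \<oplus> v \<otimes> y" using jc k(2) l(2) c by algebra
    ultimately show ?thesis using l(2) unfolding adjoin_def by blast
  qed
  ultimately show ?thesis using k(2) unfolding has_socle_def by blast
qed

text \<open>A relation xz = wu modulo \<open>K\<close> forces w into K + Rx by regularity of u
  there, and then x can be cancelled.\<close>

lemma regular_mod_swap:
  assumes K: "ideal K R" and c: "x \<in> carrier R" "u \<in> carrier R"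
    and reg: "regular_mod R K x" "regular_mod R (adjoin R K x) u"
  shows "regular_mod R (adjoin R K u) x"
  unfolding regular_mod_def
proof (intro ballI impI)
  interpret K: ideal K R by fact
  fix z assume z: "z \<in> carrier R" "x \<otimes> z \<in> adjoin R K u"
  then obtain k w where k: "k \<in> K" "w \<in> carrier R" "x \<otimes> z = k \<oplus> w \<otimes> u"
    unfolding adjoin_def by blast
  have kc: "k \<in> carrier R" using k(1) by (rule K.Icarr)
  have "u \<otimes> w = (k \<oplus> w \<otimes> u) \<ominus> k" using kc k(2) c by algebra
  also have "\<dots> = \<ominus> k \<oplus> z \<otimes> x" unfolding k(3)[symmetric] using kc z(1) c by algebra
  finally have "u \<otimes> w \<in> adjoin R K x"
    using z(1) K.a_inv_closed[OF k(1)] unfolding adjoin_def by blast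
  then have "w \<in> adjoin R K x" using k(2) by (rule regular_modD[OF reg(2)])
  then obtain l v where l: "l \<in> K" "v \<in> carrier R" "w = l \<oplus> v \<otimes> x" unfolding adjoin_def by blast
  have lc: "l \<in> carrier R" using l(1) by (rule K.Icarr)
  have "x \<otimes> (z \<ominus> v \<otimes> u) = x \<otimes> z \<ominus> x \<otimes> (v \<otimes> u)" using z(1) l(2) c by algebra
  also have "\<dots> = k \<oplus> l \<otimes> u" unfolding k(3) l(3) using kc lc l(2) c by algebra
  also have "\<dots> \<in> K" using k(1) l(1) c(2) by (intro K.a_closed K.I_r_closed)
  finally have "z \<ominus> v \<otimes> u \<in> K"
    by (rule regular_modD[OF reg(1)]) (simp add: z(1) l(2) c)
  moreover have "z = (z \<ominus> v \<otimes> u) \<oplus> v \<otimes> u" using z(1) l(2) c by algebra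
  ultimately show "z \<in> adjoin R K u" using l(2) unfolding adjoin_def by blast
qed

text \<open>Repeated swaps move \<open>u\<close> from the end of the sequence past all its members
  to the front.\<close>

lemma regular_on_adjoin:
  assumes "ideal K R" "u \<in> carrier R" "set xs \<subseteq> carrier R" "regular_on R K xs"
    and "\<And>L. L \<in> set (partial_adjoins R K xs) \<Longrightarrow> regular_mod R L u"
  shows "regular_on R (adjoin R K u) xs"
  using assms
proof (induction xs arbitrary: K)
  case (Cons x xs)
  have x: "x \<in> carrier R" using Cons.prems by simp
  have "regular_mod R (adjoin R K x) u"
    by (rule Cons.prems(5)) (cases xs; simp)
  then have "regular_mod R (adjoin R K u) x"
    using regular_mod_swap[OF Cons.prems(1) x Cons.prems(2)] Cons.prems(4) by simp
  moreover have "regular_on R (adjoin R (adjoin R K x) u) xs"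
  proof (rule Cons.IH)
    show "ideal (adjoin R K x) R" using Cons.prems(1) x by (rule adjoin_ideal)
    show "regular_mod R L u" if "L \<in> set (partial_adjoins R (adjoin R K x) xs)" for L
      by (rule Cons.prems(5)) (simp add: that)
  qed (use Cons.prems(2-4) in simp_all)
  ultimately show ?case using Cons.prems x by (simp add: adjoin_commute)
qed simp

end

section \<open>Associated primes and Rees' theorem\<close>

context noetherian_cring
begin

text \<open>Maximal annihilators of nonzero elements of R/K are prime and cover the zero divisors.
  There are finitely many: finitely many members of \<open>W\<close> generate all of
  \<open>W\<close>, and if the annihilator of some w in \<open>W\<close> differed from theirs, a
  product of elements outside it would kill the generators and hence w.\<close>

lemma finite_associated_primes:
  assumes K: "ideal K R"
  shows "\<exists>F. finite F \<and> (\<forall>p\<in>F. primeideal p R \<and> (\<exists>z\<in>carrier R - K. p = colon R K z)) \<and>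
    (\<forall>x\<in>carrier R. \<not> regular_mod R K x \<longrightarrow> (\<exists>p\<in>F. x \<in> p))"
proof -
  interpret K: ideal K R by fact
  define W where "W = {w \<in> carrier R - K. \<forall>z\<in>carrier R - K.
    colon R K w \<subseteq> colon R K z \<longrightarrow> colon R K z = colon R K w}"
  have ci: "ideal (colon R K z) R" if "z \<in> carrier R" for z using K that by (rule colon_ideal)
  have Wc: "W \<subseteq> carrier R" by (auto simp: W_def)
  have Wmax: "colon R K z = colon R K w"
    if "w \<in> W" "z \<in> carrier R" "z \<notin> K" "colon R K w \<subseteq> colon R K z" for w z
    using that by (simp add: W_def)
  have ex: "\<exists>w\<in>W. colon R K z \<subseteq> colon R K w" if z: "z \<in> carrier R - K" for z
  proof -
    let ?S = "{colon R K w | w. w \<in> carrier R - K \<and> colon R K z \<subseteq> colon R K w}"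
    have "colon R K z \<in> ?S" using z by blast
    then have "\<exists>M\<in>?S. \<forall>N\<in>?S. M \<subseteq> N \<longrightarrow> N = M" using ci by (intro ex_maximal) auto
    then obtain w where w: "w \<in> carrier R - K" "colon R K z \<subseteq> colon R K w"
      "\<forall>N\<in>?S. colon R K w \<subseteq> N \<longrightarrow> N = colon R K w" by blast
    have "w \<in> W" unfolding W_def
    proof (intro CollectI conjI ballI impI)
      fix v assume v: "v \<in> carrier R - K" "colon R K w \<subseteq> colon R K v"
      have "colon R K z \<subseteq> colon R K v" using w(2) v(2) by (rule subset_trans)
      then have "colon R K v \<in> ?S" using v(1) by blast
      then show "colon R K v = colon R K w" using w(3) v(2) by blast
    qed (rule w(1))
    then show ?thesis using w(2) by blast
  qed
  have prime: "primeideal (colon R K w) R" if w: "w \<in> W" for w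
  proof (rule primeidealI')
    have wc: "w \<in> carrier R" "w \<notin> K" using w by (auto simp: W_def)
    show "ideal (colon R K w) R" using wc ci by simp
    show "\<one> \<notin> colon R K w" using wc by (simp add: colon_def)
    fix a b assume ab: "a \<in> carrier R" "b \<in> carrier R" "a \<otimes> b \<in> colon R K w"
    have *: "a \<otimes> (b \<otimes> w) \<in> K" using ab wc by (simp add: colon_def m_assoc)
    show "a \<in> colon R K w \<or> b \<in> colon R K w"
    proof (cases "b \<otimes> w \<in> K")
      case False
      have "colon R K w \<subseteq> colon R K (b \<otimes> w)"
      proof
        fix r assume "r \<in> colon R K w"
        then have r: "r \<in> carrier R" "b \<otimes> (r \<otimes> w) \<in> K"
          using ab(2) K.I_l_closed by (auto simp: colon_def)
        then show "r \<in> colon R K (b \<otimes> w)"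
          using m_lcomm[OF ab(2) r(1) wc(1)] by (simp add: colon_def)
      qed
      then have "colon R K (b \<otimes> w) = colon R K w" using Wmax[OF w _ False] ab(2) wc by simp
      moreover have "a \<in> colon R K (b \<otimes> w)" using * ab(1) by (simp add: colon_def)
      ultimately show ?thesis by simp
    qed (use ab in \<open>simp add: colon_def\<close>)
  qed
  obtain F where F: "finite F" "F \<subseteq> W" "W \<subseteq> Idl F"
    using finite_subset_generates[OF Wc] by blast
  have rep: "\<exists>f\<in>F. colon R K f = colon R K w" if w: "w \<in> W" for w
  proof (rule ccontr)
    assume n: "\<not> ?thesis"
    interpret w: primeideal "colon R K w" R using w by (rule prime)
    have wc: "w \<in> carrier R" "w \<notin> K" using w by (auto simp: W_def)
    have av: "\<exists>a\<in>carrier R. a \<notin> colon R K w \<and> a \<otimes> f \<in> K" if f: "f \<in> F" for f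
    proof -
      have "\<not> colon R K f \<subseteq> colon R K w"
        using Wmax[OF subsetD[OF F(2) f] wc] f n by auto
      then obtain a where "a \<in> colon R K f" "a \<notin> colon R K w" unfolding subset_iff by blast
      then show ?thesis unfolding mem_colon_iff by blast
    qed
    have "finite G \<Longrightarrow> G \<subseteq> F \<Longrightarrow> \<exists>a\<in>carrier R. a \<notin> colon R K w \<and> (\<forall>f\<in>G. a \<otimes> f \<in> K)" for G
    proof (induction G rule: finite_induct)
      case empty
      then show ?case using w.one_notin by blast
    next
      case (insert f G)
      obtain a where a: "a \<in> carrier R" "a \<notin> colon R K w" "\<forall>f\<in>G. a \<otimes> f \<in> K"
        using insert by blast
      obtain b where b: "b \<in> carrier R" "b \<notin> colon R K w" "b \<otimes> f \<in> K"
        using av[of f] insert.prems by blast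
      have Fc: "g \<in> carrier R" if "g \<in> insert f G" for g using that insert.prems F(2) Wc by blast
      have "a \<otimes> b \<otimes> g \<in> K" if g: "g \<in> insert f G" for g
      proof (cases "g = f")
        case True
        have "a \<otimes> (b \<otimes> f) \<in> K" using b(3) a(1) by (rule K.I_l_closed)
        then show ?thesis using True a(1) b(1) Fc[OF g] by (simp add: m_assoc)
      next
        case False
        then have "b \<otimes> (a \<otimes> g) \<in> K" using a(3) g b(1) K.I_l_closed by simp
        moreover have "a \<otimes> b \<otimes> g = b \<otimes> (a \<otimes> g)" using a(1) b(1) Fc[OF g] by algebra
        ultimately show ?thesis by simp
      qed
      then show ?case using a b w.mult_mem_iff by (intro bexI[of _ "a \<otimes> b"]) simp_all
    qed
    then obtain a where a: "a \<in> carrier R" "a \<notin> colon R K w" "\<And>f. f \<in> F \<Longrightarrow> a \<otimes> f \<in> K"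
      using F(1) by (metis order_refl)
    have "F \<subseteq> colon R K a"
    proof
      fix f assume f: "f \<in> F"
      then have "f \<in> carrier R" using F(2) Wc by blast
      then show "f \<in> colon R K a"
        using a(3)[OF f] m_comm[OF a(1), of f] unfolding mem_colon_iff by metis
    qed
    then have "Idl F \<subseteq> colon R K a" using ci[OF a(1)] by (rule genideal_minimal[rotated])
    then have "w \<in> colon R K a" using F(3) w by blast
    then have "a \<in> colon R K w"
      using a(1) m_comm[OF a(1) wc(1)] unfolding mem_colon_iff by metis
    then show False using a(2) by simp
  qed
  have "\<exists>p\<in>colon R K ` F. x \<in> p" if x: "x \<in> carrier R" "\<not> regular_mod R K x" for x
  proof -
    obtain z where z: "z \<in> carrier R - K" "x \<otimes> z \<in> K" using x(2) by (auto simp: regular_mod_def)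
    obtain w where w: "w \<in> W" "colon R K z \<subseteq> colon R K w" using ex[OF z(1)] by blast
    have "x \<in> colon R K z" using x z by (simp add: colon_def)
    then show ?thesis using rep[OF w(1)] w(2) by blast
  qed
  moreover have "\<forall>p\<in>colon R K ` F. primeideal p R \<and> (\<exists>z\<in>carrier R - K. p = colon R K z)"
    using F(2) prime by (auto simp: W_def)
  ultimately show ?thesis using F(1) by (intro exI[of _ "colon R K ` F"]) simp
qed

text \<open>If every element of \<open>J\<close> were a zero divisor modulo one of the given ideals,
  prime avoidance would place \<open>J\<close> inside a single associated prime (K : z), and
  \<open>J\<close> would kill z. Several ideals at once are needed in
  \<open>has_socle_invariant\<close>.\<close>

lemma ex_regular_element:
  assumes "finite \<K>" "\<And>K. K \<in> \<K> \<Longrightarrow> ideal K R" "ideal J R"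
    and "\<And>K. K \<in> \<K> \<Longrightarrow> \<not> has_socle R J K"
  shows "\<exists>u\<in>J. \<forall>K\<in>\<K>. regular_mod R K u"
proof (rule ccontr)
  assume n: "\<not> ?thesis"
  interpret J: ideal J R by fact
  have "\<forall>K\<in>\<K>. \<exists>F. finite F \<and> (\<forall>p\<in>F. primeideal p R \<and> (\<exists>z\<in>carrier R - K. p = colon R K z)) \<and>
    (\<forall>x\<in>carrier R. \<not> regular_mod R K x \<longrightarrow> (\<exists>p\<in>F. x \<in> p))"
    using assms(2) finite_associated_primes by simp
  then obtain F where F: "\<forall>K\<in>\<K>. finite (F K) \<and>
      (\<forall>p\<in>F K. primeideal p R \<and> (\<exists>z\<in>carrier R - K. p = colon R K z)) \<and>
      (\<forall>x\<in>carrier R. \<not> regular_mod R K x \<longrightarrow> (\<exists>p\<in>F K. x \<in> p))"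
    by (elim bchoice[THEN exE])
  have "J \<subseteq> \<Union>(\<Union>(F ` \<K>))"
  proof
    fix x assume x: "x \<in> J"
    have "\<not> (\<forall>K\<in>\<K>. regular_mod R K x)" using n x by simp
    then obtain K where K: "K \<in> \<K>" "\<not> regular_mod R K x" by auto
    then have "\<exists>p\<in>F K. x \<in> p" using bspec[OF F K(1)] J.Icarr[OF x] by simp
    then show "x \<in> \<Union>(\<Union>(F ` \<K>))" using K(1) by auto
  qed
  moreover have "finite (\<Union>(F ` \<K>))" using assms(1) F by simp
  moreover have "primeideal p R" if "p \<in> \<Union>(F ` \<K>)" for p using F that by blast
  ultimately obtain p where "p \<in> \<Union>(F ` \<K>)" "J \<subseteq> p"
    using prime_avoidance[of "\<Union>(F ` \<K>)" J] assms(3) by meson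
  then obtain K where K': "K \<in> \<K>" "p \<in> F K" by blast
  then obtain z where "z \<in> carrier R - K" "p = colon R K z" using bspec[OF F K'(1)] by blast
  with K' \<open>J \<subseteq> p\<close> have K: "K \<in> \<K>" "z \<in> carrier R - K" "J \<subseteq> colon R K z" by simp_all
  have "\<forall>j\<in>J. j \<otimes> z \<in> K" using K(3) mem_colon_iff by blast
  then have "has_socle R J K" using K(2) unfolding has_socle_def by blast
  then show False using assms(4) K by simp
qed

text \<open>Both sides say that Ext^n(R/J, R/K) is nonzero, n being the common length. Choose u in
  \<open>J\<close> regular at the stages of both sequences without their last elements. In each
  sequence the last element is exchanged for u and u is moved to the front, so that the shorter
  sequences can be compared modulo K + Ru.\<close>

theorem has_socle_invariant:
  assumes "ideal J R" "ideal K R" "set xs \<subseteq> J" "set ys \<subseteq> J" "length xs = length ys"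
    and "regular_on R K xs" "regular_on R K ys" "has_socle R J (adjoins R K xs)"
  shows "has_socle R J (adjoins R K ys)"
  using assms(2-)
proof (induction "length xs" arbitrary: K xs ys)
  case (Suc n)
  interpret J: ideal J R by fact
  have Jc: "J \<subseteq> carrier R" using J.Icarr by auto
  obtain xs' x where xs: "xs = xs' @ [x]" using Suc.hyps(2) by (cases xs rule: rev_cases) auto
  obtain ys' y where ys: "ys = ys' @ [y]" using Suc.hyps(2) Suc.prems(4) by (cases ys rule: rev_cases) auto
  let ?K = "set (partial_adjoins R K xs') \<union> set (partial_adjoins R K ys')"
  have c: "set xs' \<subseteq> carrier R" "set ys' \<subseteq> carrier R" using Suc.prems xs ys Jc by auto
  have "\<exists>u\<in>J. \<forall>L\<in>?K. regular_mod R L u"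
  proof (rule ex_regular_element)
    show "ideal L R" if "L \<in> ?K" for L
      using that partial_adjoins_ideal[OF Suc.prems(1)] c by auto
    show "\<not> has_socle R J L" if L: "L \<in> ?K" for L
    proof -
      have "\<exists>v\<in>J. regular_mod R L v"
        using L ex_regular_partial_adjoins[of R K xs' x L] ex_regular_partial_adjoins[of R K ys' y L]
          Suc.prems(2,3,5,6) xs ys by blast
      then show ?thesis using not_regular_mod_of_socle by metis
    qed
  qed (use assms(1) in auto)
  then obtain u where u: "u \<in> J" "\<And>L. L \<in> ?K \<Longrightarrow> regular_mod R L u" by auto
  have uc: "u \<in> carrier R" using u Jc by auto
  have rx: "regular_on R (adjoin R K u) xs'" "regular_mod R (adjoins R K xs') x"
    and ry: "regular_on R (adjoin R K u) ys'" "regular_mod R (adjoins R K ys') y"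
    using Suc.prems xs ys c uc u(2) by (auto simp: regular_on_append intro!: regular_on_adjoin)
  have ui: "regular_mod R (adjoins R K xs') u" "regular_mod R (adjoins R K ys') u"
    using u(2) last_partial_adjoins[of R K xs'] last_partial_adjoins[of R K ys'] by auto
  have i: "ideal (adjoins R K xs') R" "ideal (adjoins R K ys') R"
    using adjoins_ideal Suc.prems(1) c by auto
  have "has_socle R J (adjoin R (adjoins R K xs') u)"
    using has_socle_exchange[OF i(1) Jc _ u(1) rx(2) ui(1)] Suc.prems(2,7) xs by simp
  then have "has_socle R J (adjoins R (adjoin R K u) xs')"
    using adjoins_adjoin[OF Suc.prems(1) c(1) uc] by simp
  then have "has_socle R J (adjoins R (adjoin R K u) ys')"
    using Suc.hyps Suc.prems xs ys rx ry uc
    by (intro Suc.hyps(1)[of xs' "adjoin R K u" ys']) (auto simp: adjoin_ideal)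
  then have "has_socle R J (adjoin R (adjoins R K ys') u)"
    using adjoins_adjoin[OF Suc.prems(1) c(2) uc] by simp
  then show ?case
    using has_socle_exchange[OF i(2) Jc u(1) _ ui(2) ry(2)] Suc.prems(3) ys by simp
qed simp

text \<open>Were \<open>ys\<close> longer, its initial part as long as \<open>xs\<close> would leave
  a nonzero element killed by \<open>J\<close>, but the next entry of \<open>ys\<close> is regular
  there.\<close>

corollary maximal_regular_length_le:
  assumes "ideal J R" "ideal K R" "set xs \<subseteq> J" "set ys \<subseteq> J"
    and "regular_on R K xs" "regular_on R K ys" "has_socle R J (adjoins R K xs)"
  shows "length ys \<le> length xs"
proof (rule ccontr)
  assume "\<not> ?thesis"
  then have l: "length xs < length ys" by simp
  define us where "us = take (length xs) ys"
  define y where "y = ys ! length xs"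
  have ys: "ys = us @ y # drop (Suc (length xs)) ys"
    unfolding us_def y_def using l by (simp add: id_take_nth_drop)
  then have r: "regular_on R K us" "regular_mod R (adjoins R K us) y" and m: "set us \<subseteq> J" "y \<in> J"
    using assms(4,6) regular_on_append[of R K us "y # drop (Suc (length xs)) ys"]
    by (auto simp: us_def y_def l dest: in_set_takeD)
  have "has_socle R J (adjoins R K us)"
    using has_socle_invariant[OF assms(1-3) m(1) _ assms(5) r(1) assms(7)] l by (simp add: us_def)
  then show False using not_regular_mod_of_socle m(2) r(2) by metis
qed

text \<open>Take \<open>xs\<close> whose ideal is maximal. A further regular element u of
  \<open>J\<close> would already lie in that ideal, and cancelling u in u1 would put 1
  there.\<close>

lemma ex_maximal_regular:
  assumes J: "ideal J R" "J \<noteq> carrier R"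
  shows "\<exists>xs. set xs \<subseteq> J \<and> regular_on R {\<zero>} xs \<and> has_socle R J (adjoins R {\<zero>} xs)"
proof -
  interpret J: ideal J R by fact
  have Jc: "J \<subseteq> carrier R" using J.Icarr by auto
  let ?S = "{adjoins R {\<zero>} xs | xs. set xs \<subseteq> J \<and> regular_on R {\<zero>} xs}"
  have "adjoins R {\<zero>} [] \<in> ?S" by (intro CollectI exI[of _ "[]"]) simp
  moreover have "ideal L R" if "L \<in> ?S" for L
    using that adjoins_ideal[OF zeroideal] Jc by auto
  ultimately have "\<exists>M\<in>?S. \<forall>N\<in>?S. M \<subseteq> N \<longrightarrow> N = M" by (intro ex_maximal) auto
  then obtain xs where xs: "set xs \<subseteq> J" "regular_on R {\<zero>} xs"
    "\<forall>N\<in>?S. adjoins R {\<zero>} xs \<subseteq> N \<longrightarrow> N = adjoins R {\<zero>} xs" by blast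
  let ?K = "adjoins R {\<zero>} xs"
  have Ki: "ideal ?K R" using xs(1) Jc adjoins_ideal[OF zeroideal] by simp
  have KJ: "?K \<subseteq> J" using xs(1) J.zero_closed by (intro adjoins_least J(1)) simp_all
  have "has_socle R J ?K"
  proof (rule ccontr)
    assume "\<not> ?thesis"
    then obtain u where u: "u \<in> J" "regular_mod R ?K u"
      using ex_regular_element[of "{?K}" J] Ki J(1) by auto
    have uc: "u \<in> carrier R" using u Jc by auto
    have "adjoin R ?K u \<in> ?S"
      by (rule CollectI, rule exI[of _ "xs @ [u]"]) (use xs u in \<open>simp add: regular_on_append\<close>)
    then have "adjoin R ?K u = ?K" using xs(3) adjoin_supset[OF Ki uc] by blast
    then have "u \<otimes> \<one> \<in> ?K" using adjoin_self[OF Ki uc] uc by simp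
    then have "\<one> \<in> ?K" by (rule regular_modD[OF u(2)]) simp
    then have "\<one> \<in> J" using KJ by blast
    then show False using J.one_imp_carrier J(2) by blast
  qed
  then show ?thesis using xs by blast
qed

end

subsection \<open>A ring as a module over itself\<close>

lemma self_module_simps [simp]:
  "carrier (self_module A) = carrier A" "zero (self_module A) = zero A"
  "add (self_module A) = add A" "smult (self_module A) = mult A"
  "a_inv (self_module A) = a_inv A"
  by (simp_all add: self_module_def a_inv_def m_inv_def fun_eq_iff)

lemma self_module_cosets [simp]:
  "a_r_coset (self_module A) = a_r_coset A" "A_RCOSETS (self_module A) = A_RCOSETS A"
  by (simp_all add: fun_eq_iff a_r_coset_defs A_RCOSETS_defs)

lemma quot_self_module_simps:
  "carrier (quot_module (self_module A) K) = a_rcosets\<^bsub>A\<^esub> K"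
  "zero (quot_module (self_module A) K) = K"
  "smult (quot_module (self_module A) K) a X = (\<Union>x\<in>X. K +>\<^bsub>A\<^esub> (a \<otimes>\<^bsub>A\<^esub> x))"
  by (simp_all add: quot_module_def)

context cring
begin

lemma module_self: "module R (self_module R)"
proof (rule moduleI)
  show "abelian_group (self_module R)"
    by (rule abelian_groupI) (auto simp: a_ac intro: l_neg a_inv_closed)
qed (auto simp: l_distr r_distr m_assoc cring_axioms)

lemma submodule_self_iff: "submodule N R (self_module R) \<longleftrightarrow> ideal N R"
proof
  assume N: "submodule N R (self_module R)"
  note E = module.submoduleE[OF module_self N, simplified]
  obtain a where "a \<in> N" using E(2) by blast
  moreover from this have "\<zero> = \<ominus> a \<oplus> a" using E(1) by (simp add: subset_eq l_neg)
  ultimately have "\<zero> \<in> N" using E(3,5) by simp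
  then show "ideal N R" using E by (intro idealI') auto
next
  assume "ideal N R"
  then interpret N: ideal N R .
  show "submodule N R (self_module R)"
    by (rule module.submoduleI[OF module_self]) (use N.Icarr N.I_l_closed in auto)
qed

lemma module_span_self: "module_span R (self_module R) S = Idl S"
  by (simp add: module_span_def genideal_def submodule_self_iff)

lemma fin_gen_self: "fin_gen_module R (self_module R)"
  unfolding fin_gen_module_def
  by (intro exI[of _ "{\<one>}"]) (simp add: module_span_self genideal_one)

lemma ideal_smult_self:
  assumes "ideal J R"
  shows "ideal_smult R J (self_module R) = J"
proof -
  interpret J: ideal J R by fact
  have "{a \<otimes> x | a x. a \<in> J \<and> x \<in> carrier R} = J" (is "?S = J")
  proof
    show "?S \<subseteq> J" using J.I_r_closed by auto
    show "J \<subseteq> ?S"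
    proof
      fix a assume "a \<in> J"
      then have "a = a \<otimes> \<one>" by (simp add: J.Icarr)
      then show "a \<in> ?S" using \<open>a \<in> J\<close> by blast
    qed
  qed
  moreover have "Idl J = J"
    using genideal_minimal[OF assms order_refl] genideal_self[of J] J.Icarr by blast
  ultimately show ?thesis by (simp add: ideal_smult_def module_span_self)
qed

lemma coset_eq_iff:
  assumes "ideal K R" "b \<in> carrier R"
  shows "K +> b = K \<longleftrightarrow> b \<in> K"
  using a_rcos_zero[OF assms(1), of b] ideal.rcos_const_imp_mem[OF assms] by blast

text \<open>Scalar multiplication on cosets is a union over all representatives, each of which
  contributes the same coset.\<close>

lemma smult_coset:
  assumes K: "ideal K R" and a: "a \<in> carrier R" and b: "b \<in> carrier R"
  shows "(\<Union>x\<in>K +> b. K +> (a \<otimes> x)) = K +> (a \<otimes> b)"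
proof -
  interpret K: ideal K R by fact
  have "K +> (a \<otimes> x) = K +> (a \<otimes> b)" if "x \<in> K +> b" for x
  proof -
    obtain k where k: "k \<in> K" "x = k \<oplus> b" using \<open>x \<in> K +> b\<close> by (auto simp: a_r_coset_def')
    have kc: "k \<in> carrier R" using k(1) by (rule K.Icarr)
    have "a \<otimes> x \<ominus> a \<otimes> b = a \<otimes> k" unfolding k(2) using a b kc by algebra
    then have "a \<otimes> x \<ominus> a \<otimes> b \<in> K" using K.I_l_closed[OF k(1) a] by simp
    then show ?thesis using quotient_eq_iff_same_a_r_cos[OF K] a b kc k(2) by simp
  qed
  moreover have "b \<in> K +> b"
    using b K.zero_closed by (auto simp: a_r_coset_def' intro!: bexI[of _ \<zero>])
  ultimately show ?thesis by blast
qed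

lemma annihilator_self: "annihilator R (self_module R) = {\<zero>}"
proof -
  have "a = \<zero>" if "a \<in> carrier R" "\<forall>x\<in>carrier R. a \<otimes> x = \<zero>" for a
    using that(1) bspec[OF that(2) one_closed] by simp
  then show ?thesis by (auto simp: annihilator_def)
qed

text \<open>The coset of one is killed by \<open>J\<close> only, so the dimension of the module R/J
  is that of the ring R/J.\<close>

lemma annihilator_quot_self:
  assumes J: "ideal J R"
  shows "annihilator R (quot_module (self_module R) J) = J"
proof -
  interpret J: ideal J R by fact
  have "(\<forall>X\<in>a_rcosets J. (\<Union>x\<in>X. J +> (a \<otimes> x)) = J) \<longleftrightarrow> a \<in> J" if a: "a \<in> carrier R" for a
  proof -
    have "(\<forall>X\<in>a_rcosets J. (\<Union>x\<in>X. J +> (a \<otimes> x)) = J) \<longleftrightarrow>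
      (\<forall>b\<in>carrier R. (\<Union>x\<in>J +> b. J +> (a \<otimes> x)) = J)"
      by (auto simp: A_RCOSETS_def')
    also have "\<dots> \<longleftrightarrow> (\<forall>b\<in>carrier R. a \<otimes> b \<in> J)"
      using a by (simp add: smult_coset[OF J a] coset_eq_iff[OF J])
    also have "\<dots> \<longleftrightarrow> a \<in> J" using a J.I_r_closed by (metis one_closed r_one)
    finally show ?thesis .
  qed
  then have "annihilator R (quot_module (self_module R) J) = {a \<in> carrier R. a \<in> J}"
    unfolding annihilator_def quot_self_module_simps by blast
  then show ?thesis using J.Icarr by blast
qed

lemma regular_on_iff_nth:
  "regular_on R K xs \<longleftrightarrow> (\<forall>i<length xs. regular_mod R (adjoins R K (take i xs)) (xs ! i))"
proof (induction xs arbitrary: K)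
  case (Cons x xs)
  have "(\<forall>i<length (x # xs). regular_mod R (adjoins R K (take i (x # xs))) ((x # xs) ! i)) \<longleftrightarrow>
    regular_mod R K x \<and> (\<forall>i<length xs. regular_mod R (adjoins R (adjoin R K x) (take i xs)) (xs ! i))"
    by (auto simp: less_Suc_eq_0_disj)
  then show ?case using Cons by simp
qed simp

lemma regular_seq_self_iff:
  "regular_seq R (self_module R) xs \<longleftrightarrow>
    set xs \<subseteq> carrier R \<and> regular_on R {\<zero>} xs \<and> adjoins R {\<zero>} xs \<noteq> carrier R"
proof (cases "set xs \<subseteq> carrier R")
  case True
  have sub: "set (take i xs) \<subseteq> carrier R" for i using True set_take_subset by fast
  have i: "ideal (adjoins R {\<zero>} (take i xs)) R" for i using adjoins_ideal[OF zeroideal sub] .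
  have smult: "ideal_smult R (Idl (set (take i xs))) (self_module R) = adjoins R {\<zero>} (take i xs)" for i
    using Idl_eq_adjoins[OF sub] ideal_smult_self[OF i] by simp
  have *: "(\<forall>X\<in>a_rcosets K. (\<Union>z\<in>X. K +> (x \<otimes> z)) = K \<longrightarrow> X = K) \<longleftrightarrow> regular_mod R K x"
    if K: "ideal K R" and x: "x \<in> carrier R" for K x
  proof -
    have "(\<forall>X\<in>a_rcosets K. (\<Union>z\<in>X. K +> (x \<otimes> z)) = K \<longrightarrow> X = K) \<longleftrightarrow>
      (\<forall>b\<in>carrier R. (\<Union>z\<in>K +> b. K +> (x \<otimes> z)) = K \<longrightarrow> K +> b = K)"
      by (auto simp: A_RCOSETS_def')
    also have "\<dots> \<longleftrightarrow> (\<forall>b\<in>carrier R. x \<otimes> b \<in> K \<longrightarrow> b \<in> K)"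
      using x by (simp add: smult_coset[OF K x] coset_eq_iff[OF K])
    finally show ?thesis by (simp add: regular_mod_def)
  qed
  have "ideal_smult R (Idl (set xs)) (self_module R) = adjoins R {\<zero>} xs"
    using smult[of "length xs"] by simp
  then show ?thesis
    using True * i
    unfolding regular_seq_def Let_def smult quot_self_module_simps regular_on_iff_nth
    by (simp add: subset_eq)
qed (simp add: regular_seq_def)

end

context noetherian_cring
begin

text \<open>A regular sequence in \<open>J\<close> stops when \<open>J\<close> consists of zero
  divisors at the last stage, and then \<open>J\<close> kills a single nonzero element there. All
  ideals involved lie in the proper ideal \<open>J\<close>.\<close>

lemma maximal_regular_seq_self_iff:
  assumes J: "ideal J R" "J \<noteq> carrier R"
  shows "maximal_regular_seq_in R (self_module R) J xs \<longleftrightarrow>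
    set xs \<subseteq> J \<and> regular_on R {\<zero>} xs \<and> has_socle R J (adjoins R {\<zero>} xs)"
proof -
  interpret J: ideal J R by fact
  have Jc: "J \<subseteq> carrier R" using J.Icarr by blast
  have reg: "regular_seq R (self_module R) ys \<longleftrightarrow> regular_on R {\<zero>} ys" if ys: "set ys \<subseteq> J" for ys
  proof -
    have "adjoins R {\<zero>} ys \<subseteq> J" using J(1) _ ys by (rule adjoins_least) simp
    then have "adjoins R {\<zero>} ys \<noteq> carrier R" using J(2) Jc by blast
    then show ?thesis using subset_trans[OF ys Jc] by (simp add: regular_seq_self_iff)
  qed
  show ?thesis
  proof (cases "set xs \<subseteq> J")
    case True
    have i: "ideal (adjoins R {\<zero>} xs) R"
      using adjoins_ideal[OF zeroideal subset_trans[OF True Jc]] .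
    have "(\<forall>y\<in>J. \<not> regular_seq R (self_module R) (xs @ [y])) \<longleftrightarrow>
      (\<forall>y\<in>J. \<not> regular_mod R (adjoins R {\<zero>} xs) y)" if "regular_on R {\<zero>} xs"
      using True that by (simp add: reg regular_on_append)
    moreover have "(\<forall>y\<in>J. \<not> regular_mod R (adjoins R {\<zero>} xs) y) \<longleftrightarrow>
      has_socle R J (adjoins R {\<zero>} xs)"
      using ex_regular_element[of "{adjoins R {\<zero>} xs}" J] i J(1)
        not_regular_mod_of_socle[of R J "adjoins R {\<zero>} xs"] by blast
    ultimately show ?thesis using True by (auto simp: maximal_regular_seq_in_def reg)
  qed (simp add: maximal_regular_seq_in_def)
qed

text \<open>\<open>maximal_regular_length_le\<close> in both directions shows that the description
  in \<open>grade\<close> singles out one number.\<close>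

lemma grade_self:
  assumes J: "ideal J R" "J \<noteq> carrier R"
    and xs: "set xs \<subseteq> J" "regular_on R {\<zero>} xs" "has_socle R J (adjoins R {\<zero>} xs)"
  shows "grade R J (self_module R) = length xs"
  unfolding grade_def maximal_regular_seq_self_iff[OF J]
proof (rule the_equality)
  fix k assume "\<exists>ys. (set ys \<subseteq> J \<and> regular_on R {\<zero>} ys \<and> has_socle R J (adjoins R {\<zero>} ys)) \<and> length ys = k"
  then show "k = length xs"
    using maximal_regular_length_le[OF J(1) zeroideal] xs by (meson le_antisym)
qed (use xs in blast)

end

subsection \<open>Krull dimension of quotients\<close>

text \<open>The dimension of R/J expressed in R, see \<open>krull_dim_Quot\<close>; it is minus
  infinity when no prime contains \<open>J\<close>.\<close>

definition chain_dim :: "('a, 'm) ring_scheme \<Rightarrow> 'a set \<Rightarrow> ereal"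
  where "chain_dim R J = Sup {ereal (real m) | m. \<exists>p. prime_chain R J m p}"

lemma krull_dim_eq_chain_dim: "krull_dim A = chain_dim A {}"
proof -
  \<comment> \<open>Recording the top member in \<open>P k = p\<close> makes the induction on k
    possible.\<close>
  have *: "(\<exists>P. (\<forall>i\<le>k. primeideal (P i) A) \<and> (\<forall>i<k. P i \<subset> P (Suc i)) \<and> P k = p) \<longleftrightarrow>
    prime_chain A {} k p" for k p
  proof (induction k arbitrary: p)
    case 0
    then show ?case by auto
  next
    case (Suc k)
    have "(\<exists>P. (\<forall>i\<le>Suc k. primeideal (P i) A) \<and> (\<forall>i<Suc k. P i \<subset> P (Suc i)) \<and> P (Suc k) = p) \<longleftrightarrow>
      primeideal p A \<and> (\<exists>q. (\<exists>P. (\<forall>i\<le>k. primeideal (P i) A) \<and> (\<forall>i<k. P i \<subset> P (Suc i)) \<and> P k = q) \<and> q \<subset> p)"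
      (is "?l \<longleftrightarrow> ?r")
    proof
      assume ?l
      then obtain P where P: "\<forall>i\<le>Suc k. primeideal (P i) A" "\<forall>i<Suc k. P i \<subset> P (Suc i)" "P (Suc k) = p"
        by blast
      show ?r
        by (intro conjI exI[of _ "P k"] exI[of _ P]) (use P in \<open>simp_all add: less_Suc_eq_le flip: P(3)\<close>)
    next
      assume ?r
      then obtain P where P: "primeideal p A" "\<forall>i\<le>k. primeideal (P i) A"
        "\<forall>i<k. P i \<subset> P (Suc i)" "P k \<subset> p" by blast
      show ?l
        by (intro exI[of _ "P(Suc k := p)"]) (use P in \<open>auto simp: le_Suc_eq less_Suc_eq\<close>)
    qed
    then show ?case using Suc by simp
  qed
  have "(\<exists>P. (\<forall>i\<le>k. primeideal (P i) A) \<and> (\<forall>i<k. P i \<subset> P (Suc i))) \<longleftrightarrow>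
    (\<exists>p. prime_chain A {} k p)" for k unfolding *[symmetric] by blast
  then show ?thesis by (simp add: krull_dim_def chain_dim_def)
qed

text \<open>Serves both R -> R/J and the passage from R to the ring in zero variables.\<close>

locale surjective_ring_hom = ring_hom_cring +
  assumes surj: "h ` carrier R = carrier S"
begin

lemma primeideal_vimage:
  assumes "primeideal q S"
  shows "primeideal {r \<in> carrier R. h r \<in> q} R"
proof -
  interpret q: primeideal q S by fact
  show ?thesis
  proof (rule R.primeidealI')
    have "ring_hom_ring R S h" ..
    then show "ideal {r \<in> carrier R. h r \<in> q} R"
      using ring_hom_ring.ideal_vimage q.ideal_axioms by blast
    show "\<one> \<notin> {r \<in> carrier R. h r \<in> q}" using q.one_notin by simp
  qed (use q.mult_mem_iff in auto)
qed

text \<open>Surjectivity keeps the inclusions strict.\<close>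

lemma prime_chain_vimage:
  "prime_chain S J m q \<Longrightarrow> prime_chain R {r \<in> carrier R. h r \<in> J} m {r \<in> carrier R. h r \<in> q}"
proof (induction m arbitrary: q)
  case 0
  then show ?case using primeideal_vimage by auto
next
  case (Suc m)
  then obtain p where p: "prime_chain S J m p" "p \<subset> q" "primeideal q S" by (metis prime_chain.simps(2))
  obtain y where y: "y \<in> q" "y \<notin> p" using p(2) by blast
  then have "y \<in> carrier S" using ideal.Icarr[OF primeideal.axioms(1)[OF p(3)]] by blast
  then obtain r where r: "r \<in> carrier R" "h r = y" using surj by (metis imageE)
  have "{r \<in> carrier R. h r \<in> p} \<subseteq> {r \<in> carrier R. h r \<in> q}" using p(2) by blast
  moreover have "r \<in> {r \<in> carrier R. h r \<in> q}" "r \<notin> {r \<in> carrier R. h r \<in> p}" using r y by simp_all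
  ultimately have "{r \<in> carrier R. h r \<in> p} \<subset> {r \<in> carrier R. h r \<in> q}"
    unfolding psubset_eq by metis
  then show ?case by (rule prime_chain_SucI[OF Suc.IH[OF p(1)] _ primeideal_vimage[OF p(3)]])
qed

lemma image_mem_iff:
  assumes p: "ideal p R" and k: "a_kernel R S h \<subseteq> p" and a: "a \<in> carrier R"
  shows "h a \<in> h ` p \<longleftrightarrow> a \<in> p"
proof
  interpret p: ideal p R by fact
  assume "h a \<in> h ` p"
  then obtain b where b: "b \<in> p" "h a = h b" by blast
  have bc: "b \<in> carrier R" using b(1) by (rule p.Icarr)
  have "h (a \<ominus> b) = \<zero>\<^bsub>S\<^esub>" using a bc b(2) by (simp add: R.minus_eq S.r_neg)
  then have "a \<ominus> b \<in> a_kernel R S h" unfolding a_kernel_def' using R.minus_closed[OF a bc] by blast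
  then have "a \<ominus> b \<in> p" by (rule subsetD[OF k])
  moreover have "a = (a \<ominus> b) \<oplus> b" using a bc by algebra
  ultimately show "a \<in> p" using b(1) p.a_closed by metis
qed simp

lemma primeideal_image:
  assumes "primeideal p R" and k: "a_kernel R S h \<subseteq> p"
  shows "primeideal (h ` p) S"
proof -
  interpret p: primeideal p R by fact
  note iff = image_mem_iff[OF p.ideal_axioms k]
  have pc: "p \<subseteq> carrier R" using p.Icarr by blast
  show ?thesis
  proof (rule S.primeidealI')
    show "ideal (h ` p) S"
    proof (rule S.idealI')
      show "h ` p \<subseteq> carrier S" using pc by auto
      show "\<zero>\<^bsub>S\<^esub> \<in> h ` p" using p.zero_closed hom_zero by (metis imageI)
      fix a b assume "a \<in> h ` p" "b \<in> h ` p"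
      then obtain u v where "u \<in> p" "v \<in> p" "a = h u" "b = h v" by blast
      then have "a \<oplus>\<^bsub>S\<^esub> b = h (u \<oplus> v)" "u \<oplus> v \<in> p" using pc p.a_closed by auto
      then show "a \<oplus>\<^bsub>S\<^esub> b \<in> h ` p" by blast
    next
      fix a s assume "a \<in> h ` p" "s \<in> carrier S"
      then obtain u t where "u \<in> p" "t \<in> carrier R" "a = h u" "s = h t"
        using surj by (metis imageE)
      then have "s \<otimes>\<^bsub>S\<^esub> a = h (t \<otimes> u)" "t \<otimes> u \<in> p" using pc p.I_l_closed by auto
      then show "s \<otimes>\<^bsub>S\<^esub> a \<in> h ` p" by blast
    qed
    show "\<one>\<^bsub>S\<^esub> \<notin> h ` p" using iff[OF R.one_closed] p.one_notin by simp
    fix a b assume "a \<in> carrier S" "b \<in> carrier S" and ab: "a \<otimes>\<^bsub>S\<^esub> b \<in> h ` p"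
    then obtain u v where uv: "u \<in> carrier R" "v \<in> carrier R" "a = h u" "b = h v"
      using surj by (metis imageE)
    then show "a \<in> h ` p \<or> b \<in> h ` p"
      using ab iff[of "u \<otimes> v"] iff[of u] iff[of v] p.mult_mem_iff by simp
  qed
qed

lemma prime_chain_image:
  "prime_chain R (a_kernel R S h) m p \<Longrightarrow> prime_chain S {} m (h ` p)"
proof (induction m arbitrary: p)
  case 0
  then show ?case using primeideal_image by simp
next
  case (Suc m)
  then obtain q where q: "prime_chain R (a_kernel R S h) m q" "q \<subset> p" "primeideal p R"
    by (metis prime_chain.simps(2))
  have k: "a_kernel R S h \<subseteq> q" "primeideal q R" using prime_chainD[OF q(1)] by auto
  obtain x where x: "x \<in> p" "x \<notin> q" using q(2) by blast
  have "h x \<notin> h ` q"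
    using image_mem_iff[OF primeideal.axioms(1)[OF k(2)] k(1)] x
      ideal.Icarr[OF primeideal.axioms(1)[OF q(3)] x(1)] by simp
  then have "h ` q \<subset> h ` p" using q(2) x(1) by blast
  moreover have "primeideal (h ` p) S" using q(2,3) k(1) by (intro primeideal_image) auto
  ultimately show ?case by (rule prime_chain_SucI[OF Suc.IH[OF q(1)]])
qed

end

lemma (in cring) krull_dim_Quot:
  assumes J: "ideal J R"
  shows "krull_dim (R Quot J) = chain_dim R J"
proof -
  interpret J: ideal J R by fact
  interpret h: surjective_ring_hom R "R Quot J" "(+>) J"
  proof (intro surjective_ring_hom.intro surjective_ring_hom_axioms.intro)
    show "ring_hom_cring R (R Quot J) ((+>) J)" using J.rcos_ring_hom_cring[OF cring_axioms] .
    show "(+>) J ` carrier R = carrier (R Quot J)" by (auto simp: FactRing_def A_RCOSETS_def')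
  qed
  have eqJ: "{r \<in> carrier R. J +> r = J} = J"
  proof (rule Set.set_eqI)
    show "r \<in> {r \<in> carrier R. J +> r = J} \<longleftrightarrow> r \<in> J" for r
      using coset_eq_iff[OF J, of r] J.Icarr[of r] by blast
  qed
  have zero: "\<zero>\<^bsub>R Quot J\<^esub> = J" unfolding FactRing_def by simp
  have ker: "a_kernel R (R Quot J) ((+>) J) = J"
    unfolding a_kernel_def' zero by (rule eqJ)
  have "(\<exists>p. prime_chain (R Quot J) {} m p) \<longleftrightarrow> (\<exists>p. prime_chain R J m p)" for m
  proof
    assume "\<exists>p. prime_chain (R Quot J) {} m p"
    then obtain p where p: "prime_chain (R Quot J) {} m p" ..
    \<comment> \<open>The zero of the quotient is the coset \<open>J\<close>, which every prime
      contains. Testing against the set with this one element makes the preimages lie over the ideal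
      \<open>J\<close>.\<close>
    have "prime_chain (R Quot J) {J} m p"
      using p
    proof (induction m arbitrary: p)
      case 0
      then have "\<zero>\<^bsub>R Quot J\<^esub> \<in> p"
        using additive_subgroup.zero_closed ideal.axioms(1) primeideal.axioms(1) by fastforce
      then show ?case using 0 unfolding zero by simp
    qed auto
    from h.prime_chain_vimage[OF this]
    have "prime_chain R {r \<in> carrier R. J +> r \<in> {J}} m {r \<in> carrier R. J +> r \<in> p}" .
    then show "\<exists>p. prime_chain R J m p" unfolding singleton_iff eqJ by blast
  next
    assume "\<exists>p. prime_chain R J m p"
    then show "\<exists>p. prime_chain (R Quot J) {} m p" using h.prime_chain_image unfolding ker by blast
  qed
  then show ?thesis by (simp add: krull_dim_eq_chain_dim chain_dim_def)
qed

text \<open>Both dimensions in the definition turn into lengths of chains in R, over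
  \<open>J\<close> and over 0.\<close>

lemma (in noetherian_cring) ideal_cohen_macaulay_ring_iff:
  assumes J: "ideal J R" "J \<noteq> carrier R"
  shows "ideal_cohen_macaulay_ring R J \<longleftrightarrow>
    ereal (real (grade R J (self_module R))) + chain_dim R J = chain_dim R {\<zero>}"
  using J module_self fin_gen_self cring_axioms noetherian_ring_axioms
  by (simp add: ideal_cohen_macaulay_ring_def ideal_cohen_macaulay_module_def module_dim_def
      ideal_smult_self annihilator_self annihilator_quot_self krull_dim_Quot zeroideal)

subsection \<open>Extensions of a Noetherian ring by one element\<close>

text \<open>The subring is given by its carrier \<open>A\<close> within the same record, because
  series in n variables form a subset of those in n + 1 variables.\<close>

locale noetherian_extension = cring +
  fixes A
  assumes A_sub: "A \<subseteq> carrier R" and A_noetherian: "noetherian_cring (R\<lparr>carrier := A\<rparr>)"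
begin

lemma A_closed:
  "\<zero> \<in> A" "\<one> \<in> A" "a \<in> A \<Longrightarrow> b \<in> A \<Longrightarrow> a \<oplus> b \<in> A" "a \<in> A \<Longrightarrow> b \<in> A \<Longrightarrow> a \<otimes> b \<in> A"
  "a \<in> A \<Longrightarrow> \<ominus> a \<in> A"
proof -
  interpret A: noetherian_cring "R\<lparr>carrier := A\<rparr>" by (rule A_noetherian)
  show "\<zero> \<in> A" "\<one> \<in> A" using A.zero_closed A.one_closed by simp_all
  show "a \<oplus> b \<in> A" "a \<otimes> b \<in> A" if "a \<in> A" "b \<in> A" for a b
    using A.a_closed[of a b] A.m_closed[of a b] that by simp_all
  show "\<ominus> a \<in> A" if a: "a \<in> A" for a
  proof -
    have ac: "a \<in> carrier R" using a A_sub by blast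
    obtain b where b: "b \<in> A" "b \<oplus> a = \<zero>" using A.l_neg[of a] A.a_inv_closed[of a] a by auto
    then have "\<ominus> a = b" using minus_equality[of b a] ac A_sub by blast
    then show ?thesis using b by simp
  qed
qed

lemma A_carr: "a \<in> A \<Longrightarrow> a \<in> carrier R"
  using A_sub by blast

lemma A_idealI:
  assumes "K \<subseteq> A" "\<zero> \<in> K" "\<And>a b. a \<in> K \<Longrightarrow> b \<in> K \<Longrightarrow> a \<oplus> b \<in> K"
    "\<And>a r. a \<in> K \<Longrightarrow> r \<in> A \<Longrightarrow> r \<otimes> a \<in> K"
  shows "ideal K (R\<lparr>carrier := A\<rparr>)"
proof -
  interpret A: noetherian_cring "R\<lparr>carrier := A\<rparr>" by (rule A_noetherian)
  show ?thesis by (rule A.idealI') (use assms in simp_all)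
qed

text \<open>Generation is expressed through all ideals that contain \<open>F\<close>; this fits
  ideals described by coefficients, to which it is applied.\<close>

lemma A_finite_generators:
  assumes "X \<subseteq> A"
  shows "\<exists>F. finite F \<and> F \<subseteq> X \<and> (\<forall>K. ideal K (R\<lparr>carrier := A\<rparr>) \<longrightarrow> F \<subseteq> K \<longrightarrow> X \<subseteq> K)"
proof -
  interpret A: noetherian_cring "R\<lparr>carrier := A\<rparr>" by (rule A_noetherian)
  obtain F where "finite F" "F \<subseteq> X" "X \<subseteq> genideal (R\<lparr>carrier := A\<rparr>) F"
    using A.finite_subset_generates[of X] assms by auto
  then show ?thesis using A.genideal_minimal by (intro exI[of _ F]) (meson subset_trans)
qed

lemma contract_primeideal:
  assumes "primeideal q R"
  shows "primeideal (q \<inter> A) (R\<lparr>carrier := A\<rparr>)"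
proof -
  interpret A: noetherian_cring "R\<lparr>carrier := A\<rparr>" by (rule A_noetherian)
  interpret q: primeideal q R by fact
  show ?thesis
  proof (rule A.primeidealI')
    show "ideal (q \<inter> A) (R\<lparr>carrier := A\<rparr>)"
      by (rule A_idealI) (use A_closed A_carr q.zero_closed q.a_closed q.I_l_closed in auto)
    show "\<one>\<^bsub>R\<lparr>carrier := A\<rparr>\<^esub> \<notin> q \<inter> A" using q.one_notin by simp
    fix a b assume "a \<in> carrier (R\<lparr>carrier := A\<rparr>)" "b \<in> carrier (R\<lparr>carrier := A\<rparr>)"
      "a \<otimes>\<^bsub>R\<lparr>carrier := A\<rparr>\<^esub> b \<in> q \<inter> A"
    then show "a \<in> q \<inter> A \<or> b \<in> q \<inter> A" using q.mult_mem_iff[of a b] A_carr by auto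
  qed
qed

text \<open>If \<open>M \<inter> A\<close> is minimal over \<open>d\<close> elements, then \<open>M\<close> is minimal over these and \<open>y\<close>.\<close>

lemma height_step:
  assumes "noetherian_cring R" and M: "primeideal M R" and y: "y \<in> M"
    and fibre: "\<And>L. primeideal L R \<Longrightarrow> L \<subseteq> M \<Longrightarrow> y \<in> L \<Longrightarrow> L \<inter> A = M \<inter> A \<Longrightarrow> L = M"
    and J: "ideal J (R\<lparr>carrier := A\<rparr>)" "J \<subseteq> J'"
    and bound: "\<And>m p. prime_chain (R\<lparr>carrier := A\<rparr>) J m p \<Longrightarrow> m \<le> d"
    and chain: "prime_chain R J' m M"
  shows "m \<le> Suc d"
proof -
  interpret R: noetherian_cring R by fact
  interpret A: noetherian_cring "R\<lparr>carrier := A\<rparr>" by (rule A_noetherian)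
  have J'M: "J' \<subseteq> M" using prime_chainD[OF chain] by simp
  have JA: "J \<subseteq> A" using ideal.Icarr[OF J(1)] by auto
  obtain X where X: "finite X" "card X \<le> d" "minimal_over (R\<lparr>carrier := A\<rparr>) (J \<union> X) (M \<inter> A)"
    using A.krull_height_converse[OF J(1) contract_primeideal[OF M], of d] bound J(2) J'M JA by blast
  have XM: "X \<subseteq> M" using X(3) by (auto simp: minimal_over_def)
  have XA: "X \<subseteq> A" using X(3) by (auto simp: minimal_over_def)
  have "minimal_over R (J' \<union> insert y X) M"
    unfolding minimal_over_def
  proof (intro conjI allI impI)
    show "J' \<union> insert y X \<subseteq> M" using J'M y XM by blast
    fix L assume L: "primeideal L R" "J' \<union> insert y X \<subseteq> L" "L \<subseteq> M"
    have "J \<union> X \<subseteq> L \<inter> A" using L(2) J(2) JA XA by blast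
    moreover have "L \<inter> A \<subseteq> M \<inter> A" using L(3) by blast
    ultimately have "L \<inter> A = M \<inter> A"
      using X(3) contract_primeideal[OF L(1)] unfolding minimal_over_def by blast
    then show "L = M" using fibre L by blast
  qed (rule M)
  moreover have "card (insert y X) \<le> Suc d" using X(1,2) by (simp add: card_insert_if)
  ultimately show ?thesis using R.krull_height[OF _ _ _ chain] X(1) by blast
qed

end

subsection \<open>Power series in one variable\<close>

text \<open>An abstract form of R = A[[x]]. In \<open>power_sums\<close>, \<open>s k\<close> is the
  sum of all x^j c (k + j), so completeness is expressed by the recursion of the tails, without a
  topology. By \<open>separated\<close>, an element divisible by x over and over is 0, which makes
  such sums unique.\<close>

locale series_extension = noetherian_extension +
  fixes x
  assumes x_closed [simp]: "x \<in> carrier R"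
    and decompose: "f \<in> carrier R \<Longrightarrow> \<exists>a\<in>A. \<exists>g\<in>carrier R. f = a \<oplus> x \<otimes> g"
    and power_sums: "(\<And>k :: nat. c k \<in> carrier R) \<Longrightarrow>
      \<exists>s. \<forall>k. s k \<in> carrier R \<and> s k = c k \<oplus> x \<otimes> s (Suc k)"
    and separated: "(\<And>k :: nat. h k \<in> carrier R) \<Longrightarrow> (\<And>k. h k = x \<otimes> h (Suc k)) \<Longrightarrow> h 0 = \<zero>"
begin

text \<open>The constant terms of \<open>N\<close> form an ideal of \<open>A\<close>; finitely many
  generators of it lift to \<open>F\<close>. An element of \<open>Idl F\<close> with the constant
  term of f differs from f by a multiple xh, and h lies in (N : x).\<close>

lemma lift_generators:
  assumes N: "ideal N R"
  shows "\<exists>F. finite F \<and> F \<subseteq> N \<and> (\<forall>f\<in>N. \<exists>g\<in>Idl F. \<exists>h\<in>colon R N x. f = g \<oplus> x \<otimes> h)"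
proof -
  define LC where "LC N = {a \<in> A. \<exists>h\<in>carrier R. a \<oplus> x \<otimes> h \<in> N}" for N
  have LC: "ideal (LC N) (R\<lparr>carrier := A\<rparr>)" if N: "ideal N R" for N
  proof (rule A_idealI)
    interpret N: ideal N R by fact
    have "\<zero> \<oplus> x \<otimes> \<zero> \<in> N" using N.zero_closed by simp
    then show "\<zero> \<in> LC N" unfolding LC_def using A_closed(1) by blast
    fix a b assume "a \<in> LC N" "b \<in> LC N"
    then obtain h g where h: "a \<in> A" "b \<in> A" "h \<in> carrier R" "g \<in> carrier R"
      "a \<oplus> x \<otimes> h \<in> N" "b \<oplus> x \<otimes> g \<in> N" unfolding LC_def by blast
    have "(a \<oplus> b) \<oplus> x \<otimes> (h \<oplus> g) = (a \<oplus> x \<otimes> h) \<oplus> (b \<oplus> x \<otimes> g)"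
      using A_carr[OF h(1)] A_carr[OF h(2)] h(3,4) x_closed by algebra
    then have "(a \<oplus> b) \<oplus> x \<otimes> (h \<oplus> g) \<in> N" using N.a_closed[OF h(5,6)] by simp
    then show "a \<oplus> b \<in> LC N" unfolding LC_def using A_closed(3) h(1-4) a_closed by blast
  next
    interpret N: ideal N R by fact
    fix a r assume "a \<in> LC N" and r: "r \<in> A"
    then obtain h where h: "a \<in> A" "h \<in> carrier R" "a \<oplus> x \<otimes> h \<in> N" unfolding LC_def by blast
    have "r \<otimes> a \<oplus> x \<otimes> (r \<otimes> h) = r \<otimes> (a \<oplus> x \<otimes> h)"
      using A_carr[OF h(1)] A_carr[OF r] h(2) x_closed by algebra
    then have "r \<otimes> a \<oplus> x \<otimes> (r \<otimes> h) \<in> N" using N.I_l_closed[OF h(3) A_carr[OF r]] by simp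
    then show "r \<otimes> a \<in> LC N" unfolding LC_def using A_closed(4) r h m_closed A_carr by blast
  qed (auto simp: LC_def)
  have "LC N \<subseteq> A" by (auto simp: LC_def)
  then obtain G where G: "finite G" "G \<subseteq> LC N"
    "\<And>K. ideal K (R\<lparr>carrier := A\<rparr>) \<Longrightarrow> G \<subseteq> K \<Longrightarrow> LC N \<subseteq> K" using A_finite_generators by metis
  have "\<forall>a\<in>G. \<exists>h. h \<in> carrier R \<and> a \<oplus> x \<otimes> h \<in> N" using G(2) unfolding LC_def by blast
  then obtain \<phi> where \<phi>: "\<forall>a\<in>G. \<phi> a \<in> carrier R \<and> a \<oplus> x \<otimes> \<phi> a \<in> N" by (rule bchoice[THEN exE])
  define F where "F = (\<lambda>a. a \<oplus> x \<otimes> \<phi> a) ` G"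
  have F: "finite F" "F \<subseteq> N" using G(1) \<phi> by (auto simp: F_def)
  have Nc: "N \<subseteq> carrier R" using ideal.Icarr[OF N] by blast
  have Fc: "F \<subseteq> carrier R" using F(2) Nc by blast
  have IF: "ideal (Idl F) R" using Fc by (rule genideal_ideal)
  have FN: "Idl F \<subseteq> N" using N F(2) by (rule genideal_minimal)
  have "G \<subseteq> LC (Idl F)"
  proof
    fix a assume a: "a \<in> G"
    then have "a \<oplus> x \<otimes> \<phi> a \<in> Idl F" using genideal_self[OF Fc] unfolding F_def by blast
    moreover have "a \<in> A" using a G(2) unfolding LC_def by blast
    ultimately show "a \<in> LC (Idl F)" using \<phi> a unfolding LC_def by blast
  qed
  then have sub: "LC N \<subseteq> LC (Idl F)" by (rule G(3)[OF LC[OF IF]])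
  have "\<exists>g\<in>Idl F. \<exists>h\<in>colon R N x. f = g \<oplus> x \<otimes> h" if f: "f \<in> N" for f
  proof -
    have fc: "f \<in> carrier R" using f Nc by blast
    obtain a h where a: "a \<in> A" "h \<in> carrier R" "f = a \<oplus> x \<otimes> h" using decompose[OF fc] by blast
    then have "a \<in> LC N" using f unfolding LC_def by blast
    then obtain h' where h': "h' \<in> carrier R" "a \<oplus> x \<otimes> h' \<in> Idl F"
      using sub unfolding LC_def by blast
    let ?g = "a \<oplus> x \<otimes> h'"
    have gc: "?g \<in> carrier R" using A_carr[OF a(1)] h'(1) by simp
    have e: "f = ?g \<oplus> x \<otimes> (h \<ominus> h')"
      unfolding a(3) using A_carr[OF a(1)] a(2) h'(1) x_closed by algebra
    have e2: "(h \<ominus> h') \<otimes> x = (a \<oplus> x \<otimes> h) \<ominus> ?g"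
      using A_carr[OF a(1)] a(2) h'(1) x_closed by algebra
    have "f \<ominus> ?g \<in> N" using ideal.minus_mem[OF N f] h'(2) FN by blast
    then have "h \<ominus> h' \<in> colon R N x"
      unfolding mem_colon_iff e2 a(3)[symmetric] using a(2) h'(1) by simp
    then show ?thesis using e h'(2) by blast
  qed
  then show ?thesis using F by blast
qed

text \<open>Finitely generated ideals are closed under the infinite sums of
  \<open>power_sums\<close>: with g k = l k + (r k) y, the coefficients r k can be summed in R. The
  induction starts from an ideal \<open>K\<close> that has the property.\<close>

lemma power_sums_ideal:
  assumes K: "ideal K R" and xs: "set xs \<subseteq> carrier R"
    and "\<And>g :: nat \<Rightarrow> 'a. (\<And>k. g k \<in> K) \<Longrightarrow> \<exists>u. \<forall>k. u k \<in> K \<and> u k = g k \<oplus> x \<otimes> u (Suc k)"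
    and "\<And>k :: nat. g k \<in> adjoins R K xs"
  shows "\<exists>u. \<forall>k. u k \<in> adjoins R K xs \<and> u k = g k \<oplus> x \<otimes> u (Suc k)"
  using assms
proof (induction xs arbitrary: K)
  case (Cons y ys)
  interpret K: ideal K R by (rule Cons.prems)
  have y: "y \<in> carrier R" using Cons.prems by simp
  have "\<exists>u. \<forall>k. u k \<in> adjoin R K y \<and> u k = g k \<oplus> x \<otimes> u (Suc k)"
    if g: "\<And>k :: nat. g k \<in> adjoin R K y" for g
  proof -
    have "\<forall>k. \<exists>l r. l \<in> K \<and> r \<in> carrier R \<and> g k = l \<oplus> r \<otimes> y"
      using g unfolding adjoin_def by blast
    then obtain l r where lr: "\<And>k. l k \<in> K" "\<And>k. r k \<in> carrier R" "\<And>k. g k = l k \<oplus> r k \<otimes> y"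
      by metis
    have "\<exists>u. \<forall>k. u k \<in> K \<and> u k = l k \<oplus> x \<otimes> u (Suc k)" by (rule Cons.prems(3)) (rule lr(1))
    then obtain u where u: "\<And>k. u k \<in> K" "\<And>k. u k = l k \<oplus> x \<otimes> u (Suc k)" by metis
    have "\<exists>s. \<forall>k. s k \<in> carrier R \<and> s k = r k \<oplus> x \<otimes> s (Suc k)"
      by (rule power_sums) (rule lr(2))
    then obtain s where s: "\<And>k. s k \<in> carrier R" "\<And>k. s k = r k \<oplus> x \<otimes> s (Suc k)" by metis
    let ?v = "\<lambda>k. u k \<oplus> s k \<otimes> y"
    have v: "?v k = g k \<oplus> x \<otimes> ?v (Suc k)" for k
    proof -
      have c: "l k \<in> carrier R" "u (Suc k) \<in> carrier R" using K.Icarr lr(1) u(1) by blast+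
      have "?v k = (l k \<oplus> x \<otimes> u (Suc k)) \<oplus> (r k \<oplus> x \<otimes> s (Suc k)) \<otimes> y"
        unfolding u(2)[of k, symmetric] s(2)[of k, symmetric] ..
      also have "\<dots> = g k \<oplus> x \<otimes> ?v (Suc k)"
        unfolding lr(3) using c lr(2)[of k] s(1)[of "Suc k"] y x_closed by algebra
      finally show ?thesis .
    qed
    have "?v k \<in> adjoin R K y" for k using u(1) s(1) unfolding adjoin_def by blast
    then show ?thesis using v by (intro exI[of _ ?v] allI conjI)
  qed
  then have "\<exists>u. \<forall>k. u k \<in> adjoins R (adjoin R K y) ys \<and> u k = g k \<oplus> x \<otimes> u (Suc k)"
    by (rule Cons.IH[rotated 2]) (use Cons.prems(2,4) y in \<open>simp_all add: adjoin_ideal K.ideal_axioms\<close>)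
  then show ?case by simp
qed simp

text \<open>As h stays in \<open>N\<close>, \<open>lift_generators\<close> can be iterated to f = g
  0 + x g 1 + x^2 g 2 + ..., and this sum lies in the finitely generated ideal
  \<open>Idl F\<close>.\<close>

lemma finitely_generated_if_colon_eq:
  assumes N: "ideal N R" and eq: "colon R N x = N"
  shows "\<exists>F. finite F \<and> F \<subseteq> N \<and> N \<subseteq> Idl F"
proof -
  obtain F where F: "finite F" "F \<subseteq> N"
    and step: "\<forall>f\<in>N. \<exists>g\<in>Idl F. \<exists>h\<in>N. f = g \<oplus> x \<otimes> h"
    using lift_generators[OF N] unfolding eq by blast
  obtain xs where xs: "set xs = F" using finite_list[OF F(1)] by blast
  have Nc: "N \<subseteq> carrier R" using ideal.Icarr[OF N] by blast
  have Fc: "set xs \<subseteq> carrier R" using F(2) Nc xs by blast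
  have IF: "Idl F = adjoins R {\<zero>} xs" using Idl_eq_adjoins[OF Fc] xs by simp
  have Ic: "Idl F \<subseteq> carrier R"
    using ideal.Icarr[OF genideal_ideal[OF Fc]] unfolding xs by blast
  have "f \<in> Idl F" if f: "f \<in> N" for f
  proof -
    have "\<forall>f\<in>N. \<exists>h. h \<in> N \<and> (\<exists>g\<in>Idl F. f = g \<oplus> x \<otimes> h)" using step by blast
    then obtain \<nu> where \<nu>: "\<forall>f\<in>N. \<nu> f \<in> N \<and> (\<exists>g\<in>Idl F. f = g \<oplus> x \<otimes> \<nu> f)" by (rule bchoice[THEN exE])
    \<comment> \<open>\<open>w k\<close> is what remains of f after k divisions by x.\<close>
    define w where "w k = (\<nu> ^^ k) f" for k
    have wN: "w k \<in> N" for k by (induction k) (use f \<nu> in \<open>simp_all add: w_def\<close>)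
    have "\<exists>g\<in>Idl F. w k = g \<oplus> x \<otimes> w (Suc k)" for k using \<nu> wN[of k] by (simp add: w_def)
    then obtain g where g: "\<And>k. g k \<in> Idl F" "\<And>k. w k = g k \<oplus> x \<otimes> w (Suc k)" by metis
    have "\<exists>u. \<forall>k. u k \<in> Idl F \<and> u k = g k \<oplus> x \<otimes> u (Suc k)"
      unfolding IF
    proof (rule power_sums_ideal[OF zeroideal Fc])
      fix g :: "nat \<Rightarrow> 'a" assume "\<And>k. g k \<in> {\<zero>}"
      then show "\<exists>u. \<forall>k. u k \<in> {\<zero>} \<and> u k = g k \<oplus> x \<otimes> u (Suc k)"
        by (intro exI[of _ "\<lambda>_. \<zero>"]) simp
    qed (use g(1) IF in simp)
    then obtain u where u: "\<And>k. u k \<in> Idl F" "\<And>k. u k = g k \<oplus> x \<otimes> u (Suc k)" by metis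
    have c: "w k \<in> carrier R" "u k \<in> carrier R" "g k \<in> carrier R" for k
      using wN u(1) g(1) Nc Ic by blast+
    \<comment> \<open>\<open>w\<close> and \<open>u\<close> obey the same recursion, so their
      difference is divisible by x over and over.\<close>
    have "w 0 \<ominus> u 0 = \<zero>"
    proof (rule separated)
      show "w k \<ominus> u k \<in> carrier R" for k using c by simp
      show "w k \<ominus> u k = x \<otimes> (w (Suc k) \<ominus> u (Suc k))" for k
      proof -
        have "w k \<ominus> u k = (g k \<oplus> x \<otimes> w (Suc k)) \<ominus> (g k \<oplus> x \<otimes> u (Suc k))"
          unfolding g(2)[of k, symmetric] u(2)[of k, symmetric] ..
        also have "\<dots> = x \<otimes> (w (Suc k) \<ominus> u (Suc k))" using c[of k] c[of "Suc k"] x_closed by algebra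
        finally show ?thesis .
      qed
    qed
    then have "w 0 = u 0" using c[of 0] by simp
    then show "f \<in> Idl F" using u(1)[of 0] by (simp add: w_def)
  qed
  then show ?thesis using F by blast
qed

text \<open>An element of \<open>N\<close> is a combination of \<open>F\<close> plus xh, and h is a
  combination of \<open>G\<close>; hence \<open>F\<close> together with the products of
  \<open>G\<close> by x generates \<open>N\<close>.\<close>

lemma finitely_generated_if_colon:
  assumes N: "ideal N R" and G: "finite G" "G \<subseteq> colon R N x" "colon R N x \<subseteq> Idl G"
  shows "\<exists>F. finite F \<and> F \<subseteq> N \<and> N \<subseteq> Idl F"
proof -
  obtain F where F: "finite F" "F \<subseteq> N"
    and step: "\<forall>f\<in>N. \<exists>g\<in>Idl F. \<exists>h\<in>colon R N x. f = g \<oplus> x \<otimes> h"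
    using lift_generators[OF N] by blast
  let ?H = "F \<union> (\<lambda>h. h \<otimes> x) ` G"
  have HN: "?H \<subseteq> N" using F(2) G(2) mem_colon_iff by blast
  have Hc: "?H \<subseteq> carrier R" using HN ideal.Icarr[OF N] by blast
  have I: "ideal (Idl ?H) R" using Hc by (rule genideal_ideal)
  have "G \<subseteq> colon R (Idl ?H) x"
  proof
    fix h assume h: "h \<in> G"
    then have "h \<otimes> x \<in> Idl ?H" by (intro subsetD[OF genideal_self[OF Hc]]) simp
    then show "h \<in> colon R (Idl ?H) x"
      using subsetD[OF G(2) h] unfolding mem_colon_iff by simp
  qed
  then have "Idl G \<subseteq> colon R (Idl ?H) x" by (rule genideal_minimal[OF colon_ideal[OF I x_closed]])
  then have col: "h \<in> carrier R \<and> h \<otimes> x \<in> Idl ?H" if "h \<in> colon R N x" for h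
    using subsetD[OF G(3) that] subsetD[OF \<open>Idl G \<subseteq> _\<close>] unfolding mem_colon_iff by simp
  have FH: "Idl F \<subseteq> Idl ?H" using subset_Idl_subset[OF Hc] by simp
  have "N \<subseteq> Idl ?H"
  proof
    fix f assume "f \<in> N"
    then obtain g h where gh: "g \<in> Idl F" "h \<in> colon R N x" "f = g \<oplus> x \<otimes> h" using step by blast
    have "x \<otimes> h \<in> Idl ?H" using col[OF gh(2)] m_comm[OF x_closed, of h] by simp
    then show "f \<in> Idl ?H"
      unfolding gh(3) using additive_subgroup.a_closed[OF ideal.axioms(1)[OF I]] gh(1) FH by blast
  qed
  then show ?thesis using F(1) G(1) HN by (intro exI[of _ ?H]) simp
qed

text \<open>The ideals (N : x^k) ascend. Their union U satisfies (U : x) = U and is therefore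
  finitely generated, hence equal to one of them. Finite generation then passes down to
  \<open>N\<close>, one power of x at a time.\<close>

theorem noetherian: "noetherian_cring R"
proof (rule noetherianI)
  fix N assume N: "ideal N R"
  define J where "J = rec_nat N (\<lambda>_ K. colon R K x)"
  have J0: "J 0 = N" and JS: "J (Suc k) = colon R (J k) x" for k by (simp_all add: J_def)
  have Ji: "ideal (J k) R" for k
    by (induction k) (simp_all add: J0 JS N colon_ideal)
  have mono: "J k \<subseteq> J (Suc k)" for k unfolding JS using Ji x_closed by (rule colon_supset)
  have mono': "J i \<subseteq> J j" if "i \<le> j" for i j using lift_Suc_mono_le[of J, OF mono that] .
  define U where "U = (\<Union>k. J k)"
  have U: "ideal U R"
  proof (rule idealI')
    show "U \<subseteq> carrier R" using ideal.Icarr[OF Ji] unfolding U_def by blast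
    show "\<zero> \<in> U" using additive_subgroup.zero_closed[OF ideal.axioms(1)[OF Ji]]
      unfolding U_def by blast
    fix a b assume "a \<in> U" "b \<in> U"
    then obtain i j where "a \<in> J i" "b \<in> J j" unfolding U_def by blast
    then have "a \<in> J (max i j)" "b \<in> J (max i j)" using mono'[of i "max i j"] mono'[of j "max i j"] by auto
    then have "a \<oplus> b \<in> J (max i j)" by (rule additive_subgroup.a_closed[OF ideal.axioms(1)[OF Ji]])
    then show "a \<oplus> b \<in> U" unfolding U_def by blast
  next
    fix a r assume "a \<in> U" "r \<in> carrier R"
    then show "r \<otimes> a \<in> U" using ideal.I_l_closed[OF Ji] unfolding U_def by blast
  qed
  have "colon R U x = U"
  proof
    show "U \<subseteq> colon R U x" using U x_closed by (rule colon_supset)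
    show "colon R U x \<subseteq> U"
    proof
      fix r assume "r \<in> colon R U x"
      then obtain k where "r \<in> carrier R" "r \<otimes> x \<in> J k" unfolding mem_colon_iff U_def by blast
      then have "r \<in> J (Suc k)" unfolding JS mem_colon_iff by simp
      then show "r \<in> U" unfolding U_def by blast
    qed
  qed
  then obtain F where F: "finite F" "F \<subseteq> U" "U \<subseteq> Idl F"
    using finitely_generated_if_colon_eq[OF U] by blast
  have "\<exists>n. F \<subseteq> J n"
    using F(1,2)
  proof (induction F rule: finite_induct)
    case (insert f F)
    then obtain n k where nk: "F \<subseteq> J n" "f \<in> J k" unfolding U_def by blast
    have "insert f F \<subseteq> J (max n k)"
      using nk mono'[of n "max n k"] mono'[of k "max n k"] by auto
    then show ?case by blast
  qed simp
  then obtain n where "F \<subseteq> J n" by blast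
  then have "\<exists>F. finite F \<and> F \<subseteq> J n \<and> J n \<subseteq> Idl F" using F(1,3) unfolding U_def by blast
  then have "\<exists>F. finite F \<and> F \<subseteq> J 0 \<and> J 0 \<subseteq> Idl F"
  proof (induction n)
    case (Suc n)
    then obtain G where "finite G" "G \<subseteq> colon R (J n) x" "colon R (J n) x \<subseteq> Idl G"
      unfolding JS by blast
    then show ?case using finitely_generated_if_colon[OF Ji] Suc.IH by blast
  qed
  then show "\<exists>F. finite F \<and> F \<subseteq> N \<and> N \<subseteq> Idl F" unfolding J0 .
qed

text \<open>This puts x into the Jacobson radical: if 1 = p + rx, the geometric series in rx is an
  inverse of p. It is the element \<open>s 0\<close>.\<close>

lemma adjoin_proper:
  assumes P: "ideal P R" "\<one> \<notin> P"
  shows "\<one> \<notin> adjoin R P x"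
proof
  assume "\<one> \<in> adjoin R P x"
  then obtain p r where p: "p \<in> P" "r \<in> carrier R" "\<one> = p \<oplus> r \<otimes> x" unfolding adjoin_def by blast
  have pc: "p \<in> carrier R" using P(1) p(1) by (rule ideal.Icarr)
  have "r [^] k \<in> carrier R" for k :: nat using p(2) by simp
  then have "\<exists>s. \<forall>k. s k \<in> carrier R \<and> s k = r [^] (k::nat) \<oplus> x \<otimes> s (Suc k)"
    by (rule power_sums)
  then obtain s where s: "\<And>k. s k \<in> carrier R" "\<And>k. s k = r [^] (k::nat) \<oplus> x \<otimes> s (Suc k)"
    by metis
  \<comment> \<open>Formally s k is r^k times the geometric series, so r s k and s (k + 1) should
    agree; the differences satisfy the recursion of \<open>separated\<close>.\<close>
  have "r \<otimes> s 0 \<ominus> s (Suc 0) = \<zero>"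
  proof (rule separated[where h = "\<lambda>k. r \<otimes> s k \<ominus> s (Suc k)"])
    show "r \<otimes> s k \<ominus> s (Suc k) \<in> carrier R" for k using s(1) p(2) by simp
    show "r \<otimes> s k \<ominus> s (Suc k) = x \<otimes> (r \<otimes> s (Suc k) \<ominus> s (Suc (Suc k)))" for k
    proof -
      have rk: "r [^] k \<in> carrier R" using p(2) by simp
      have "r \<otimes> s k \<ominus> s (Suc k) = r \<otimes> (r [^] k \<oplus> x \<otimes> s (Suc k)) \<ominus> (r [^] k \<otimes> r \<oplus> x \<otimes> s (Suc (Suc k)))"
        using s(2)[of k] s(2)[of "Suc k"] by simp
      also have "\<dots> = x \<otimes> (r \<otimes> s (Suc k) \<ominus> s (Suc (Suc k)))"
        using s(1)[of "Suc k"] s(1)[of "Suc (Suc k)"] p(2) x_closed rk by algebra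
      finally show ?thesis .
    qed
  qed
  then have eq: "s (Suc 0) = r \<otimes> s 0" using s(1) p(2) by simp
  have "\<one> = s 0 \<otimes> p"
  proof -
    have "s 0 = \<one> \<oplus> x \<otimes> (r \<otimes> s 0)" using s(2)[of 0] unfolding eq by simp
    also have "\<dots> = (p \<oplus> r \<otimes> x) \<oplus> x \<otimes> (r \<otimes> s 0)" unfolding p(3)[symmetric] ..
    finally have e: "s 0 = (p \<oplus> r \<otimes> x) \<oplus> x \<otimes> (r \<otimes> s 0)" .
    have "s 0 \<otimes> \<one> = s 0 \<otimes> (p \<oplus> r \<otimes> x)" unfolding p(3)[symmetric] ..
    then have "s 0 = s 0 \<otimes> p \<oplus> x \<otimes> (r \<otimes> s 0)" using s(1)[of 0] p(2) pc x_closed by (simp add: r_distr m_ac)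
    moreover have "s 0 = \<one> \<oplus> x \<otimes> (r \<otimes> s 0)" using s(2)[of 0] unfolding eq by simp
    ultimately have "s 0 \<otimes> p \<oplus> x \<otimes> (r \<otimes> s 0) = \<one> \<oplus> x \<otimes> (r \<otimes> s 0)" by simp
    then show ?thesis using s(1)[of 0] p(2) pc by simp
  qed
  then show False using ideal.I_l_closed[OF P(1) p(1) s(1)[of 0]] P(2) by simp
qed

text \<open>The top of the chain is enlarged to a prime \<open>M\<close> containing x. Such a prime
  is determined by \<open>M \<inter> A\<close>, because every f is a + xg with a in
  \<open>A\<close>; so x is the extra element for \<open>height_step\<close>.\<close>

theorem chain_bound:
  assumes J: "ideal J (R\<lparr>carrier := A\<rparr>)" "J \<subseteq> J'"
    and bound: "\<And>m p. prime_chain (R\<lparr>carrier := A\<rparr>) J m p \<Longrightarrow> m \<le> d"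
    and chain: "prime_chain R J' m P"
  shows "m \<le> Suc d"
proof -
  interpret noetherian_cring R by (rule noetherian)
  have P: "primeideal P R" using prime_chainD[OF chain] by simp
  interpret P: primeideal P R by (rule P)
  have "adjoin R P x \<noteq> carrier R" using adjoin_proper[OF P.ideal_axioms P.one_notin] one_closed by blast
  then obtain M where M: "primeideal M R" "adjoin R P x \<subseteq> M"
    using ex_prime_supset[OF adjoin_ideal[OF P.ideal_axioms x_closed]] by blast
  have xM: "x \<in> M" and PM: "P \<subseteq> M"
    using M(2) adjoin_self[OF P.ideal_axioms x_closed] adjoin_supset[OF P.ideal_axioms x_closed] by blast+
  interpret M: primeideal M R by (rule M)
  have "L = M" if L: "primeideal L R" "L \<subseteq> M" "x \<in> L" "L \<inter> A = M \<inter> A" for L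
  proof
    interpret L: primeideal L R by (rule L)
    show "M \<subseteq> L"
    proof
      fix f assume f: "f \<in> M"
      obtain a g where a: "a \<in> A" "g \<in> carrier R" "f = a \<oplus> x \<otimes> g"
        using decompose[OF M.Icarr[OF f]] by blast
      have "a \<in> M"
        using M.add_cancel_mem[OF A_carr[OF a(1)] M.I_r_closed[OF xM a(2)]] f unfolding a(3) by blast
      then have "a \<in> L" using L(4) a(1) by blast
      then show "f \<in> L" unfolding a(3) using L.a_closed L.I_r_closed[OF L(3) a(2)] by blast
    qed
  qed (rule L)
  then show ?thesis
    by (rule height_step[OF noetherian M(1) xM _ J _ prime_chain_upward[OF chain M(1) PM]])
      (auto intro: bound)
qed

end

subsection \<open>Polynomials in one variable\<close>

text \<open>Elements that have a presentation of degree less than d in x, so that d = 0 leaves only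
  zero. Working with presentations avoids coefficients and their uniqueness.\<close>

primrec poly_below :: "('a, 'm) ring_scheme \<Rightarrow> 'a set \<Rightarrow> 'a \<Rightarrow> nat \<Rightarrow> 'a set" where
  "poly_below R A x 0 = {\<zero>\<^bsub>R\<^esub>}"
| "poly_below R A x (Suc d) =
    {a \<otimes>\<^bsub>R\<^esub> (x [^]\<^bsub>R\<^esub> d) \<oplus>\<^bsub>R\<^esub> g | a g. a \<in> A \<and> g \<in> poly_below R A x d}"

declare poly_below.simps(2) [simp del]

text \<open>\<open>generated\<close> is induction along Horner's scheme: R is generated by x over
  \<open>A\<close>, and relations among the powers of x are allowed.\<close>

locale polynomial_extension = noetherian_extension +
  fixes x
  assumes x_closed [simp]: "x \<in> carrier R"
    and generated: "\<zero> \<in> S \<Longrightarrow> (\<And>a g. a \<in> A \<Longrightarrow> g \<in> S \<Longrightarrow> g \<in> carrier R \<Longrightarrow> a \<oplus> x \<otimes> g \<in> S) \<Longrightarrow> carrier R \<subseteq> S"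
begin

abbreviation "B \<equiv> poly_below R A x"

lemma B_SucI: "a \<in> A \<Longrightarrow> g \<in> B d \<Longrightarrow> a \<otimes> x [^] d \<oplus> g \<in> B (Suc d)"
  by (auto simp: poly_below.simps(2))

lemma B_SucE:
  assumes "f \<in> B (Suc d)"
  obtains a g where "a \<in> A" "g \<in> B d" "f = a \<otimes> x [^] d \<oplus> g"
  using assms by (auto simp: poly_below.simps(2))

lemma B_carr: "f \<in> B d \<Longrightarrow> f \<in> carrier R"
proof (induction d arbitrary: f)
  case (Suc d)
  then show ?case using A_carr by (elim B_SucE) simp
qed simp

lemma B_add: "f \<in> B d \<Longrightarrow> g \<in> B d \<Longrightarrow> f \<oplus> g \<in> B d"
proof (induction d arbitrary: f g)
  case (Suc d)
  obtain a f' b g' where *: "a \<in> A" "f' \<in> B d" "f = a \<otimes> x [^] d \<oplus> f'"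
    "b \<in> A" "g' \<in> B d" "g = b \<otimes> x [^] d \<oplus> g'" using Suc.prems by (elim B_SucE)
  have c: "a \<in> carrier R" "b \<in> carrier R" "f' \<in> carrier R" "g' \<in> carrier R" "x [^] d \<in> carrier R"
    using * A_carr B_carr by simp_all
  have "f \<oplus> g = (a \<oplus> b) \<otimes> x [^] d \<oplus> (f' \<oplus> g')" unfolding *(3,6) using c by algebra
  then show ?case using B_SucI[OF A_closed(3)[OF *(1,4)] Suc.IH[OF *(2,5)]] by simp
qed simp

lemma B_scale: "r \<in> A \<Longrightarrow> f \<in> B d \<Longrightarrow> r \<otimes> f \<in> B d"
proof (induction d arbitrary: f)
  case 0
  then show ?case using A_carr by simp
next
  case (Suc d)
  obtain a f' where *: "a \<in> A" "f' \<in> B d" "f = a \<otimes> x [^] d \<oplus> f'"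
    using Suc.prems(2) by (elim B_SucE)
  have c: "a \<in> carrier R" "r \<in> carrier R" "f' \<in> carrier R" "x [^] d \<in> carrier R"
    using * A_carr B_carr Suc.prems(1) by simp_all
  have "r \<otimes> f = (r \<otimes> a) \<otimes> x [^] d \<oplus> (r \<otimes> f')" unfolding *(3) using c by algebra
  then show ?case using B_SucI[OF A_closed(4)[OF Suc.prems(1) *(1)] Suc.IH[OF Suc.prems(1) *(2)]] by simp
qed

lemma B_minus: "f \<in> B d \<Longrightarrow> g \<in> B d \<Longrightarrow> f \<ominus> g \<in> B d"
proof -
  assume fg: "f \<in> B d" "g \<in> B d"
  have "\<ominus> \<one> \<otimes> g \<in> B d" using B_scale[OF A_closed(5)[OF A_closed(2)] fg(2)] .
  moreover have "f \<ominus> g = f \<oplus> \<ominus> \<one> \<otimes> g" using fg B_carr by (simp add: minus_eq l_minus)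
  ultimately show ?thesis using B_add[OF fg(1)] by simp
qed

lemma B_Suc: "f \<in> B d \<Longrightarrow> f \<in> B (Suc d)"
  using B_SucI[OF A_closed(1), of f d] B_carr[of f d] by simp

lemma B_shift: "f \<in> B d \<Longrightarrow> x \<otimes> f \<in> B (Suc d)"
proof (induction d arbitrary: f)
  case 0
  then show ?case using B_Suc[of \<zero> 0] by simp
next
  case (Suc d)
  obtain a f' where *: "a \<in> A" "f' \<in> B d" "f = a \<otimes> x [^] d \<oplus> f'"
    using Suc.prems by (elim B_SucE)
  have c: "a \<in> carrier R" "f' \<in> carrier R" "x [^] d \<in> carrier R"
    using * A_carr B_carr by simp_all
  have "x \<otimes> f = a \<otimes> (x [^] d \<otimes> x) \<oplus> (x \<otimes> f')" unfolding *(3) using c x_closed by algebra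
  then show ?case using B_SucI[OF *(1) Suc.IH[OF *(2)]] by simp
qed

lemma B_shift_power: "f \<in> B d \<Longrightarrow> x [^] (k::nat) \<otimes> f \<in> B (d + k)"
proof (induction k)
  case 0
  then show ?case using B_carr by simp
next
  case (Suc k)
  have "x [^] Suc k \<otimes> f = x \<otimes> (x [^] k \<otimes> f)" using B_carr[OF Suc.prems] by (simp add: m_ac)
  then show ?case using B_shift[OF Suc.IH[OF Suc.prems]] by simp
qed

lemma B_const: "a \<in> A \<Longrightarrow> f \<in> B (Suc d) \<Longrightarrow> a \<oplus> f \<in> B (Suc d)"
proof (induction d arbitrary: f)
  case 0
  then obtain b where b: "b \<in> A" "f = b \<otimes> x [^] (0::nat) \<oplus> \<zero>" by (auto elim: B_SucE)
  have "a \<oplus> f = (a \<oplus> b) \<otimes> x [^] (0::nat) \<oplus> \<zero>" unfolding b(2) using A_carr[OF b(1)] A_carr[OF 0(1)] by simp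
  then show ?case using B_SucI[OF A_closed(3)[OF 0(1) b(1)], of \<zero> 0] by simp
next
  case (Suc d)
  obtain b f' where *: "b \<in> A" "f' \<in> B (Suc d)" "f = b \<otimes> x [^] Suc d \<oplus> f'"
    using Suc.prems(2) by (rule B_SucE)
  have c: "a \<in> carrier R" "b \<in> carrier R" "f' \<in> carrier R" "x [^] Suc d \<in> carrier R"
    using * A_carr B_carr Suc.prems(1) by simp_all
  have "a \<oplus> f = b \<otimes> x [^] Suc d \<oplus> (a \<oplus> f')" unfolding *(3) using c by algebra
  then show ?case using B_SucI[OF *(1) Suc.IH[OF Suc.prems(1) *(2)]] by simp
qed

lemma carrier_B: "f \<in> carrier R \<Longrightarrow> \<exists>d. f \<in> B d"
proof -
  have "carrier R \<subseteq> (\<Union>d. B d)"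
  proof (rule generated)
    show "\<zero> \<in> (\<Union>d. B d)" by (rule UN_I[of 0]) simp_all
    fix a g assume a: "a \<in> A" and "g \<in> (\<Union>d. B d)"
    then obtain d where "g \<in> B d" by blast
    then have "a \<oplus> x \<otimes> g \<in> B (Suc d)" using B_const[OF a B_shift] by blast
    then show "a \<oplus> x \<otimes> g \<in> (\<Union>d. B d)" by blast
  qed
  then show "f \<in> carrier R \<Longrightarrow> \<exists>d. f \<in> B d" by blast
qed

definition lead :: "'a set \<Rightarrow> nat \<Rightarrow> 'a set"
  where "lead N d = {a \<in> A. \<exists>g\<in>B d. a \<otimes> x [^] d \<oplus> g \<in> N}"

lemma lead_ideal:
  assumes N: "ideal N R"
  shows "ideal (lead N d) (R\<lparr>carrier := A\<rparr>)"
proof (rule A_idealI)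
  interpret N: ideal N R by fact
  have p: "x [^] d \<in> carrier R" by simp
  have z: "\<zero> \<in> B d" by (induction d) (use B_Suc in simp_all)
  have "\<zero> \<otimes> x [^] d \<oplus> \<zero> \<in> N" using N.zero_closed by simp
  then show "\<zero> \<in> lead N d" unfolding lead_def using A_closed(1) z by blast
  fix a b assume "a \<in> lead N d" "b \<in> lead N d"
  then obtain h g where h: "a \<in> A" "b \<in> A" "h \<in> B d" "g \<in> B d"
    "a \<otimes> x [^] d \<oplus> h \<in> N" "b \<otimes> x [^] d \<oplus> g \<in> N" unfolding lead_def by blast
  have "(a \<oplus> b) \<otimes> x [^] d \<oplus> (h \<oplus> g) = (a \<otimes> x [^] d \<oplus> h) \<oplus> (b \<otimes> x [^] d \<oplus> g)"
    using A_carr[OF h(1)] A_carr[OF h(2)] B_carr[OF h(3)] B_carr[OF h(4)] p by algebra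
  then have "(a \<oplus> b) \<otimes> x [^] d \<oplus> (h \<oplus> g) \<in> N" using N.a_closed[OF h(5,6)] by simp
  then show "a \<oplus> b \<in> lead N d"
    unfolding lead_def using A_closed(3)[OF h(1,2)] B_add[OF h(3,4)] by blast
next
  interpret N: ideal N R by fact
  have p: "x [^] d \<in> carrier R" by simp
  fix a r assume "a \<in> lead N d" and r: "r \<in> A"
  then obtain h where h: "a \<in> A" "h \<in> B d" "a \<otimes> x [^] d \<oplus> h \<in> N" unfolding lead_def by blast
  have "(r \<otimes> a) \<otimes> x [^] d \<oplus> (r \<otimes> h) = r \<otimes> (a \<otimes> x [^] d \<oplus> h)"
    using A_carr[OF h(1)] A_carr[OF r] B_carr[OF h(2)] p by algebra
  then have "(r \<otimes> a) \<otimes> x [^] d \<oplus> (r \<otimes> h) \<in> N" using N.I_l_closed[OF h(3) A_carr[OF r]] by simp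
  then show "r \<otimes> a \<in> lead N d"
    unfolding lead_def using A_closed(4)[OF r h(1)] B_scale[OF r h(2)] by blast
qed (auto simp: lead_def)

lemma lead_Suc:
  assumes N: "ideal N R"
  shows "lead N d \<subseteq> lead N (Suc d)"
proof
  fix a assume "a \<in> lead N d"
  then obtain h where h: "a \<in> A" "h \<in> B d" "a \<otimes> x [^] d \<oplus> h \<in> N" unfolding lead_def by blast
  have p: "x [^] d \<in> carrier R" by simp
  have "a \<otimes> (x [^] d \<otimes> x) \<oplus> (x \<otimes> h) = x \<otimes> (a \<otimes> x [^] d \<oplus> h)"
    using A_carr[OF h(1)] B_carr[OF h(2)] p x_closed by algebra
  then have "a \<otimes> x [^] Suc d \<oplus> (x \<otimes> h) \<in> N" using ideal.I_l_closed[OF N h(3) x_closed] by simp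
  then show "a \<in> lead N (Suc d)" unfolding lead_def using h(1) B_shift[OF h(2)] by blast
qed

text \<open>Hilbert's basis theorem. Generators are collected in the degrees up to \<open>D\<close>,
  where the ideals of leading coefficients have stabilised; multiplication by powers of x carries
  them to higher degrees.\<close>

theorem noetherian: "noetherian_cring R"
proof (rule noetherianI)
  fix N assume N: "ideal N R"
  interpret N: ideal N R by fact
  have Nc: "N \<subseteq> carrier R" using N.Icarr by blast
  interpret A: noetherian_cring "R\<lparr>carrier := A\<rparr>" by (rule A_noetherian)
  obtain D where D: "\<And>i. D \<le> i \<Longrightarrow> lead N i = lead N D"
    using A.ascending_stabilises[of "lead N"] lead_ideal[OF N] lead_Suc[OF N] by blast
  have "\<exists>F. finite F \<and> F \<subseteq> N \<and> lead N d \<subseteq> lead (Idl F) d" for d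
  proof -
    have "lead N d \<subseteq> A" by (auto simp: lead_def)
    then obtain G where G: "finite G" "G \<subseteq> lead N d"
      "\<And>K. ideal K (R\<lparr>carrier := A\<rparr>) \<Longrightarrow> G \<subseteq> K \<Longrightarrow> lead N d \<subseteq> K" using A_finite_generators by metis
    have "\<forall>a\<in>G. \<exists>h. h \<in> B d \<and> a \<otimes> x [^] d \<oplus> h \<in> N" using G(2) unfolding lead_def by blast
    then obtain \<phi> where \<phi>: "\<forall>a\<in>G. \<phi> a \<in> B d \<and> a \<otimes> x [^] d \<oplus> \<phi> a \<in> N" by (rule bchoice[THEN exE])
    define F where "F = (\<lambda>a. a \<otimes> x [^] d \<oplus> \<phi> a) ` G"
    have F: "finite F" "F \<subseteq> N" using G(1) \<phi> by (auto simp: F_def)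
    have Fc: "F \<subseteq> carrier R" using F(2) Nc by blast
    have "G \<subseteq> lead (Idl F) d"
    proof
      fix a assume a: "a \<in> G"
      then have "a \<otimes> x [^] d \<oplus> \<phi> a \<in> Idl F" using genideal_self[OF Fc] unfolding F_def by blast
      moreover have "a \<in> A" using a G(2) unfolding lead_def by blast
      ultimately show "a \<in> lead (Idl F) d" using \<phi> a unfolding lead_def by blast
    qed
    then have "lead N d \<subseteq> lead (Idl F) d" by (rule G(3)[OF lead_ideal[OF genideal_ideal[OF Fc]]])
    then show ?thesis using F by blast
  qed
  then obtain F where F: "\<And>d. finite (F d)" "\<And>d. F d \<subseteq> N" "\<And>d. lead N d \<subseteq> lead (Idl (F d)) d"
    by metis
  define G where "G = (\<Union>d\<le>D. F d)"
  have G: "finite G" "G \<subseteq> N" using F(1,2) by (auto simp: G_def)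
  have Gc: "G \<subseteq> carrier R" using G(2) Nc by blast
  interpret I: ideal "Idl G" R using Gc by (rule genideal_ideal)
  have lead_mono: "lead K d \<subseteq> lead L d" if "K \<subseteq> L" for K L d using that unfolding lead_def by blast
  have below: "lead N d \<subseteq> lead (Idl G) d" if "d \<le> D" for d
  proof -
    have "F d \<subseteq> G" using that unfolding G_def by blast
    then have "Idl (F d) \<subseteq> Idl G" by (rule subset_Idl_subset[OF Gc])
    then show ?thesis using lead_mono F(3) by (meson subset_trans)
  qed
  have leads: "lead N d \<subseteq> lead (Idl G) d" for d
  proof (cases "d \<le> D")
    case False
    then have "lead (Idl G) D \<subseteq> lead (Idl G) d"
      using lift_Suc_mono_le[of "lead (Idl G)", OF lead_Suc[OF I.ideal_axioms]] by simp
    then show ?thesis using D[of d] below[of D] False by simp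
  qed (rule below)
  \<comment> \<open>Induction on the degree: an element of \<open>Idl G\<close> with the same
    leading term is subtracted.\<close>
  have NB: "f \<in> N \<Longrightarrow> f \<in> B d \<Longrightarrow> f \<in> Idl G" for f d
  proof (induction d arbitrary: f)
    case 0
    then show ?case using I.zero_closed by simp
  next
    case (Suc d)
    obtain a r where a: "a \<in> A" "r \<in> B d" "f = a \<otimes> x [^] d \<oplus> r" using Suc.prems(2) by (rule B_SucE)
    then have "a \<in> lead N d" using Suc.prems(1) unfolding lead_def by blast
    then obtain r' where r': "r' \<in> B d" "a \<otimes> x [^] d \<oplus> r' \<in> Idl G"
      using leads[of d] unfolding lead_def by blast
    let ?g = "a \<otimes> x [^] d \<oplus> r'"
    have c: "a \<in> carrier R" "r \<in> carrier R" "r' \<in> carrier R" "x [^] d \<in> carrier R"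
      using A_carr[OF a(1)] B_carr[OF a(2)] B_carr[OF r'(1)] by simp_all
    have "?g \<in> N" using r'(2) genideal_minimal[OF N G(2)] by blast
    then have "f \<ominus> ?g \<in> N" using N.minus_mem[OF Suc.prems(1)] by blast
    moreover have e: "f \<ominus> ?g = r \<ominus> r'" unfolding a(3) using c by algebra
    ultimately have "r \<ominus> r' \<in> Idl G" using Suc.IH B_minus[OF a(2) r'(1)] by simp
    moreover have "f = ?g \<oplus> (r \<ominus> r')" unfolding a(3) using c by algebra
    ultimately show ?case using I.a_closed[OF r'(2)] by simp
  qed
  have "N \<subseteq> Idl G"
  proof
    fix f assume f: "f \<in> N"
    then show "f \<in> Idl G" using NB[OF f] carrier_B[OF N.Icarr[OF f]] by blast
  qed
  then show "\<exists>F. finite F \<and> F \<subseteq> N \<and> N \<subseteq> Idl F" using G by blast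
qed

text \<open>The fibre over \<open>M \<inter> A\<close> is a quotient of a polynomial ring over the residue field, and \<open>y\<close>
  is an element of least degree that generates the image of \<open>M\<close>.\<close>

lemma ex_fibre_generator:
  assumes M: "primeideal M R"
  shows "\<exists>y\<in>M. \<forall>L. primeideal L R \<longrightarrow> L \<subseteq> M \<longrightarrow> y \<in> L \<longrightarrow> L \<inter> A = M \<inter> A \<longrightarrow> L = M"
proof -
  interpret M: primeideal M R by fact
  have MA: "M \<inter> A \<subseteq> carrier R" using M.Icarr by blast
  interpret E: ideal "Idl (M \<inter> A)" R using MA by (rule genideal_ideal)
  have EL: "Idl (M \<inter> A) \<subseteq> L" if "primeideal L R" "L \<inter> A = M \<inter> A" for L
    using that by (intro genideal_minimal) (auto simp: primeideal_def)
  show ?thesis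
  proof (cases "M \<subseteq> Idl (M \<inter> A)")
    case True
    then show ?thesis using EL M.zero_closed by blast
  next
    case False
    then obtain f0 where f0: "f0 \<in> M" "f0 \<notin> Idl (M \<inter> A)" by blast
    then obtain d0 where "f0 \<in> B d0" using carrier_B[OF M.Icarr] by blast
    then have ex: "\<exists>d. \<exists>f\<in>M. f \<notin> Idl (M \<inter> A) \<and> f \<in> B d" using f0 by blast
    define e where "e = (LEAST d. \<exists>f\<in>M. f \<notin> Idl (M \<inter> A) \<and> f \<in> B d)"
    obtain y where y: "y \<in> M" "y \<notin> Idl (M \<inter> A)" "y \<in> B e" using LeastI_ex[OF ex] unfolding e_def by blast
    have min: "f \<in> Idl (M \<inter> A)" if "f \<in> M" "f \<in> B d" "d < e" for f d
      using not_less_Least[of d "\<lambda>d. \<exists>f\<in>M. f \<notin> Idl (M \<inter> A) \<and> f \<in> B d"] that unfolding e_def by blast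
    have "e \<noteq> 0" using y(2,3) E.zero_closed by (metis poly_below.simps(1) singletonD)
    then obtain d where d: "e = Suc d" using not0_implies_Suc by blast
    obtain c r where c: "c \<in> A" "r \<in> B d" "y = c \<otimes> x [^] d \<oplus> r" using y(3) unfolding d by (rule B_SucE)
    have cc: "c \<in> carrier R" "r \<in> carrier R" "x [^] d \<in> carrier R"
      using A_carr[OF c(1)] B_carr[OF c(2)] by simp_all
    \<comment> \<open>If \<open>c\<close> were in \<open>M\<close>, dropping the leading term of y
      would give an element of smaller degree, against the choice of \<open>e\<close>.\<close>
    have cM: "c \<notin> M"
    proof
      assume "c \<in> M"
      then have "c \<in> Idl (M \<inter> A)" using c(1) genideal_self[OF MA] by blast
      then have 1: "c \<otimes> x [^] d \<in> Idl (M \<inter> A)" using E.I_r_closed cc(3) by blast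
      have "r \<oplus> c \<otimes> x [^] d \<in> M" using y(1) cc unfolding c(3) by (simp add: a_comm)
      then have "r \<in> M" using M.add_cancel_mem[OF cc(2) M.I_r_closed[OF \<open>c \<in> M\<close> cc(3)]] by blast
      then have "r \<in> Idl (M \<inter> A)" using min[OF _ c(2)] d by simp
      then show False using y(2) E.a_closed[OF 1] unfolding c(3) by blast
    qed
    have "L = M" if L: "primeideal L R" "L \<subseteq> M" "y \<in> L" "L \<inter> A = M \<inter> A" for L
    proof
      interpret L: primeideal L R by (rule L)
      have cL: "c \<notin> L" using cM L(2) by blast
      have "g \<in> M \<Longrightarrow> g \<in> B k \<Longrightarrow> g \<in> L" for g k
      proof (induction k arbitrary: g)
        case 0
        then show ?case using L.zero_closed by simp
      next
        case (Suc k)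
        show ?case
        proof (cases "Suc k < e")
          case True
          then show ?thesis using min[OF Suc.prems] EL[OF L(1,4)] by blast
        next
          case False
          then have k: "k = d + (k - d)" using d by simp
          obtain b s where b: "b \<in> A" "s \<in> B k" "g = b \<otimes> x [^] k \<oplus> s" using Suc.prems(2) by (rule B_SucE)
          let ?w = "x [^] (k - d)"
          have bc: "b \<in> carrier R" "s \<in> carrier R" "?w \<in> carrier R"
            using A_carr[OF b(1)] B_carr[OF b(2)] by simp_all
          have gc: "g \<in> carrier R" using B_carr[OF Suc.prems(2)] .
          have xk: "x [^] k = x [^] d \<otimes> ?w" using nat_pow_mult[OF x_closed, of d "k - d"] k by simp
          \<comment> \<open>Pseudo-division: g is multiplied by the leading coefficient
            \<open>c\<close> of y so that the leading terms cancel. As \<open>c\<close> is outside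
            the prime \<open>L\<close>, it can be removed at the end.\<close>
          have e1: "c \<otimes> g \<ominus> (b \<otimes> ?w) \<otimes> y = c \<otimes> s \<ominus> b \<otimes> (?w \<otimes> r)"
            unfolding b(3) c(3) xk using bc cc by algebra
          have "?w \<otimes> r \<in> B k" using B_shift_power[OF c(2), of "k - d"] k by simp
          then have "c \<otimes> s \<ominus> b \<otimes> (?w \<otimes> r) \<in> B k"
            using B_minus B_scale[OF c(1) b(2)] B_scale[OF b(1)] by blast
          moreover have "c \<otimes> g \<ominus> (b \<otimes> ?w) \<otimes> y \<in> M"
            using M.minus_mem M.I_l_closed[OF Suc.prems(1) cc(1)] M.I_l_closed[OF y(1)] bc by simp
          ultimately have 1: "c \<otimes> g \<ominus> (b \<otimes> ?w) \<otimes> y \<in> L" using Suc.IH unfolding e1 by blast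
          have yc: "y \<in> carrier R" using M.Icarr[OF y(1)] .
          have "(c \<otimes> g \<ominus> (b \<otimes> ?w) \<otimes> y) \<oplus> (b \<otimes> ?w) \<otimes> y \<in> L"
            using L.a_closed[OF 1] L.I_l_closed[OF L(3)] bc by simp
          moreover have "(c \<otimes> g \<ominus> (b \<otimes> ?w) \<otimes> y) \<oplus> (b \<otimes> ?w) \<otimes> y = c \<otimes> g"
            using bc cc gc yc by algebra
          ultimately have "c \<otimes> g \<in> L" by simp
          then show ?thesis using L.mult_mem_iff[OF cc(1) gc] cL by blast
        qed
      qed
      then show "M \<subseteq> L" using carrier_B M.Icarr by blast
    qed (rule L)
    then show ?thesis using y(1) by blast
  qed
qed

theorem chain_bound:
  assumes J: "ideal J (R\<lparr>carrier := A\<rparr>)" "J \<subseteq> J'"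
    and bound: "\<And>m p. prime_chain (R\<lparr>carrier := A\<rparr>) J m p \<Longrightarrow> m \<le> d"
    and chain: "prime_chain R J' m P"
  shows "m \<le> Suc d"
proof -
  have P: "primeideal P R" using prime_chainD[OF chain] by simp
  obtain y where y: "y \<in> P"
    "\<And>L. primeideal L R \<Longrightarrow> L \<subseteq> P \<Longrightarrow> y \<in> L \<Longrightarrow> L \<inter> A = P \<inter> A \<Longrightarrow> L = P"
    using ex_fibre_generator[OF P] by blast
  show ?thesis
    by (rule height_step[OF noetherian P y J _ chain]) (auto intro: bound)
qed

end

subsection \<open>The ring of formal power series\<close>

lemma finite_submultisets: "finite {k. k \<subseteq># m}"
proof (induction m)
  case (add x m)
  have "{k. k \<subseteq># add_mset x m} \<subseteq> {k. k \<subseteq># m} \<union> add_mset x ` {k. k \<subseteq># m}"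
  proof
    fix k assume k: "k \<in> {k. k \<subseteq># add_mset x m}"
    show "k \<in> {k. k \<subseteq># m} \<union> add_mset x ` {k. k \<subseteq># m}"
    proof (cases "x \<in># k")
      case True
      then have "k = add_mset x (k - {#x#})" "k - {#x#} \<subseteq># m"
        using k by (simp_all add: subset_eq_diff_conv)
      then show ?thesis by blast
    next
      case False
      then have "k \<subseteq># m" using k subset_eq_diff_conv[of k "{#x#}" m] by (simp add: diff_single_trivial)
      then show ?thesis by simp
    qed
  qed
  then show ?case using add finite_subset by blast
qed simp

context abelian_monoid
begin

lemma finsum_single:
  assumes "finite A" "i \<in> A" "f i \<in> carrier G" "\<And>j. j \<in> A \<Longrightarrow> j \<noteq> i \<Longrightarrow> f j = \<zero>"
  shows "finsum G f A = f i"
proof -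
  have "finsum G f A = (\<Oplus>j\<in>A. if i = j then f j else \<zero>)"
    by (rule finsum_cong') (use assms in auto)
  also have "\<dots> = f i"
    using assms by (intro finsum_singleton Pi_I) (auto, metis zero_closed)
  finally show ?thesis .
qed

lemma finsum_eq_zero: "(\<And>j. j \<in> A \<Longrightarrow> f j = \<zero>) \<Longrightarrow> finsum G f A = \<zero>"
  using finsum_cong'[of A A "\<lambda>_. \<zero>" f] by simp

lemma finsum_Sigma:
  assumes "finite A" "\<And>i. i \<in> A \<Longrightarrow> finite (B i)"
    and "\<And>i j. i \<in> A \<Longrightarrow> j \<in> B i \<Longrightarrow> f i j \<in> carrier G"
  shows "(\<Oplus>i\<in>A. \<Oplus>j\<in>B i. f i j) = (\<Oplus>p\<in>Sigma A B. case p of (i, j) \<Rightarrow> f i j)"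
  using assms
proof (induction A rule: finite_induct)
  case (insert a A)
  have S: "Sigma (insert a A) B = Pair a ` B a \<union> Sigma A B" by auto
  have fin: "finite (Pair a ` B a)" "finite (Sigma A B)" using insert by auto
  have "(\<Oplus>p\<in>Sigma (insert a A) B. case p of (i, j) \<Rightarrow> f i j) =
    (\<Oplus>p\<in>Pair a ` B a. case p of (i, j) \<Rightarrow> f i j) \<oplus> (\<Oplus>p\<in>Sigma A B. case p of (i, j) \<Rightarrow> f i j)"
    unfolding S using insert fin by (intro finsum_Un_disjoint) auto
  also have "(\<Oplus>p\<in>Pair a ` B a. case p of (i, j) \<Rightarrow> f i j) = (\<Oplus>j\<in>B a. f a j)"
    using insert by (subst finsum_reindex) (auto simp: inj_on_def)
  also have "(\<Oplus>p\<in>Sigma A B. case p of (i, j) \<Rightarrow> f i j) = (\<Oplus>i\<in>A. \<Oplus>j\<in>B i. f i j)"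
    using insert by simp
  also have "(\<Oplus>j\<in>B a. f a j) \<oplus> (\<Oplus>i\<in>A. \<Oplus>j\<in>B i. f i j) = (\<Oplus>i\<in>insert a A. \<Oplus>j\<in>B i. f i j)"
    using insert by (intro finsum_insert[symmetric]) (auto intro!: finsum_closed)
  finally show ?case by simp
qed simp

end

lemma mseries_ring_simps [simp]:
  "carrier (mseries_ring R n) = mseries_carrier R n"
  "zero (mseries_ring R n) = (\<lambda>m. \<zero>\<^bsub>R\<^esub>)"
  "one (mseries_ring R n) = (\<lambda>m. if m = {#} then \<one>\<^bsub>R\<^esub> else \<zero>\<^bsub>R\<^esub>)"
  "add (mseries_ring R n) f g = (\<lambda>m. f m \<oplus>\<^bsub>R\<^esub> g m)"
  by (simp_all add: mseries_ring_def)

lemma mult_mseries_ring: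
  "mult (mseries_ring R n) f g m = (\<Oplus>\<^bsub>R\<^esub>k\<in>{k. k \<subseteq># m}. f k \<otimes>\<^bsub>R\<^esub> g (m - k))"
  by (simp add: mseries_ring_def)

definition mono_series :: "('a, 'm) ring_scheme \<Rightarrow> 'a \<Rightarrow> nat multiset \<Rightarrow> nat multiset \<Rightarrow> 'a"
  where "mono_series R a u = (\<lambda>m. if m = u then a else \<zero>\<^bsub>R\<^esub>)"

lemma mseries_carrierD: "f \<in> mseries_carrier R n \<Longrightarrow> f m \<in> carrier R"
  by (simp add: mseries_carrier_def)

lemma mseries_carrier_outside:
  "f \<in> mseries_carrier R n \<Longrightarrow> \<not> set_mset m \<subseteq> {..<n} \<Longrightarrow> f m = \<zero>\<^bsub>R\<^esub>"
  by (simp add: mseries_carrier_def)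

section \<open>Ring axioms for series, and polynomials as a subring\<close>

context cring
begin

lemma mseries_mult_closed:
  assumes f: "f \<in> mseries_carrier R n" and g: "g \<in> mseries_carrier R n"
  shows "f \<otimes>\<^bsub>mseries_ring R n\<^esub> g \<in> mseries_carrier R n"
  unfolding mseries_carrier_def
proof (intro CollectI conjI allI impI)
  note fc = mseries_carrierD[OF f] and gc = mseries_carrierD[OF g]
  fix m :: "nat multiset"
  show "(f \<otimes>\<^bsub>mseries_ring R n\<^esub> g) m \<in> carrier R"
    using fc gc by (auto simp: mult_mseries_ring intro!: finsum_closed)
  assume m: "\<not> set_mset m \<subseteq> {..<n}"
  show "(f \<otimes>\<^bsub>mseries_ring R n\<^esub> g) m = \<zero>"
    unfolding mult_mseries_ring
  proof (rule finsum_eq_zero)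
    fix k assume "k \<in> {k. k \<subseteq># m}"
    then have "m = k + (m - k)" by simp
    then have "set_mset m = set_mset k \<union> set_mset (m - k)" by (metis set_mset_union)
    then have "\<not> set_mset k \<subseteq> {..<n} \<or> \<not> set_mset (m - k) \<subseteq> {..<n}" using m by auto
    then have "f k = \<zero> \<or> g (m - k) = \<zero>"
      using mseries_carrier_outside[OF f, of k] mseries_carrier_outside[OF g, of "m - k"] by blast
    then show "f k \<otimes> g (m - k) = \<zero>" using fc[of k] gc[of "m - k"] by auto
  qed
qed

lemma mono_series_mult:
  assumes f: "f \<in> mseries_carrier R n" and a: "a \<in> carrier R"
  shows "(mono_series R a u \<otimes>\<^bsub>mseries_ring R n\<^esub> f) m = (if u \<subseteq># m then a \<otimes> f (m - u) else \<zero>)"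
proof (cases "u \<subseteq># m")
  case True
  have "(mono_series R a u \<otimes>\<^bsub>mseries_ring R n\<^esub> f) m = mono_series R a u u \<otimes> f (m - u)"
    unfolding mult_mseries_ring using True mseries_carrierD[OF f] a
    by (intro finsum_single) (auto simp: finite_submultisets mono_series_def)
  then show ?thesis using True by (simp add: mono_series_def)
next
  case False
  then have "(mono_series R a u \<otimes>\<^bsub>mseries_ring R n\<^esub> f) m = \<zero>"
    unfolding mult_mseries_ring using mseries_carrierD[OF f]
    by (intro finsum_eq_zero) (auto simp: mono_series_def)
  then show ?thesis using False by simp
qed

lemma mseries_mult_comm:
  assumes f: "f \<in> mseries_carrier R n" and g: "g \<in> mseries_carrier R n"
  shows "f \<otimes>\<^bsub>mseries_ring R n\<^esub> g = g \<otimes>\<^bsub>mseries_ring R n\<^esub> f"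
proof
  note c = mseries_carrierD[OF f] mseries_carrierD[OF g]
  fix m :: "nat multiset"
  have im: "(\<lambda>k. m - k) ` {k. k \<subseteq># m} = {k. k \<subseteq># m}"
    by (auto simp: image_iff) (metis diff_subset_eq_self subset_mset.diff_diff_right
      add_diff_cancel_left' subset_mset.add_diff_inverse)
  have inj: "inj_on (\<lambda>k. m - k) {k. k \<subseteq># m}"
    by (auto simp: inj_on_def) (metis subset_mset.add_diff_inverse add_diff_cancel_right'
      subset_mset.diff_add diff_subset_eq_self)
  have "(f \<otimes>\<^bsub>mseries_ring R n\<^esub> g) m = (\<Oplus>k\<in>(\<lambda>k. m - k) ` {k. k \<subseteq># m}. f k \<otimes> g (m - k))"
    unfolding im mult_mseries_ring ..
  also have "\<dots> = (\<Oplus>k\<in>{k. k \<subseteq># m}. f (m - k) \<otimes> g (m - (m - k)))"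
    using c inj by (intro finsum_reindex) auto
  also have "\<dots> = (g \<otimes>\<^bsub>mseries_ring R n\<^esub> f) m"
    unfolding mult_mseries_ring
  proof (rule finsum_cong')
    fix k assume "k \<in> {k. k \<subseteq># m}"
    then have "m - (m - k) = k" by (metis mem_Collect_eq subset_mset.add_diff_inverse add_diff_cancel_right')
    then show "f (m - k) \<otimes> g (m - (m - k)) = g k \<otimes> f (m - k)" using c m_comm by simp
  qed (use c in auto)
  finally show "(f \<otimes>\<^bsub>mseries_ring R n\<^esub> g) m = (g \<otimes>\<^bsub>mseries_ring R n\<^esub> f) m" .
qed

lemma mseries_mult_assoc:
  assumes f: "f \<in> mseries_carrier R n" and g: "g \<in> mseries_carrier R n"
    and h: "h \<in> mseries_carrier R n"
  shows "(f \<otimes>\<^bsub>mseries_ring R n\<^esub> g) \<otimes>\<^bsub>mseries_ring R n\<^esub> h =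
    f \<otimes>\<^bsub>mseries_ring R n\<^esub> (g \<otimes>\<^bsub>mseries_ring R n\<^esub> h)"
proof
  note c = mseries_carrierD[OF f] mseries_carrierD[OF g] mseries_carrierD[OF h]
  fix m :: "nat multiset"
  let ?S = "Sigma {k. k \<subseteq># m} (\<lambda>k. {j. j \<subseteq># k})"
  let ?T = "Sigma {j. j \<subseteq># m} (\<lambda>j. {i. i \<subseteq># m - j})"
  \<comment> \<open>A factorization of m into three monomials j, i and a rest is indexed by (j + i,
    j) on the left and by (j, i) on the right.\<close>
  let ?\<phi> = "\<lambda>(j, i). (j + i, j)"
  have inj: "inj_on ?\<phi> ?T" by (auto simp: inj_on_def)
  have im: "?\<phi> ` ?T = ?S"
  proof
    show "?\<phi> ` ?T \<subseteq> ?S"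
      by (auto simp: subset_mset.le_diff_conv2 add.commute)
    show "?S \<subseteq> ?\<phi> ` ?T"
    proof
      fix p assume "p \<in> ?S"
      then obtain k j where p: "p = (k, j)" "k \<subseteq># m" "j \<subseteq># k" by auto
      obtain i q where "k = j + i" "m = k + q"
        using p(2,3) by (auto simp: subset_mset.le_iff_add)
      then have "i \<subseteq># m - j" "j \<subseteq># m" "p = ?\<phi> (j, i)" using p(1) by simp_all
      then show "p \<in> ?\<phi> ` ?T" by blast
    qed
  qed
  have "((f \<otimes>\<^bsub>mseries_ring R n\<^esub> g) \<otimes>\<^bsub>mseries_ring R n\<^esub> h) m =
    (\<Oplus>k\<in>{k. k \<subseteq># m}. \<Oplus>j\<in>{j. j \<subseteq># k}. f j \<otimes> g (k - j) \<otimes> h (m - k))"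
    unfolding mult_mseries_ring
    by (intro finsum_cong' finsum_ldistr) (use c in \<open>auto simp: finite_submultisets intro!: finsum_closed\<close>)
  also have "\<dots> = (\<Oplus>p\<in>?S. case p of (k, j) \<Rightarrow> f j \<otimes> g (k - j) \<otimes> h (m - k))"
    using c by (intro finsum_Sigma) (auto simp: finite_submultisets)
  also have "\<dots> = (\<Oplus>p\<in>?\<phi> ` ?T. case p of (k, j) \<Rightarrow> f j \<otimes> g (k - j) \<otimes> h (m - k))" unfolding im ..
  also have "\<dots> = (\<Oplus>p\<in>?T. case ?\<phi> p of (k, j) \<Rightarrow> f j \<otimes> g (k - j) \<otimes> h (m - k))"
    using c inj by (intro finsum_reindex) auto
  also have "\<dots> = (\<Oplus>p\<in>?T. case p of (j, i) \<Rightarrow> f j \<otimes> (g i \<otimes> h (m - j - i)))"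
    by (rule finsum_cong') (use c in \<open>auto simp: m_assoc\<close>)
  also have "\<dots> = (\<Oplus>j\<in>{j. j \<subseteq># m}. \<Oplus>i\<in>{i. i \<subseteq># m - j}. f j \<otimes> (g i \<otimes> h (m - j - i)))"
    using c by (intro finsum_Sigma[symmetric]) (auto simp: finite_submultisets)
  also have "\<dots> = (f \<otimes>\<^bsub>mseries_ring R n\<^esub> (g \<otimes>\<^bsub>mseries_ring R n\<^esub> h)) m"
    unfolding mult_mseries_ring
    by (intro finsum_cong' finsum_rdistr[symmetric])
      (use c in \<open>auto simp: finite_submultisets intro!: finsum_closed\<close>)
  finally show "((f \<otimes>\<^bsub>mseries_ring R n\<^esub> g) \<otimes>\<^bsub>mseries_ring R n\<^esub> h) m =
    (f \<otimes>\<^bsub>mseries_ring R n\<^esub> (g \<otimes>\<^bsub>mseries_ring R n\<^esub> h)) m" .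
qed

theorem mseries_cring: "cring (mseries_ring R n)"
proof (rule cringI)
  show "abelian_group (mseries_ring R n)"
  proof (rule abelian_groupI)
    fix f assume "f \<in> carrier (mseries_ring R n)"
    then have "(\<lambda>m. \<ominus> f m) \<in> carrier (mseries_ring R n)"
      "(\<lambda>m. \<ominus> f m) \<oplus>\<^bsub>mseries_ring R n\<^esub> f = \<zero>\<^bsub>mseries_ring R n\<^esub>"
      by (auto simp: mseries_carrier_def l_neg)
    then show "\<exists>g\<in>carrier (mseries_ring R n). g \<oplus>\<^bsub>mseries_ring R n\<^esub> f = \<zero>\<^bsub>mseries_ring R n\<^esub>"
      by blast
  qed (auto simp: mseries_carrier_def a_ac)
  show "comm_monoid (mseries_ring R n)"
  proof (rule comm_monoidI)
    have one: "\<one>\<^bsub>mseries_ring R n\<^esub> = mono_series R \<one> {#}" by (simp add: mono_series_def)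
    show "\<one>\<^bsub>mseries_ring R n\<^esub> \<in> carrier (mseries_ring R n)" by (auto simp: mseries_carrier_def)
    show "\<one>\<^bsub>mseries_ring R n\<^esub> \<otimes>\<^bsub>mseries_ring R n\<^esub> f = f" if "f \<in> carrier (mseries_ring R n)" for f
      unfolding one using that by (auto simp: mono_series_mult mseries_carrierD)
  qed (auto simp: mseries_mult_closed mseries_mult_assoc intro: mseries_mult_comm)
  fix f g h
  assume "f \<in> carrier (mseries_ring R n)" "g \<in> carrier (mseries_ring R n)" "h \<in> carrier (mseries_ring R n)"
  then have c: "f m \<in> carrier R" "g m \<in> carrier R" "h m \<in> carrier R" for m
    by (simp_all add: mseries_carrierD)
  show "(f \<oplus>\<^bsub>mseries_ring R n\<^esub> g) \<otimes>\<^bsub>mseries_ring R n\<^esub> h =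
    f \<otimes>\<^bsub>mseries_ring R n\<^esub> h \<oplus>\<^bsub>mseries_ring R n\<^esub> g \<otimes>\<^bsub>mseries_ring R n\<^esub> h"
  proof
    fix m :: "nat multiset"
    have "((f \<oplus>\<^bsub>mseries_ring R n\<^esub> g) \<otimes>\<^bsub>mseries_ring R n\<^esub> h) m =
      (\<Oplus>k\<in>{k. k \<subseteq># m}. f k \<otimes> h (m - k) \<oplus> g k \<otimes> h (m - k))"
      unfolding mult_mseries_ring by (rule finsum_cong') (use c in \<open>auto simp: l_distr\<close>)
    also have "\<dots> = (f \<otimes>\<^bsub>mseries_ring R n\<^esub> h \<oplus>\<^bsub>mseries_ring R n\<^esub> g \<otimes>\<^bsub>mseries_ring R n\<^esub> h) m"
      using c by (simp add: mult_mseries_ring finsum_addf)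
    finally show "((f \<oplus>\<^bsub>mseries_ring R n\<^esub> g) \<otimes>\<^bsub>mseries_ring R n\<^esub> h) m =
      (f \<otimes>\<^bsub>mseries_ring R n\<^esub> h \<oplus>\<^bsub>mseries_ring R n\<^esub> g \<otimes>\<^bsub>mseries_ring R n\<^esub> h) m" .
  qed
qed

lemma mseries_uminus:
  assumes "f \<in> mseries_carrier R n"
  shows "\<ominus>\<^bsub>mseries_ring R n\<^esub> f = (\<lambda>m. \<ominus> f m)"
proof -
  interpret S: cring "mseries_ring R n" by (rule mseries_cring)
  show ?thesis
    using assms by (intro S.minus_equality) (auto simp: mseries_carrier_def l_neg)
qed

lemma mpoly_subring: "subring (mpoly_carrier R n) (mseries_ring R n)"
proof -
  interpret S: cring "mseries_ring R n" by (rule mseries_cring)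
  show ?thesis
  proof (rule S.subringI)
    show "mpoly_carrier R n \<subseteq> carrier (mseries_ring R n)" by (auto simp: mpoly_carrier_def)
    have "finite {m. \<one>\<^bsub>mseries_ring R n\<^esub> m \<noteq> \<zero>}"
      by (rule finite_subset[of _ "{{#}}"]) auto
    then show "\<one>\<^bsub>mseries_ring R n\<^esub> \<in> mpoly_carrier R n"
      using S.one_closed unfolding mpoly_carrier_def by simp
  next
    fix f assume f: "f \<in> mpoly_carrier R n"
    then have fc: "f \<in> mseries_carrier R n" "finite {m. f m \<noteq> \<zero>}" by (simp_all add: mpoly_carrier_def)
    have "finite {m. \<ominus> f m \<noteq> \<zero>}" by (rule finite_subset[OF _ fc(2)]) auto
    then show "\<ominus>\<^bsub>mseries_ring R n\<^esub> f \<in> mpoly_carrier R n"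
      using S.a_inv_closed[of f] fc(1) by (simp add: mpoly_carrier_def mseries_uminus)
  next
    fix f g assume "f \<in> mpoly_carrier R n" "g \<in> mpoly_carrier R n"
    then have c: "f \<in> mseries_carrier R n" "g \<in> mseries_carrier R n"
      and fin: "finite {m. f m \<noteq> \<zero>}" "finite {m. g m \<noteq> \<zero>}" by (simp_all add: mpoly_carrier_def)
    have "finite {m. f m \<oplus> g m \<noteq> \<zero>}"
      by (rule finite_subset[OF _ finite_UnI[OF fin]]) auto
    then show "f \<oplus>\<^bsub>mseries_ring R n\<^esub> g \<in> mpoly_carrier R n"
      using S.a_closed[of f g] c by (simp add: mpoly_carrier_def)
    have "{m. (f \<otimes>\<^bsub>mseries_ring R n\<^esub> g) m \<noteq> \<zero>} \<subseteq>
      (\<lambda>(k, l). k + l) ` ({m. f m \<noteq> \<zero>} \<times> {m. g m \<noteq> \<zero>})"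
    proof
      fix m assume m: "m \<in> {m. (f \<otimes>\<^bsub>mseries_ring R n\<^esub> g) m \<noteq> \<zero>}"
      have "\<exists>k. k \<subseteq># m \<and> f k \<otimes> g (m - k) \<noteq> \<zero>"
      proof (rule ccontr)
        assume "\<not> ?thesis"
        then have "(f \<otimes>\<^bsub>mseries_ring R n\<^esub> g) m = \<zero>"
          unfolding mult_mseries_ring by (intro finsum_eq_zero) blast
        then show False using m by simp
      qed
      then obtain k where k: "k \<subseteq># m" "f k \<otimes> g (m - k) \<noteq> \<zero>" by blast
      then have "f k \<noteq> \<zero>" "g (m - k) \<noteq> \<zero>"
        using mseries_carrierD[OF c(1), of k] mseries_carrierD[OF c(2), of "m - k"] by auto
      moreover have "m = k + (m - k)" using k(1) by simp
      ultimately show "m \<in> (\<lambda>(k, l). k + l) ` ({m. f m \<noteq> \<zero>} \<times> {m. g m \<noteq> \<zero>})"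
        by (intro image_eqI[of _ _ "(k, m - k)"]) auto
    qed
    then have "finite {m. (f \<otimes>\<^bsub>mseries_ring R n\<^esub> g) m \<noteq> \<zero>}"
      by (rule finite_subset) (use fin in simp)
    then show "f \<otimes>\<^bsub>mseries_ring R n\<^esub> g \<in> mpoly_carrier R n"
      using mseries_mult_closed[OF c] by (simp add: mpoly_carrier_def)
  qed
qed

theorem mpoly_cring: "cring (mpoly_ring R n)"
proof -
  interpret S: cring "mseries_ring R n" by (rule mseries_cring)
  show ?thesis
    using S.subcring_iff[of "mpoly_carrier R n"] S.subcringI'[OF mpoly_subring]
      subringE(1)[OF mpoly_subring] by (simp add: mpoly_ring_def)
qed

end

section \<open>Extension of ideals, grade and chains of primes\<close>

text \<open>The polynomial ring and the power series ring are treated simultaneously: membership in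
  the carrier only depends on the set of monomials with nonzero coefficient.\<close>

locale power_series_ring = cring R + S: cring S
  for R :: "('a, 'm) ring_scheme" (structure) and S :: "(nat multiset \<Rightarrow> 'a) ring" +
  fixes n :: nat
  assumes carrier_sub: "carrier S \<subseteq> mseries_carrier R n"
    and mult_eq: "mult S = mult (mseries_ring R n)"
    and one_eq: "one S = one (mseries_ring R n)"
    and zero_eq: "zero S = zero (mseries_ring R n)"
    and add_eq: "add S = add (mseries_ring R n)"
    and solid: "\<lbrakk>f \<in> carrier S; \<And>m. g m \<in> carrier R; \<And>m. f m = \<zero> \<Longrightarrow> g m = \<zero>\<rbrakk> \<Longrightarrow> g \<in> carrier S"
    and mono_series_closed: "\<lbrakk>a \<in> carrier R; set_mset u \<subseteq> {..<n}\<rbrakk> \<Longrightarrow> mono_series R a u \<in> carrier S"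
begin

lemma coeff_closed: "f \<in> carrier S \<Longrightarrow> f m \<in> carrier R"
  using carrier_sub mseries_carrierD by blast

lemma coeff_add: "(f \<oplus>\<^bsub>S\<^esub> g) m = f m \<oplus> g m"
  by (simp add: add_eq)

lemma coeff_mult: "(f \<otimes>\<^bsub>S\<^esub> g) m = (\<Oplus>k\<in>{k. k \<subseteq># m}. f k \<otimes> g (m - k))"
  by (simp add: mult_eq mult_mseries_ring)

lemma coeff_zero: "\<zero>\<^bsub>S\<^esub> m = \<zero>"
  by (simp add: zero_eq)

lemma coeff_one: "\<one>\<^bsub>S\<^esub> m = (if m = {#} then \<one> else \<zero>)"
  by (simp add: one_eq)

abbreviation "const a \<equiv> mono_series R a {#}"

lemma const_closed: "a \<in> carrier R \<Longrightarrow> const a \<in> carrier S"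
  by (simp add: mono_series_closed)

lemma coeff_const_mult: "f \<in> carrier S \<Longrightarrow> a \<in> carrier R \<Longrightarrow> (const a \<otimes>\<^bsub>S\<^esub> f) m = a \<otimes> f m"
  using mono_series_mult[of f n a "{#}" m] carrier_sub by (auto simp: mult_eq)

lemma coeff_mult_const: "f \<in> carrier S \<Longrightarrow> a \<in> carrier R \<Longrightarrow> (f \<otimes>\<^bsub>S\<^esub> const a) m = f m \<otimes> a"
  using coeff_const_mult[of f a m] by (simp add: S.m_comm m_comm const_closed coeff_closed)

lemma const_hom: "const \<in> ring_hom R S"
proof (rule ring_hom_memI)
  fix a b assume ab: "a \<in> carrier R" "b \<in> carrier R"
  show "const (a \<otimes> b) = const a \<otimes>\<^bsub>S\<^esub> const b"
    using ab coeff_const_mult[OF const_closed[OF ab(2)] ab(1)] by (auto simp: mono_series_def)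
  show "const (a \<oplus> b) = const a \<oplus>\<^bsub>S\<^esub> const b"
    using ab by (auto simp: coeff_add mono_series_def)
next
  show "const \<one> = \<one>\<^bsub>S\<^esub>" by (simp add: one_eq mono_series_def)
qed (rule const_closed)

text \<open>Common form of \<open>mpoly_ideal\<close> and \<open>mseries_ideal\<close>.\<close>

definition ext :: "'a set \<Rightarrow> (nat multiset \<Rightarrow> 'a) set"
  where "ext K = {f \<in> carrier S. \<forall>m. f m \<in> K}"

lemma ext_ideal:
  assumes "ideal K R"
  shows "ideal (ext K) S"
proof -
  interpret K: ideal K R by fact
  show ?thesis
  proof (rule S.idealI')
    show "\<zero>\<^bsub>S\<^esub> \<in> ext K" using K.zero_closed by (simp add: ext_def coeff_zero)
    fix f g assume "f \<in> ext K" "g \<in> ext K"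
    then show "f \<oplus>\<^bsub>S\<^esub> g \<in> ext K" by (simp add: ext_def coeff_add)
  next
    fix f g assume f: "f \<in> ext K" and g: "g \<in> carrier S"
    have "(g \<otimes>\<^bsub>S\<^esub> f) m \<in> K" for m
      unfolding coeff_mult
      by (rule K.finsum_mem, rule K.I_l_closed) (use f g coeff_closed in \<open>auto simp: ext_def\<close>)
    then show "g \<otimes>\<^bsub>S\<^esub> f \<in> ext K" using f g by (simp add: ext_def)
  qed (auto simp: ext_def)
qed

lemma const_mem_ext_iff:
  assumes "ideal K R" "a \<in> carrier R"
  shows "const a \<in> ext K \<longleftrightarrow> a \<in> K"
proof -
  have "\<zero> \<in> K" using additive_subgroup.zero_closed[OF ideal.axioms(1)[OF assms(1)]] .
  then have "(\<forall>m. const a m \<in> K) \<longleftrightarrow> a \<in> K" by (auto simp: mono_series_def)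
  then show ?thesis using const_closed[OF assms(2)] by (simp add: ext_def)
qed

lemma ext_proper:
  assumes K: "ideal K R" "K \<noteq> carrier R"
  shows "ext K \<noteq> carrier S"
proof -
  have "\<one> \<notin> K" using ideal.one_imp_carrier[OF K(1)] K(2) by blast
  then have "const \<one> \<notin> ext K" using const_mem_ext_iff[OF K(1)] by simp
  then show ?thesis using const_closed[OF one_closed] by blast
qed

lemma ext_zero: "ext {\<zero>} = {\<zero>\<^bsub>S\<^esub>}"
  using S.zero_closed by (auto simp: ext_def zero_eq)

text \<open>Since a constant acts coefficientwise, f m = k m + (r m) x can be split for each
  monomial separately.\<close>

lemma ext_adjoin:
  assumes K: "ideal K R" and x: "x \<in> carrier R"
  shows "ext (adjoin R K x) = adjoin S (ext K) (const x)"
proof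
  show "ext (adjoin R K x) \<subseteq> adjoin S (ext K) (const x)"
  proof
    fix f assume f: "f \<in> ext (adjoin R K x)"
    then have "\<forall>m. \<exists>k r. k \<in> K \<and> r \<in> carrier R \<and> f m = k \<oplus> r \<otimes> x"
      unfolding ext_def adjoin_def by blast
    then obtain k r where kr: "\<And>m. k m \<in> K" "\<And>m. r m \<in> carrier R" "\<And>m. f m = k m \<oplus> r m \<otimes> x"
      by metis
    have kc: "k m \<in> carrier R" for m using ideal.Icarr[OF K kr(1)] .
    have zK: "\<zero> \<in> K" using additive_subgroup.zero_closed[OF ideal.axioms(1)[OF K]] .
    \<comment> \<open>The choices are replaced by zero where f vanishes. Then \<open>solid\<close>
      applies, and a polynomial f yields polynomials \<open>k'\<close> and
      \<open>r'\<close>.\<close>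
    define k' where "k' m = (if f m = \<zero> then \<zero> else k m)" for m
    define r' where "r' m = (if f m = \<zero> then \<zero> else r m)" for m
    have fS: "f \<in> carrier S" using f by (simp add: ext_def)
    have k'S: "k' \<in> carrier S" by (rule solid[OF fS]) (simp_all add: k'_def kc)
    have r'S: "r' \<in> carrier S" by (rule solid[OF fS]) (simp_all add: r'_def kr(2))
    have "f = k' \<oplus>\<^bsub>S\<^esub> r' \<otimes>\<^bsub>S\<^esub> const x"
    proof
      show "f m = (k' \<oplus>\<^bsub>S\<^esub> r' \<otimes>\<^bsub>S\<^esub> const x) m" for m
        using kr(3)[of m] x by (simp add: coeff_add coeff_mult_const[OF r'S x] k'_def r'_def)
    qed
    moreover have "k' \<in> ext K" using k'S kr(1) zK by (simp add: ext_def k'_def)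
    ultimately show "f \<in> adjoin S (ext K) (const x)" using r'S unfolding adjoin_def by blast
  qed
  show "adjoin S (ext K) (const x) \<subseteq> ext (adjoin R K x)"
  proof (rule S.adjoin_least)
    show "ideal (ext (adjoin R K x)) S" using K x by (intro ext_ideal adjoin_ideal)
    show "ext K \<subseteq> ext (adjoin R K x)" using adjoin_supset[OF K x] by (auto simp: ext_def)
    show "const x \<in> ext (adjoin R K x)"
      using const_mem_ext_iff[OF adjoin_ideal[OF K x] x] adjoin_self[OF K x] by blast
  qed
qed

lemma ext_adjoins:
  "ideal K R \<Longrightarrow> set xs \<subseteq> carrier R \<Longrightarrow>
    ext (adjoins R K xs) = adjoins S (ext K) (map const xs)"
  by (induction xs arbitrary: K) (simp_all add: ext_adjoin adjoin_ideal)

lemma regular_mod_ext: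
  assumes "x \<in> carrier R" "regular_mod R K x"
  shows "regular_mod S (ext K) (const x)"
  unfolding regular_mod_def
proof (intro ballI impI)
  fix f assume f: "f \<in> carrier S" "const x \<otimes>\<^bsub>S\<^esub> f \<in> ext K"
  have "(const x \<otimes>\<^bsub>S\<^esub> f) m \<in> K" for m using f(2) unfolding ext_def by blast
  then have "x \<otimes> f m \<in> K" for m unfolding coeff_const_mult[OF f(1) assms(1)] .
  then have "f m \<in> K" for m using regular_modD[OF assms(2)] coeff_closed[OF f(1)] by blast
  then show "f \<in> ext K" using f(1) by (simp add: ext_def)
qed

lemma regular_on_ext:
  "ideal K R \<Longrightarrow> set xs \<subseteq> carrier R \<Longrightarrow> regular_on R K xs \<Longrightarrow>
    regular_on S (ext K) (map const xs)"
proof (induction xs arbitrary: K)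
  case (Cons x xs)
  then have "regular_on S (ext (adjoin R K x)) (map const xs)"
    by (intro Cons.IH) (simp_all add: adjoin_ideal)
  then show ?case using Cons.prems by (simp add: ext_adjoin regular_mod_ext)
qed simp

lemma has_socle_ext:
  assumes K: "ideal K R" and soc: "has_socle R J K"
  shows "has_socle S (ext J) (ext K)"
proof -
  obtain z where z: "z \<in> carrier R" "z \<notin> K" "\<forall>j\<in>J. j \<otimes> z \<in> K"
    using soc unfolding has_socle_def by blast
  have "f \<otimes>\<^bsub>S\<^esub> const z \<in> ext K" if f: "f \<in> ext J" for f
  proof -
    have "f \<in> carrier S" "\<And>m. f m \<in> J" using f by (simp_all add: ext_def)
    then show ?thesis using z coeff_mult_const[of f z] const_closed[OF z(1)] by (simp add: ext_def)
  qed
  then show ?thesis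
    using z const_closed[OF z(1)] const_mem_ext_iff[OF K z(1)] unfolding has_socle_def by blast
qed

theorem grade_ext:
  assumes "noetherian_cring R" "noetherian_cring S" and J: "ideal J R" "J \<noteq> carrier R"
  shows "grade S (ext J) (self_module S) = grade R J (self_module R)"
proof -
  interpret R: noetherian_cring R by fact
  interpret S: noetherian_cring S by fact
  obtain xs where xs: "set xs \<subseteq> J" "regular_on R {\<zero>} xs" "has_socle R J (adjoins R {\<zero>} xs)"
    using R.ex_maximal_regular[OF J] by blast
  have xc: "set xs \<subseteq> carrier R" using xs(1) ideal.Icarr[OF J(1)] by blast
  have "set (map const xs) \<subseteq> ext J"
    using xs(1) const_mem_ext_iff[OF J(1)] xc by auto
  moreover have "regular_on S {\<zero>\<^bsub>S\<^esub>} (map const xs)"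
    using regular_on_ext[OF zeroideal xc xs(2)] by (simp only: ext_zero)
  moreover have "has_socle S (ext J) (adjoins S {\<zero>\<^bsub>S\<^esub>} (map const xs))"
    using has_socle_ext[OF adjoins_ideal[OF zeroideal xc] xs(3)] ext_adjoins[OF zeroideal xc]
    by (simp only: ext_zero)
  ultimately have "grade S (ext J) (self_module S) = length (map const xs)"
    by (rule S.grade_self[OF ext_ideal[OF J(1)] ext_proper[OF J]])
  then show ?thesis using R.grade_self[OF J xs] by simp
qed

text \<open>This is \<open>pS + (x\<^sub>0, \<dots>, x\<^bsub>j - 1\<^esub>)\<close>. That it is prime is seen on the leading monomials for
  the well-ordering of multisets.\<close>

definition ext_vars :: "'a set \<Rightarrow> nat \<Rightarrow> (nat multiset \<Rightarrow> 'a) set"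
  where "ext_vars p j = {f \<in> carrier S. \<forall>m. set_mset m \<subseteq> {j..<n} \<longrightarrow> f m \<in> p}"

lemma primeideal_ext_vars:
  assumes p: "primeideal p R"
  shows "primeideal (ext_vars p j) S"
proof -
  interpret p: primeideal p R by fact
  have ideal: "ideal (ext_vars p j) S"
  proof (rule S.idealI')
    show "\<zero>\<^bsub>S\<^esub> \<in> ext_vars p j" using p.zero_closed by (simp add: ext_vars_def coeff_zero)
    fix f g assume "f \<in> ext_vars p j" "g \<in> ext_vars p j"
    then show "f \<oplus>\<^bsub>S\<^esub> g \<in> ext_vars p j" by (simp add: ext_vars_def coeff_add)
  next
    fix f g assume f: "f \<in> ext_vars p j" and g: "g \<in> carrier S"
    have "(g \<otimes>\<^bsub>S\<^esub> f) m \<in> p" if m: "set_mset m \<subseteq> {j..<n}" for m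
      unfolding coeff_mult
    proof (rule p.finsum_mem, rule p.I_l_closed)
      fix k
      have "set_mset (m - k) \<subseteq> {j..<n}" using m by (meson in_diffD subset_iff)
      then show "f (m - k) \<in> p" using f by (simp add: ext_vars_def)
    qed (use g coeff_closed in auto)
    then show "g \<otimes>\<^bsub>S\<^esub> f \<in> ext_vars p j" using f g by (simp add: ext_vars_def)
  qed (auto simp: ext_vars_def)
  show ?thesis
  proof (rule S.primeidealI'[OF ideal])
    have "\<one>\<^bsub>S\<^esub> {#} \<notin> p" using p.one_notin by (simp add: coeff_one)
    then show "\<one>\<^bsub>S\<^esub> \<notin> ext_vars p j"
      unfolding ext_vars_def by (metis (mono_tags, lifting) empty_subsetI mem_Collect_eq set_mset_empty)
  next
    fix f g assume fg: "f \<in> carrier S" "g \<in> carrier S" "f \<otimes>\<^bsub>S\<^esub> g \<in> ext_vars p j"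
    show "f \<in> ext_vars p j \<or> g \<in> ext_vars p j"
    proof (rule ccontr)
      assume n: "\<not> ?thesis"
      \<comment> \<open>The least monomial is taken, as a power series need not have a greatest one.
        Only monomials in the variables from x_j on count, and coefficients in \<open>p\<close> are
        treated as zero.\<close>
      define lm where "lm f = (LEAST m. set_mset m \<subseteq> {j..<n} \<and> f m \<notin> p)" for f :: "nat multiset \<Rightarrow> 'a"
      have lm: "set_mset (lm f) \<subseteq> {j..<n} \<and> f (lm f) \<notin> p"
        if "f \<in> carrier S" "f \<notin> ext_vars p j" for f
      proof -
        have "\<exists>m. set_mset m \<subseteq> {j..<n} \<and> f m \<notin> p" using that by (auto simp: ext_vars_def)
        then show ?thesis unfolding lm_def by (rule LeastI_ex)
      qed
      have below: "f m \<in> p" if "m < lm f" "set_mset m \<subseteq> {j..<n}" for f m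
        using not_less_Least[of m "\<lambda>m. set_mset m \<subseteq> {j..<n} \<and> f m \<notin> p"] that unfolding lm_def by blast
      define u v where "u = lm f" and "v = lm g"
      have u: "set_mset u \<subseteq> {j..<n}" "f u \<notin> p" and v: "set_mset v \<subseteq> {j..<n}" "g v \<notin> p"
        using lm[of f] lm[of g] fg n by (auto simp: u_def v_def)
      note c = coeff_closed[OF fg(1)] coeff_closed[OF fg(2)]
      let ?A = "{k. k \<subseteq># u + v}"
      \<comment> \<open>The order is compatible with addition: a factorization of u + v other than
        (u, v) has its first factor below u or its second below v, and the coefficient there lies in
        \<open>p\<close>.\<close>
      have other: "f k \<otimes> g (u + v - k) \<in> p" if k: "k \<in> ?A - {u}" for k
      proof -
        let ?l = "u + v - k"
        have kl: "k + ?l = u + v" using k by simp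
        have "set_mset (k + ?l) = set_mset (u + v)" by (rule arg_cong[OF kl])
        then have sets: "set_mset k \<subseteq> {j..<n}" "set_mset ?l \<subseteq> {j..<n}"
          using u(1) v(1) unfolding set_mset_union by blast+
        consider "k < u" | "u < k" using k by (cases k u rule: linorder_cases) auto
        then show ?thesis
        proof cases
          case 1
          then have "f k \<in> p" using below[of k f] sets(1) by (simp add: u_def)
          then show ?thesis using c by (simp add: p.I_r_closed)
        next
          case 2
          have "?l < v"
          proof (rule ccontr)
            assume "\<not> ?l < v"
            then have "u + v < k + ?l" using 2 by (intro add_less_le_mono) auto
            then show False by (simp only: kl less_irrefl)
          qed
          then have "g ?l \<in> p" using below[of ?l g] sets(2) by (simp add: v_def)
          then show ?thesis using c by (simp add: p.I_l_closed)
        qed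
      qed
      have "?A = insert u (?A - {u})" by auto
      then have "(f \<otimes>\<^bsub>S\<^esub> g) (u + v) = (\<Oplus>k\<in>insert u (?A - {u}). f k \<otimes> g (u + v - k))"
        unfolding coeff_mult by simp
      also have "\<dots> = f u \<otimes> g (u + v - u) \<oplus> (\<Oplus>k\<in>?A - {u}. f k \<otimes> g (u + v - k))"
        by (rule finsum_insert) (use c finite_submultisets in auto)
      finally have "f u \<otimes> g v \<oplus> (\<Oplus>k\<in>?A - {u}. f k \<otimes> g (u + v - k)) = (f \<otimes>\<^bsub>S\<^esub> g) (u + v)" by simp
      also have "\<dots> \<in> p" using fg(3) u(1) v(1) by (simp add: ext_vars_def)
      finally have sum: "f u \<otimes> g v \<oplus> (\<Oplus>k\<in>?A - {u}. f k \<otimes> g (u + v - k)) \<in> p" .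
      have rest: "(\<Oplus>k\<in>?A - {u}. f k \<otimes> g (u + v - k)) \<in> p"
        by (rule p.finsum_mem) (rule other)
      have "f u \<otimes> g v \<in> p" using p.add_cancel_mem[OF m_closed[OF c] rest sum] .
      then show False using p.mult_mem_iff c u(2) v(2) by simp
    qed
  qed
qed

lemma prime_chain_ext_vars:
  "prime_chain R I m p \<Longrightarrow> prime_chain S (ext I) m (ext_vars p 0)"
proof (induction m arbitrary: p)
  case 0
  then have "ext I \<subseteq> ext_vars p 0" by (auto simp: ext_def ext_vars_def)
  then show ?case using 0 primeideal_ext_vars by simp
next
  case (Suc m)
  then obtain q where q: "prime_chain R I m q" "q \<subset> p" "primeideal p R" by auto
  interpret p: primeideal p R by fact
  interpret q: primeideal q R using prime_chainD[OF q(1)] by simp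
  obtain a where a: "a \<in> p" "a \<notin> q" using q(2) by blast
  have "const a \<in> ext_vars p 0" "const a \<notin> ext_vars q 0"
    using a const_closed[OF p.Icarr[OF a(1)]] p.zero_closed by (auto simp: ext_vars_def mono_series_def)
  moreover have "ext_vars q 0 \<subseteq> ext_vars p 0" using q(2) by (auto simp: ext_vars_def)
  ultimately have "ext_vars q 0 \<subset> ext_vars p 0" by blast
  then show ?case by (rule prime_chain_SucI[OF Suc.IH[OF q(1)] _ primeideal_ext_vars[OF q(3)]])
qed

text \<open>On top of the extended chain the variables are adjoined one at a time; x_j lies in the
  prime with index j + 1 but not in the one with index j.\<close>

lemma prime_chain_ext_vars_add:
  assumes "prime_chain R I m p"
  shows "j \<le> n \<Longrightarrow> prime_chain S (ext I) (m + j) (ext_vars p j)"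
proof (induction j)
  case 0
  then show ?case using prime_chain_ext_vars[OF assms] by simp
next
  case (Suc j)
  have p: "primeideal p R" using prime_chainD[OF assms] by simp
  interpret p: primeideal p R by fact
  let ?x = "mono_series R \<one> {#j#}"
  have xS: "?x \<in> carrier S" using Suc.prems by (intro mono_series_closed) auto
  have "?x \<in> ext_vars p (Suc j)" using xS p.zero_closed by (auto simp: ext_vars_def mono_series_def)
  moreover have "?x \<notin> ext_vars p j"
  proof
    assume "?x \<in> ext_vars p j"
    then have "?x {#j#} \<in> p" using Suc.prems unfolding ext_vars_def by simp
    then show False using p.one_notin by (simp add: mono_series_def)
  qed
  moreover have "ext_vars p j \<subseteq> ext_vars p (Suc j)"
  proof -
    have "{Suc j..<n} \<subseteq> {j..<n}" by auto
    then show ?thesis unfolding ext_vars_def by blast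
  qed
  ultimately have "ext_vars p j \<subset> ext_vars p (Suc j)" by blast
  moreover have "prime_chain S (ext I) (m + j) (ext_vars p j)" using Suc by simp
  ultimately have "prime_chain S (ext I) (Suc (m + j)) (ext_vars p (Suc j))"
    by (intro prime_chain_SucI[OF _ _ primeideal_ext_vars[OF p]])
  then show ?case by simp
qed

end

section \<open>Dimensions and the comparison of the Cohen-Macaulay conditions\<close>

lemma chain_dim_eqI:
  assumes "prime_chain R J d p" "\<And>m q. prime_chain R J m q \<Longrightarrow> m \<le> d"
  shows "chain_dim R J = ereal (real d)"
  unfolding chain_dim_def
proof (rule antisym)
  show "Sup {ereal (real m) | m. \<exists>p. prime_chain R J m p} \<le> ereal (real d)"
    by (rule Sup_least) (use assms(2) in auto)
  show "ereal (real d) \<le> Sup {ereal (real m) | m. \<exists>p. prime_chain R J m p}"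
    by (rule Sup_upper) (use assms(1) in auto)
qed

lemma chain_dim_unbounded:
  assumes "\<And>d. \<exists>m p. prime_chain R J m p \<and> d < m"
  shows "chain_dim R J = \<infinity>"
proof (rule ereal_top)
  fix b :: real
  obtain d :: nat where "b < real d" using reals_Archimedean2 by blast
  moreover obtain m p where "prime_chain R J m p" "d < m" using assms by blast
  moreover from this have "ereal (real m) \<le> chain_dim R J"
    unfolding chain_dim_def by (intro Sup_upper) blast
  ultimately show "ereal b \<le> chain_dim R J"
    by (meson ereal_less_eq(3) less_imp_le of_nat_less_iff order_trans)
qed

context power_series_ring
begin

text \<open>If lengths are bounded, a longest chain prolonged by the n variables meets the bound;
  otherwise both sides are infinite. The upper bound is a hypothesis because polynomials and power
  series reach it in different ways.\<close>

theorem chain_dim_ext: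
  assumes "prime_chain R I 0 p"
    and upper: "\<And>d. (\<And>m p. prime_chain R I m p \<Longrightarrow> m \<le> d) \<Longrightarrow>
      (\<And>m p. prime_chain S (ext I) m p \<Longrightarrow> m \<le> d + n)"
  shows "chain_dim S (ext I) = chain_dim R I + ereal (real n)"
proof (cases "\<exists>d. \<forall>m p. prime_chain R I m p \<longrightarrow> m \<le> d")
  case True
  then have fin: "finite {m. \<exists>p. prime_chain R I m p}" by (auto simp: finite_nat_set_iff_bounded_le)
  define d where "d = Max {m. \<exists>p. prime_chain R I m p}"
  have "d \<in> {m. \<exists>p. prime_chain R I m p}"
    unfolding d_def by (rule Max_in[OF fin]) (use assms(1) in blast)
  then obtain q where q: "prime_chain R I d q" by blast
  have bound: "m \<le> d" if "prime_chain R I m p" for m p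
    unfolding d_def using fin that by (intro Max_ge) auto
  have "chain_dim S (ext I) = ereal (real (d + n))"
    by (rule chain_dim_eqI[OF prime_chain_ext_vars_add[OF q order_refl]]) (rule upper[OF bound])
  moreover have "chain_dim R I = ereal (real d)" using q bound by (rule chain_dim_eqI)
  ultimately show ?thesis by simp
next
  case False
  then have un: "\<exists>m p. prime_chain R I m p \<and> d < m" for d by (meson not_le)
  have "\<exists>m p. prime_chain S (ext I) m p \<and> d < m" for d
  proof -
    obtain m p where "prime_chain R I m p" "d < m" using un by blast
    then have "prime_chain S (ext I) (m + n) (ext_vars p n)" "d < m + n"
      using prime_chain_ext_vars_add[of I m p n] by simp_all
    then show ?thesis by blast
  qed
  then show ?thesis using un chain_dim_unbounded[of R I] chain_dim_unbounded[of S "ext I"] by simp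
qed

text \<open>The dimension formula is applied to \<open>I\<close> and to the zero ideal: both
  dimensions in the definition grow by n, while the grade stays.\<close>

theorem cohen_macaulay_ext_iff:
  assumes "noetherian_cring R" "noetherian_cring S" and I: "ideal I R" "I \<noteq> carrier R"
    and upper: "\<And>K d. ideal K R \<Longrightarrow> (\<And>m p. prime_chain R K m p \<Longrightarrow> m \<le> d) \<Longrightarrow>
      (\<And>m p. prime_chain S (ext K) m p \<Longrightarrow> m \<le> d + n)"
  shows "ideal_cohen_macaulay_ring R I \<longleftrightarrow> ideal_cohen_macaulay_ring S (ext I)"
proof -
  interpret R: noetherian_cring R by fact
  interpret S: noetherian_cring S by fact
  have dim: "chain_dim S (ext K) = chain_dim R K + ereal (real n)"
    if K: "ideal K R" "K \<noteq> carrier R" for K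
  proof -
    obtain p where "primeideal p R" "K \<subseteq> p" using R.ex_prime_supset[OF K] .
    then have "prime_chain R K 0 p" by simp
    then show ?thesis by (rule chain_dim_ext) (rule upper[OF K(1)])
  qed
  have "{\<zero>} \<noteq> carrier R"
    using I ideal.one_imp_carrier[OF I(1)] additive_subgroup.zero_closed[OF ideal.axioms(1)[OF I(1)]]
    by (metis one_closed singletonD)
  then have "chain_dim S {\<zero>\<^bsub>S\<^esub>} = chain_dim R {\<zero>} + ereal (real n)"
    using dim[OF zeroideal] by (simp add: ext_zero)
  \<comment> \<open>Here b and d may be infinite; only the finite summand c is cancelled.\<close>
  moreover have "ereal a + (b + ereal c) = d + ereal c \<longleftrightarrow> ereal a + b = d" for a b c d
    by (cases b; cases d) auto
  ultimately show ?thesis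
    using R.ideal_cohen_macaulay_ring_iff[OF I]
      S.ideal_cohen_macaulay_ring_iff[OF ext_ideal[OF I(1)] ext_proper[OF I]]
    by (simp add: dim[OF I] grade_ext[OF assms(1,2) I])
qed

end

text \<open>Generators of the preimage of an ideal map to generators.\<close>

lemma (in surjective_ring_hom) noetherian_image:
  assumes "noetherian_cring R"
  shows "noetherian_cring S"
proof (rule S.noetherianI)
  interpret noetherian_cring R by fact
  fix N assume N: "ideal N S"
  have Nc: "N \<subseteq> carrier S" using ideal.Icarr[OF N] by blast
  have "{r \<in> carrier R. h r \<in> N} \<subseteq> carrier R" by blast
  then obtain F where F: "finite F" "F \<subseteq> {r \<in> carrier R. h r \<in> N}" "{r \<in> carrier R. h r \<in> N} \<subseteq> Idl F"
    by (rule finite_subset_generates)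
  have hF: "h ` F \<subseteq> carrier S" "h ` F \<subseteq> N" using F(2) Nc by auto
  have I: "ideal (Idl\<^bsub>S\<^esub> (h ` F)) S" using hF(1) by (rule S.genideal_ideal)
  have "ring_hom_ring R S h" ..
  then have "ideal {r \<in> carrier R. h r \<in> Idl\<^bsub>S\<^esub> (h ` F)} R"
    using I by (rule ring_hom_ring.ideal_vimage)
  moreover have "F \<subseteq> {r \<in> carrier R. h r \<in> Idl\<^bsub>S\<^esub> (h ` F)}"
    using S.genideal_self[OF hF(1)] F(2) by blast
  ultimately have sub: "Idl F \<subseteq> {r \<in> carrier R. h r \<in> Idl\<^bsub>S\<^esub> (h ` F)}" by (rule R.genideal_minimal)
  have "N \<subseteq> Idl\<^bsub>S\<^esub> (h ` F)"
  proof
    fix y assume y: "y \<in> N"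
    then obtain r where "r \<in> carrier R" "h r = y" using surj Nc by (metis imageE subsetD)
    then show "y \<in> Idl\<^bsub>S\<^esub> (h ` F)" using y F(3) sub by blast
  qed
  then show "\<exists>F. finite F \<and> F \<subseteq> N \<and> N \<subseteq> Idl\<^bsub>S\<^esub> F" using F(1) hF(2) by blast
qed

subsection \<open>Adding one variable\<close>

text \<open>The remainder of f on division by the variable x_n; \<open>shift_part\<close> is the
  quotient.\<close>

definition coeff_part :: "('a, 'm) ring_scheme \<Rightarrow> nat \<Rightarrow> (nat multiset \<Rightarrow> 'a) \<Rightarrow> nat multiset \<Rightarrow> 'a"
  where "coeff_part R n f = (\<lambda>m. if n \<in># m then \<zero>\<^bsub>R\<^esub> else f m)"

definition shift_part :: "nat \<Rightarrow> (nat multiset \<Rightarrow> 'a) \<Rightarrow> nat multiset \<Rightarrow> 'a"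
  where "shift_part n f = (\<lambda>m. f (add_mset n m))"

text \<open>The operations do not depend on the number of variables, so the smaller ring is the
  larger one with a smaller carrier, as \<open>noetherian_extension\<close> expects.\<close>

lemma mseries_ring_restrict:
  "mseries_ring R k\<lparr>carrier := mseries_carrier R n\<rparr> = mseries_ring R n"
  "mpoly_ring R k\<lparr>carrier := mpoly_carrier R n\<rparr> = mpoly_ring R n"
  by (simp_all add: mseries_ring_def mpoly_ring_def)

lemma mpoly_ring_simps [simp]:
  "carrier (mpoly_ring R n) = mpoly_carrier R n"
  "mult (mpoly_ring R n) = mult (mseries_ring R n)"
  "one (mpoly_ring R n) = one (mseries_ring R n)"
  "zero (mpoly_ring R n) = zero (mseries_ring R n)"
  "add (mpoly_ring R n) = add (mseries_ring R n)"
  by (simp_all add: mpoly_ring_def)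

lemma mseries_carrier_mono: "mseries_carrier R n \<subseteq> mseries_carrier R (Suc n)"
  by (auto simp: mseries_carrier_def lessThan_Suc)

lemma mpoly_carrier_mono: "mpoly_carrier R n \<subseteq> mpoly_carrier R (Suc n)"
  using mseries_carrier_mono by (auto simp: mpoly_carrier_def)

context cring
begin

lemma mseries_power_series_ring: "power_series_ring R (mseries_ring R n) n"
proof (intro power_series_ring.intro power_series_ring_axioms.intro cring_axioms mseries_cring)
  fix f g assume f: "f \<in> carrier (mseries_ring R n)" and g: "\<And>m. g m \<in> carrier R"
    "\<And>m. f m = \<zero> \<Longrightarrow> g m = \<zero>"
  then show "g \<in> carrier (mseries_ring R n)" by (auto simp: mseries_carrier_def)
next
  fix a u assume "a \<in> carrier R" "set_mset u \<subseteq> {..<n}"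
  then show "mono_series R a u \<in> carrier (mseries_ring R n)" by (auto simp: mseries_carrier_def mono_series_def)
qed simp_all

lemma mpoly_power_series_ring: "power_series_ring R (mpoly_ring R n) n"
proof (intro power_series_ring.intro power_series_ring_axioms.intro cring_axioms mpoly_cring)
  show "carrier (mpoly_ring R n) \<subseteq> mseries_carrier R n" by (auto simp: mpoly_carrier_def)
  fix f g assume f: "f \<in> carrier (mpoly_ring R n)" and g: "\<And>m. g m \<in> carrier R"
    "\<And>m. f m = \<zero> \<Longrightarrow> g m = \<zero>"
  have "{m. g m \<noteq> \<zero>} \<subseteq> {m. f m \<noteq> \<zero>}" using g(2) by blast
  then have "finite {m. g m \<noteq> \<zero>}" by (rule finite_subset) (use f in \<open>simp add: mpoly_carrier_def\<close>)
  moreover have "g \<in> mseries_carrier R n" using f g by (auto simp: mpoly_carrier_def mseries_carrier_def)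
  ultimately show "g \<in> carrier (mpoly_ring R n)" by (simp add: mpoly_carrier_def)
next
  fix a u assume au: "a \<in> carrier R" "set_mset u \<subseteq> {..<n}"
  have "finite {m. mono_series R a u m \<noteq> \<zero>}" by (rule finite_subset[of _ "{u}"]) (auto simp: mono_series_def)
  moreover have "mono_series R a u \<in> mseries_carrier R n" using au by (auto simp: mseries_carrier_def mono_series_def)
  ultimately show "mono_series R a u \<in> carrier (mpoly_ring R n)" by (simp add: mpoly_carrier_def)
qed simp_all

lemma ext_mseries: "power_series_ring.ext (mseries_ring R n) K = mseries_ideal R n K"
  using power_series_ring.ext_def[OF mseries_power_series_ring] by (simp add: mseries_ideal_def)

lemma ext_mpoly: "power_series_ring.ext (mpoly_ring R n) K = mpoly_ideal R n K"
  using power_series_ring.ext_def[OF mpoly_power_series_ring] by (simp add: mpoly_ideal_def)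

lemma var_mult:
  assumes "f \<in> mseries_carrier R k"
  shows "(mono_series R \<one> {#n#} \<otimes>\<^bsub>mseries_ring R k\<^esub> f) m = (if n \<in># m then f (m - {#n#}) else \<zero>)"
  using assms by (simp add: mono_series_mult mseries_carrierD)

lemma decompose_variable:
  assumes f: "f \<in> mseries_carrier R (Suc n)"
  shows "coeff_part R n f \<in> mseries_carrier R n" "shift_part n f \<in> mseries_carrier R (Suc n)"
    "f = coeff_part R n f \<oplus>\<^bsub>mseries_ring R k\<^esub> mono_series R \<one> {#n#} \<otimes>\<^bsub>mseries_ring R (Suc n)\<^esub> shift_part n f"
proof -
  note fc = mseries_carrierD[OF f]
  show "coeff_part R n f \<in> mseries_carrier R n"
    unfolding mseries_carrier_def
  proof (intro CollectI conjI allI impI)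
    fix m :: "nat multiset"
    show "coeff_part R n f m \<in> carrier R" using fc by (simp add: coeff_part_def)
    assume "\<not> set_mset m \<subseteq> {..<n}"
    then obtain i where i: "i \<in># m" "\<not> i < n" by auto
    show "coeff_part R n f m = \<zero>"
    proof (cases "n \<in># m")
      case False
      then have "\<not> i < Suc n" using i by (metis less_SucE)
      then have "\<not> set_mset m \<subseteq> {..<Suc n}" using i(1) by blast
      then show ?thesis using mseries_carrier_outside[OF f] by (simp add: coeff_part_def)
    qed (simp add: coeff_part_def)
  qed
  show s: "shift_part n f \<in> mseries_carrier R (Suc n)"
    using f by (auto simp: mseries_carrier_def shift_part_def)
  show "f = coeff_part R n f \<oplus>\<^bsub>mseries_ring R k\<^esub> mono_series R \<one> {#n#} \<otimes>\<^bsub>mseries_ring R (Suc n)\<^esub> shift_part n f"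
    using fc by (simp add: fun_eq_iff var_mult[OF s]) (simp add: coeff_part_def shift_part_def)
qed

lemma mseries_extension:
  assumes "noetherian_cring (mseries_ring R n)"
  shows "series_extension (mseries_ring R (Suc n)) (mseries_carrier R n) (mono_series R \<one> {#n#})"
proof -
  interpret S: power_series_ring R "mseries_ring R (Suc n)" "Suc n" by (rule mseries_power_series_ring)
  show ?thesis
  proof (intro series_extension.intro noetherian_extension.intro noetherian_extension_axioms.intro
      series_extension_axioms.intro S.S.cring_axioms)
    show "mseries_carrier R n \<subseteq> carrier (mseries_ring R (Suc n))" using mseries_carrier_mono by simp
    show "noetherian_cring (mseries_ring R (Suc n)\<lparr>carrier := mseries_carrier R n\<rparr>)"
      using assms by (simp add: mseries_ring_restrict)
    show "mono_series R \<one> {#n#} \<in> carrier (mseries_ring R (Suc n))" by (rule S.mono_series_closed) auto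
  next
    fix f assume "f \<in> carrier (mseries_ring R (Suc n))"
    then show "\<exists>a\<in>mseries_carrier R n. \<exists>g\<in>carrier (mseries_ring R (Suc n)).
        f = a \<oplus>\<^bsub>mseries_ring R (Suc n)\<^esub> mono_series R \<one> {#n#} \<otimes>\<^bsub>mseries_ring R (Suc n)\<^esub> g"
      using decompose_variable[of f n] by (metis mseries_ring_simps(1))
  next
    fix c :: "nat \<Rightarrow> nat multiset \<Rightarrow> 'a"
    assume c: "\<And>k. c k \<in> carrier (mseries_ring R (Suc n))"
    then have cS: "c k \<in> mseries_carrier R (Suc n)" for k by simp
    note cc = mseries_carrierD[OF cS]
    \<comment> \<open>\<open>s k\<close> is the sum of all x_n^j c (k + j). At the monomial m only
      those j contribute that do not exceed the exponent of x_n in m, so each coefficient is a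
      finite sum.\<close>
    define s where "s k m = (\<Oplus>j\<in>{..count m n}. c (k + j) (m - replicate_mset j n))"
      for k :: nat and m :: "nat multiset"
    have sS: "s k \<in> mseries_carrier R (Suc n)" for k
      unfolding mseries_carrier_def
    proof (intro CollectI conjI allI impI)
      fix m :: "nat multiset"
      show "s k m \<in> carrier R" unfolding s_def using cc by (auto intro!: finsum_closed)
      assume m: "\<not> set_mset m \<subseteq> {..<Suc n}"
      then obtain i where i: "i \<in># m" "\<not> i < Suc n" by auto
      show "s k m = \<zero>" unfolding s_def
      proof (rule finsum_eq_zero)
        fix j
        have "i \<in># m - replicate_mset j n" using i by (simp add: in_diff_count)
        then have "\<not> set_mset (m - replicate_mset j n) \<subseteq> {..<Suc n}" using i(2) by blast
        then show "c (k + j) (m - replicate_mset j n) = \<zero>" by (rule mseries_carrier_outside[OF cS])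
      qed
    qed
    have rec: "s k = c k \<oplus>\<^bsub>mseries_ring R (Suc n)\<^esub> mono_series R \<one> {#n#} \<otimes>\<^bsub>mseries_ring R (Suc n)\<^esub> s (Suc k)" for k
    proof
      fix m
      show "s k m = (c k \<oplus>\<^bsub>mseries_ring R (Suc n)\<^esub> mono_series R \<one> {#n#} \<otimes>\<^bsub>mseries_ring R (Suc n)\<^esub> s (Suc k)) m"
      proof (cases "count m n")
        case 0
        then have "n \<notin># m" by (simp add: not_in_iff)
        then show ?thesis using 0 cc by (simp add: s_def var_mult[OF sS])
      next
        case (Suc q)
        then have nm: "n \<in># m" by (metis count_eq_zero_iff nat.distinct(1))
        \<comment> \<open>The term with j = 0 is split off; the others form the coefficient of
          \<open>s (Suc k)\<close> at m with one x_n removed.\<close>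
        have "s k m = (\<Oplus>j\<in>{..q}. c (k + Suc j) (m - replicate_mset (Suc j) n)) \<oplus> c k m"
          unfolding s_def Suc using cc by (subst finsum_Suc2) auto
        also have "(\<Oplus>j\<in>{..q}. c (k + Suc j) (m - replicate_mset (Suc j) n)) = s (Suc k) (m - {#n#})"
          unfolding s_def using Suc cc by (intro finsum_cong') (auto simp: diff_diff_add_mset)
        finally show ?thesis
          using nm cc mseries_carrierD[OF sS] by (simp add: var_mult[OF sS] a_comm)
      qed
    qed
    show "\<exists>s. \<forall>k. s k \<in> carrier (mseries_ring R (Suc n)) \<and> s k =
        c k \<oplus>\<^bsub>mseries_ring R (Suc n)\<^esub> mono_series R \<one> {#n#} \<otimes>\<^bsub>mseries_ring R (Suc n)\<^esub> s (Suc k)"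
      by (intro exI[of _ s] allI conjI, simp add: sS, rule rec)
  next
    fix h :: "nat \<Rightarrow> nat multiset \<Rightarrow> 'a"
    assume h: "\<And>k. h k \<in> carrier (mseries_ring R (Suc n))"
      "\<And>k. h k = mono_series R \<one> {#n#} \<otimes>\<^bsub>mseries_ring R (Suc n)\<^esub> h (Suc k)"
    have hc: "h k \<in> mseries_carrier R (Suc n)" for k using h(1) by simp
    have eq: "h k m = (if n \<in># m then h (Suc k) (m - {#n#}) else \<zero>)" for k m
      using fun_cong[OF h(2)[of k], of m] unfolding var_mult[OF hc] .
    \<comment> \<open>Each passage from \<open>h k\<close> to \<open>h (Suc k)\<close> removes one
      x_n from the monomial, until none is left.\<close>
    have "h k m = \<zero>" for k m
    proof (induction "count m n" arbitrary: k m)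
      case 0
      then have "n \<notin># m" by (simp add: not_in_iff)
      then show ?case using eq[of k m] by simp
    next
      case (Suc q)
      have "h (Suc k) (m - {#n#}) = \<zero>" by (rule Suc.hyps(1)) (use Suc.hyps(2) in simp)
      then show ?case using eq[of k m] by simp
    qed
    then show "h 0 = \<zero>\<^bsub>mseries_ring R (Suc n)\<^esub>" by auto
  qed
qed

lemma mpoly_extension:
  assumes "noetherian_cring (mpoly_ring R n)"
  shows "polynomial_extension (mpoly_ring R (Suc n)) (mpoly_carrier R n) (mono_series R \<one> {#n#})"
proof -
  interpret S: power_series_ring R "mpoly_ring R (Suc n)" "Suc n" by (rule mpoly_power_series_ring)
  interpret T: power_series_ring R "mpoly_ring R n" n by (rule mpoly_power_series_ring)
  show ?thesis
  proof (intro polynomial_extension.intro noetherian_extension.intro noetherian_extension_axioms.intro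
      polynomial_extension_axioms.intro S.S.cring_axioms)
    show "mpoly_carrier R n \<subseteq> carrier (mpoly_ring R (Suc n))" using mpoly_carrier_mono by simp
    show "noetherian_cring (mpoly_ring R (Suc n)\<lparr>carrier := mpoly_carrier R n\<rparr>)"
      using assms by (simp add: mseries_ring_restrict)
    show "mono_series R \<one> {#n#} \<in> carrier (mpoly_ring R (Suc n))" by (rule S.mono_series_closed) auto
  next
    fix U assume U0: "\<zero>\<^bsub>mpoly_ring R (Suc n)\<^esub> \<in> U"
      and U: "\<And>a g. a \<in> mpoly_carrier R n \<Longrightarrow> g \<in> U \<Longrightarrow> g \<in> carrier (mpoly_ring R (Suc n)) \<Longrightarrow>
        a \<oplus>\<^bsub>mpoly_ring R (Suc n)\<^esub> mono_series R \<one> {#n#} \<otimes>\<^bsub>mpoly_ring R (Suc n)\<^esub> g \<in> U"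
    \<comment> \<open>Induction on a strict bound \<open>d\<close> for the degree in x_n, which
      \<open>shift_part\<close> lowers by one.\<close>
    have main: "f \<in> mpoly_carrier R (Suc n) \<Longrightarrow> (\<And>m. d \<le> count m n \<Longrightarrow> f m = \<zero>) \<Longrightarrow> f \<in> U" for f d
    proof (induction d arbitrary: f)
      case 0
      then have "f = (\<lambda>m. \<zero>)" by auto
      then show ?case using U0 by simp
    next
      case (Suc d)
      have fS: "f \<in> mseries_carrier R (Suc n)" and fin: "finite {m. f m \<noteq> \<zero>}"
        using Suc.prems(1) by (simp_all add: mpoly_carrier_def)
      note dec = decompose_variable[OF fS]
      have "{m. coeff_part R n f m \<noteq> \<zero>} \<subseteq> {m. f m \<noteq> \<zero>}" by (auto simp: coeff_part_def)
      then have a: "coeff_part R n f \<in> mpoly_carrier R n"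
        using dec(1) finite_subset[OF _ fin] by (simp add: mpoly_carrier_def)
      have "add_mset n ` {m. shift_part n f m \<noteq> \<zero>} \<subseteq> {m. f m \<noteq> \<zero>}" by (auto simp: shift_part_def)
      then have "finite (add_mset n ` {m. shift_part n f m \<noteq> \<zero>})" using fin by (rule finite_subset)
      then have "finite {m. shift_part n f m \<noteq> \<zero>}" by (rule finite_imageD) (simp add: inj_on_def)
      then have g: "shift_part n f \<in> mpoly_carrier R (Suc n)"
        using dec(2) by (simp add: mpoly_carrier_def)
      have "shift_part n f \<in> U"
        by (rule Suc.IH[OF g]) (use Suc.prems(2) in \<open>simp add: shift_part_def\<close>)
      then have "coeff_part R n f \<oplus>\<^bsub>mpoly_ring R (Suc n)\<^esub>
          mono_series R \<one> {#n#} \<otimes>\<^bsub>mpoly_ring R (Suc n)\<^esub> shift_part n f \<in> U"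
        using g by (intro U[OF a]) simp_all
      then show ?case using dec(3)[of "Suc n"] by simp
    qed
    show "carrier (mpoly_ring R (Suc n)) \<subseteq> U"
    proof
      fix f assume f: "f \<in> carrier (mpoly_ring R (Suc n))"
      then have "finite ((\<lambda>m. count m n) ` {m. f m \<noteq> \<zero>})" by (simp add: mpoly_carrier_def)
      then obtain d where d: "\<forall>i\<in>(\<lambda>m. count m n) ` {m. f m \<noteq> \<zero>}. i < d"
        using finite_nat_set_iff_bounded by blast
      show "f \<in> U"
      proof (rule main[of f d])
        show "f \<in> mpoly_carrier R (Suc n)" using f by simp
        show "f m = \<zero>" if "d \<le> count m n" for m using d that by (meson imageI leD mem_Collect_eq)
      qed
    qed
  qed
qed

text \<open>Without variables only the empty monomial can have a nonzero coefficient. This starts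
  the induction on the number of variables.\<close>

lemma const_surjective_0:
  assumes S: "power_series_ring R S 0"
  shows "surjective_ring_hom R S (\<lambda>a. mono_series R a {#})"
proof -
  interpret S: power_series_ring R S 0 by fact
  show ?thesis
  proof (intro surjective_ring_hom.intro ring_hom_cring.intro surjective_ring_hom_axioms.intro
      ring_hom_cring_axioms.intro cring_axioms S.S.cring_axioms S.const_hom)
    have "f \<in> (\<lambda>a. mono_series R a {#}) ` carrier R" if f: "f \<in> carrier S" for f
    proof -
      have "f \<in> mseries_carrier R 0" using f S.carrier_sub by blast
      then have "f = mono_series R (f {#}) {#}" by (auto simp: fun_eq_iff mono_series_def mseries_carrier_def)
      then show ?thesis using S.coeff_closed[OF f] by blast
    qed
    then show "(\<lambda>a. mono_series R a {#}) ` carrier R = carrier S" using S.const_closed by blast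
  qed
qed

lemma chain_bound_0:
  assumes S: "power_series_ring R S 0" and K: "ideal K R"
    and bound: "\<And>m p. prime_chain R K m p \<Longrightarrow> m \<le> d"
    and chain: "prime_chain S (power_series_ring.ext S K) m p"
  shows "m \<le> d"
proof -
  interpret S: power_series_ring R S 0 by fact
  interpret h: surjective_ring_hom R S "\<lambda>a. mono_series R a {#}" by (rule const_surjective_0[OF S])
  have "{r \<in> carrier R. mono_series R r {#} \<in> S.ext K} = K"
    using S.const_mem_ext_iff[OF K] ideal.Icarr[OF K] by blast
  then show ?thesis using h.prime_chain_vimage[OF chain] bound by simp
qed

end

section \<open>Induction on the number of variables\<close>

context noetherian_cring
begin

lemma mseries_noetherian: "noetherian_cring (mseries_ring R n)"
proof (induction n)
  case 0
  show ?case
    using surjective_ring_hom.noetherian_image[OF const_surjective_0[OF mseries_power_series_ring]]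
      noetherian_cring_axioms by blast
next
  case (Suc n)
  show ?case by (rule series_extension.noetherian[OF mseries_extension[OF Suc]])
qed

lemma mpoly_noetherian: "noetherian_cring (mpoly_ring R n)"
proof (induction n)
  case 0
  show ?case
    using surjective_ring_hom.noetherian_image[OF const_surjective_0[OF mpoly_power_series_ring]]
      noetherian_cring_axioms by blast
next
  case (Suc n)
  show ?case by (rule polynomial_extension.noetherian[OF mpoly_extension[OF Suc]])
qed

text \<open>A chain over the ideal in n + 1 variables is measured against the ideal in n variables,
  which it contains and for which the induction hypothesis supplies the bound d + n.\<close>

lemma mseries_chain_bound:
  assumes K: "ideal K R" and bound: "\<And>m p. prime_chain R K m p \<Longrightarrow> m \<le> d"
  shows "prime_chain (mseries_ring R n) (mseries_ideal R n K) m p \<Longrightarrow> m \<le> d + n"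
proof (induction n arbitrary: m p)
  case 0
  then show ?case
    using chain_bound_0[OF mseries_power_series_ring K bound] by (simp add: ext_mseries)
next
  case (Suc n)
  interpret S: series_extension "mseries_ring R (Suc n)" "mseries_carrier R n" "mono_series R \<one> {#n#}"
    by (rule mseries_extension[OF mseries_noetherian])
  have "ideal (mseries_ideal R n K) (mseries_ring R n)"
    using power_series_ring.ext_ideal[OF mseries_power_series_ring K] by (simp add: ext_mseries)
  moreover have "mseries_ideal R n K \<subseteq> mseries_ideal R (Suc n) K"
    using mseries_carrier_mono by (auto simp: mseries_ideal_def)
  ultimately have "m \<le> Suc (d + n)"
    using S.chain_bound[of "mseries_ideal R n K" "mseries_ideal R (Suc n) K" "d + n" m p] Suc
    by (simp add: mseries_ring_restrict)
  then show ?case by simp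
qed

lemma mpoly_chain_bound:
  assumes K: "ideal K R" and bound: "\<And>m p. prime_chain R K m p \<Longrightarrow> m \<le> d"
  shows "prime_chain (mpoly_ring R n) (mpoly_ideal R n K) m p \<Longrightarrow> m \<le> d + n"
proof (induction n arbitrary: m p)
  case 0
  then show ?case
    using chain_bound_0[OF mpoly_power_series_ring K bound] by (simp add: ext_mpoly)
next
  case (Suc n)
  interpret S: polynomial_extension "mpoly_ring R (Suc n)" "mpoly_carrier R n" "mono_series R \<one> {#n#}"
    by (rule mpoly_extension[OF mpoly_noetherian])
  have "ideal (mpoly_ideal R n K) (mpoly_ring R n)"
    using power_series_ring.ext_ideal[OF mpoly_power_series_ring K] by (simp add: ext_mpoly)
  moreover have "mpoly_ideal R n K \<subseteq> mpoly_ideal R (Suc n) K"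
    using mpoly_carrier_mono by (auto simp: mpoly_ideal_def)
  ultimately have "m \<le> Suc (d + n)"
    using S.chain_bound[of "mpoly_ideal R n K" "mpoly_ideal R (Suc n) K" "d + n" m p] Suc
    by (simp add: mseries_ring_restrict)
  then show ?case by simp
qed

end

theorem theorem2p16:
  fixes R :: "('a, 'm) ring_scheme" and I :: "'a set" and n :: nat
  assumes "cring R" and "noetherian_ring R"
    and "ideal I R" and "I \<noteq> carrier R"
    and "n \<ge> 1"
  shows "(ideal_cohen_macaulay_ring R I \<longleftrightarrow>
           ideal_cohen_macaulay_ring (mpoly_ring R n) (mpoly_ideal R n I) \<and>
           grade (mpoly_ring R n) (mpoly_ideal R n I) (self_module (mpoly_ring R n))
             = grade R I (self_module R)) \<and>
         (ideal_cohen_macaulay_ring R I \<longleftrightarrow>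
           ideal_cohen_macaulay_ring (mseries_ring R n) (mseries_ideal R n I) \<and>
           grade (mseries_ring R n) (mseries_ideal R n I) (self_module (mseries_ring R n))
             = grade R I (self_module R))"
proof -
  have R: "noetherian_cring R" using assms(1,2) by (simp add: noetherian_cring_def)
  interpret noetherian_cring R by (rule R)
  interpret P: power_series_ring R "mpoly_ring R n" n by (rule mpoly_power_series_ring)
  interpret S: power_series_ring R "mseries_ring R n" n by (rule mseries_power_series_ring)
  note I = assms(3,4)
  have "ideal_cohen_macaulay_ring R I \<longleftrightarrow> ideal_cohen_macaulay_ring (mpoly_ring R n) (mpoly_ideal R n I)"
    using P.cohen_macaulay_ext_iff[OF R mpoly_noetherian I] mpoly_chain_bound
    unfolding ext_mpoly by blast
  moreover have "ideal_cohen_macaulay_ring R I \<longleftrightarrow>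
      ideal_cohen_macaulay_ring (mseries_ring R n) (mseries_ideal R n I)"
    using S.cohen_macaulay_ext_iff[OF R mseries_noetherian I] mseries_chain_bound
    unfolding ext_mseries by blast
  \<comment> \<open>The grade equations hold for every proper ideal, whatever the Cohen-Macaulay
    condition says.\<close>
  ultimately show ?thesis
    using P.grade_ext[OF R mpoly_noetherian I] S.grade_ext[OF R mseries_noetherian I]
    unfolding ext_mpoly ext_mseries by blast
qed

end
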